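(* Let $G$ be a quasi-split connected reductive group over a $p$-adic field $F$. A Langlands parameter $\phi:W_F\times SL_2(\mathbb C)\to{}^LG$ is tempered if and only if it is open and of Arthur type.
   Context: $W_F$ is the Weil group of $F$, $|\cdot|$ its norm, $\mathrm{Fr}\in W_F$ a Frobenius element with $|\mathrm{Fr}|=q^{-1}$. $\widehat G$ is the dual group with Lie algebra $\widehat{\mathfrak g}$, ${}^LG=\widehat G\rtimes W_F$. A Langlands parameter is a continuous homomorphism $\phi:W_F\times SL_2(\mathbb C)\to{}^LG$, compatible with the projections to $W_F$, with $\phi(\mathrm{Fr})$ semisimple and $\phi|_{SL_2(\mathbb C)}$ algebraic. Tempered: the restriction of $\phi$ to $W_F$ has bounded image in $\widehat G$ (after projecting ${}^LG\to\widehat G$). Arthur type: there is an Arthur parameter $\psi:W_F\times SL_2(\mathbb C)\times SL_2(\mathbb C)\to{}^LG$ (a homomorphism satisfying the analogous conditions, with $\psi|_{W_F}$ having bounded image in $\widehat G$) such that $\phi(w,x)=\psi(w,x,\mathrm{diag}(|w|^{1/2},|w|^{-1/2}))$. Open: let $\lambda(w)=\phi(w,\mathrm{diag}(|w|^{1/2},|w|^{-1/2}))$ be the infinitesimal parameter, $V_\lambda=\{x\in\widehat{\mathfrak g}:\mathrm{Ad}(\lambda(w))x=|w|x\ \forall w\in W_F\}$, and $H_\lambda=Z_{\widehat G}(\lambda)$, which acts on $V_\lambda$ with finitely many orbits and a unique open orbit; $\phi$ is open if $x_\phi=d\phi\left(\begin{smallmatrix}0&1\\0&0\end{smallmatrix}\right)\in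 V_\lambda$ lies in the open $H_\lambda$-orbit. *)

theory Defs
  imports
    "HOL-Analysis.Analysis"
    "HOL-Algebra.Algebraic_Closure_Type"
    "HOL-Algebra.Solvable_Groups"
begin

section \<open>The Weil group of a p-adic field\<close>

text \<open>
  A p-adic field is taken to be a field of characteristic zero which is complete for a nontrivial
  discrete non-archimedean absolute value \<open>v\<close> with finite residue field.
\<close>

definition residue_card :: "('f::field \<Rightarrow> real) \<Rightarrow> nat" where
  "residue_card v = card ({x. v x \<le> 1} // {(x, y). v x \<le> 1 \<and> v y \<le> 1 \<and> v (x - y) < 1})"

definition padic_field :: "('f::field_char_0 \<Rightarrow> real) \<Rightarrow> bool" where
  "padic_field v \<longleftrightarrow>
     (\<forall>x. v x \<ge> 0) \<and> (\<forall>x. v x = 0 \<longleftrightarrow> x = 0) \<and>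
     (\<forall>x y. v (x * y) = v x * v y) \<and> (\<forall>x y. v (x + y) \<le> max (v x) (v y)) \<and>
     (\<exists>p. 0 < v p \<and> v p < 1 \<and> (\<forall>x. v x < 1 \<longrightarrow> v x \<le> v p)) \<and>
     (\<forall>s::nat \<Rightarrow> 'f.
        (\<forall>e>0. \<exists>N. \<forall>m\<ge>N. \<forall>n\<ge>N. v (s m - s n) < e) \<longrightarrow>
        (\<exists>l. \<forall>e>0. \<exists>N. \<forall>n\<ge>N. v (s n - l) < e)) \<and>
     finite ({x. v x \<le> 1} // {(x, y). v x \<le> 1 \<and> v y \<le> 1 \<and> v (x - y) < 1})"

text \<open>
  The ring of integers of the algebraic closure is the integral closure of the ring of integers
  of the base field; its maximal ideal consists of the elements that are integral over the maximal
  ideal of the base (equivalently, those of absolute value less than one).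
\<close>

definition ac_integers :: "('f::field \<Rightarrow> real) \<Rightarrow> 'f alg_closure set" where
  "ac_integers v = {x. \<exists>p::'f poly. Polynomial.lead_coeff p = 1 \<and> (\<forall>i. v (Polynomial.coeff p i) \<le> 1) \<and>
     poly (map_poly to_ac p) x = 0}"

definition ac_maximal_ideal :: "('f::field \<Rightarrow> real) \<Rightarrow> 'f alg_closure set" where
  "ac_maximal_ideal v = {x. \<exists>p::'f poly. Polynomial.lead_coeff p = 1 \<and>
     (\<forall>i<Polynomial.degree p. v (Polynomial.coeff p i) < 1) \<and> poly (map_poly to_ac p) x = 0}"

definition absolute_galois :: "('f::field alg_closure \<Rightarrow> 'f alg_closure) set" where
  "absolute_galois = {s. bij s \<and> (\<forall>x y. s (x + y) = s x + s y) \<and> (\<forall>x y. s (x * y) = s x * s y) \<and>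
     (\<forall>a. s (to_ac a) = to_ac a)}"

text \<open>
  \<open>residue_power v s n\<close>: on the residue field of the algebraic closure, \<open>s\<close> induces the \<open>n\<close>-th
  power of the automorphism \<open>x \<mapsto> x ^ q\<close>.
\<close>

definition residue_power ::
  "('f::field \<Rightarrow> real) \<Rightarrow> ('f alg_closure \<Rightarrow> 'f alg_closure) \<Rightarrow> int \<Rightarrow> bool" where
  "residue_power v s n \<longleftrightarrow>
     (if n \<ge> 0
      then \<forall>x\<in>ac_integers v. s x - x ^ (residue_card v ^ nat n) \<in> ac_maximal_ideal v
      else \<forall>x\<in>ac_integers v. x - s x ^ (residue_card v ^ nat (- n)) \<in> ac_maximal_ideal v)"

definition weil ::
  "('f::field \<Rightarrow> real) \<Rightarrow> ('f alg_closure \<Rightarrow> 'f alg_closure) monoid" where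
  "weil v = \<lparr>carrier = {s \<in> absolute_galois. \<exists>n. residue_power v s n}, mult = (\<circ>), one = id\<rparr>"

definition inertia :: "('f::field \<Rightarrow> real) \<Rightarrow> ('f alg_closure \<Rightarrow> 'f alg_closure) set" where
  "inertia v = {s \<in> absolute_galois. residue_power v s 0}"

text \<open>
  Basic neighbourhoods of \<open>s\<close> consist of the elements of the coset of inertia through \<open>s\<close> that
  agree with \<open>s\<close> on a finite set \<open>A\<close>, i.e. on the finite extension generated by \<open>A\<close>.
\<close>

definition weil_nhd ::
  "('f::field \<Rightarrow> real) \<Rightarrow> ('f alg_closure \<Rightarrow> 'f alg_closure) \<Rightarrow> 'f alg_closure set \<Rightarrow>
   ('f alg_closure \<Rightarrow> 'f alg_closure) set" where
  "weil_nhd v s A = {t \<in> carrier (weil v). inv_into UNIV s \<circ> t \<in> inertia v \<and> (\<forall>x\<in>A. t x = s x)}"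

definition weil_open ::
  "('f::field \<Rightarrow> real) \<Rightarrow> ('f alg_closure \<Rightarrow> 'f alg_closure) set \<Rightarrow> bool" where
  "weil_open v U \<longleftrightarrow>
     U \<subseteq> carrier (weil v) \<and> (\<forall>s\<in>U. \<exists>A. finite A \<and> weil_nhd v s A \<subseteq> U)"

definition weil_topology ::
  "('f::field \<Rightarrow> real) \<Rightarrow> ('f alg_closure \<Rightarrow> 'f alg_closure) topology" where
  "weil_topology v = topology (weil_open v)"

lemma istopology_weil_open: "istopology (weil_open v)"
  unfolding istopology_def
proof (intro conjI allI impI)
  fix S T assume S: "weil_open v S" and T: "weil_open v T"
  show "weil_open v (S \<inter> T)"
    unfolding weil_open_def
  proof (intro conjI ballI)
    show "S \<inter> T \<subseteq> carrier (weil v)"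
      using S unfolding weil_open_def by (meson Int_lower1 order_trans)
    fix s assume s: "s \<in> S \<inter> T"
    obtain A where A: "finite A" "weil_nhd v s A \<subseteq> S"
      using S s unfolding weil_open_def by (meson IntD1)
    obtain B where B: "finite B" "weil_nhd v s B \<subseteq> T"
      using T s unfolding weil_open_def by (meson IntD2)
    have "weil_nhd v s (A \<union> B) \<subseteq> weil_nhd v s A \<inter> weil_nhd v s B"
      unfolding weil_nhd_def by (simp add: subset_iff)
    then have "finite (A \<union> B) \<and> weil_nhd v s (A \<union> B) \<subseteq> S \<inter> T"
      using A B by (meson Int_mono finite_UnI order_trans)
    then show "\<exists>A. finite A \<and> weil_nhd v s A \<subseteq> S \<inter> T" ..
  qed
next
  fix K assume K: "\<forall>U\<in>K. weil_open v U"
  show "weil_open v (\<Union>K)"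
    unfolding weil_open_def
  proof (intro conjI ballI)
    show "\<Union>K \<subseteq> carrier (weil v)"
      using K unfolding weil_open_def by (meson Union_least)
    fix s assume "s \<in> \<Union>K"
    then obtain U where U: "U \<in> K" "s \<in> U" by (rule UnionE)
    then obtain A where "finite A" "weil_nhd v s A \<subseteq> U"
      using K unfolding weil_open_def by meson
    then show "\<exists>A. finite A \<and> weil_nhd v s A \<subseteq> \<Union>K"
      using U(1) by (meson Union_upper order_trans)
  qed
qed

lemma openin_weil_topology: "openin (weil_topology v) U \<longleftrightarrow> weil_open v U"
  by (simp add: weil_topology_def topology_inverse'[OF istopology_weil_open])

lemma topspace_weil_topology: "topspace (weil_topology v) = carrier (weil v)"
proof (rule antisym)
  show "topspace (weil_topology v) \<subseteq> carrier (weil v)"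
    using openin_topspace[of "weil_topology v"] unfolding openin_weil_topology weil_open_def by meson
  have "weil_nhd v s {} \<subseteq> carrier (weil v)" for s
    unfolding weil_nhd_def by (rule Collect_restrict)
  then have "weil_open v (carrier (weil v))"
    unfolding weil_open_def by (meson finite.emptyI order_refl)
  then show "carrier (weil v) \<subseteq> topspace (weil_topology v)"
    by (simp add: openin_subset openin_weil_topology)
qed

text \<open>
  Arithmetic and geometric Frobenius elements are both admitted; the norm is then normalised by
  the chosen element: it is the homomorphism trivial on inertia with value \<open>1/q\<close> at \<open>Fr\<close>.
\<close>

definition frobenius_element ::
  "('f::field \<Rightarrow> real) \<Rightarrow> ('f alg_closure \<Rightarrow> 'f alg_closure) \<Rightarrow> bool" where
  "frobenius_element v Fr \<longleftrightarrow>
     Fr \<in> carrier (weil v) \<and> (residue_power v Fr 1 \<or> residue_power v Fr (-1))"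

definition weil_norm ::
  "('f::field \<Rightarrow> real) \<Rightarrow> ('f alg_closure \<Rightarrow> 'f alg_closure) \<Rightarrow> ('f alg_closure \<Rightarrow> 'f alg_closure) \<Rightarrow> real"
  where
  "weil_norm v Fr w =
     real (residue_card v) powi
       (- (THE n::int. \<exists>i\<in>inertia v. w = (Fr [^]\<^bsub>weil v\<^esub> n) \<circ> i))"


section \<open>Linear algebraic groups\<close>

text \<open>
  Linear algebraic groups over an algebraically closed field are Zariski closed subgroups of
  \<open>GL\<^sub>n\<close>, given by their sets of rational points.  \<open>polyfuns C Z\<close> are the polynomials with
  coefficients in the subfield \<open>C\<close> in the coordinate functions \<open>Z\<close>.
\<close>

inductive_set polyfuns :: "'k::field set \<Rightarrow> ('x \<Rightarrow> 'k) set \<Rightarrow> ('x \<Rightarrow> 'k) set"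
  for C :: "'k set" and Z :: "('x \<Rightarrow> 'k) set" where
  const: "c \<in> C \<Longrightarrow> (\<lambda>_. c) \<in> polyfuns C Z"
| coord: "f \<in> Z \<Longrightarrow> f \<in> polyfuns C Z"
| add: "f \<in> polyfuns C Z \<Longrightarrow> g \<in> polyfuns C Z \<Longrightarrow> (\<lambda>x. f x + g x) \<in> polyfuns C Z"
| mult: "f \<in> polyfuns C Z \<Longrightarrow> g \<in> polyfuns C Z \<Longrightarrow> (\<lambda>x. f x * g x) \<in> polyfuns C Z"

definition mat_polys :: "'k::field set \<Rightarrow> ('k^'n^'n \<Rightarrow> 'k) set" where
  "mat_polys C = polyfuns C {f. \<exists>i j. f = (\<lambda>A. A $ i $ j)}"

definition zariski_open :: "('k::field^'n^'n) set \<Rightarrow> bool" where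
  "zariski_open U \<longleftrightarrow> (\<forall>A\<in>U. \<exists>p \<in> mat_polys UNIV. p A \<noteq> 0 \<and> {B. p B \<noteq> 0} \<subseteq> U)"

definition zariski :: "('k::field^'n^'n) topology" where
  "zariski = topology zariski_open"

lemma istopology_zariski_open: "istopology (zariski_open :: ('k::field^'n^'n) set \<Rightarrow> bool)"
  unfolding istopology_def
proof (intro conjI allI impI)
  fix S T :: "('k^'n^'n) set" assume S: "zariski_open S" and T: "zariski_open T"
  show "zariski_open (S \<inter> T)"
    unfolding zariski_open_def
  proof
    fix A assume A: "A \<in> S \<inter> T"
    obtain p where p: "p \<in> mat_polys UNIV" "p A \<noteq> 0" "{B. p B \<noteq> 0} \<subseteq> S"
      using S A unfolding zariski_open_def by (meson IntD1)
    obtain q where q: "q \<in> mat_polys UNIV" "q A \<noteq> 0" "{B. q B \<noteq> 0} \<subseteq> T"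
      using T A unfolding zariski_open_def by (meson IntD2)
    show "\<exists>r \<in> mat_polys UNIV. r A \<noteq> 0 \<and> {B. r B \<noteq> 0} \<subseteq> S \<inter> T"
    proof (rule bexI[of _ "\<lambda>B. p B * q B"])
      show "(\<lambda>B. p B * q B) \<in> mat_polys UNIV"
        using p(1) q(1) unfolding mat_polys_def by (rule polyfuns.mult)
    qed (use p q in auto)
  qed
next
  fix K :: "('k^'n^'n) set set" assume K: "\<forall>U\<in>K. zariski_open U"
  show "zariski_open (\<Union>K)"
    unfolding zariski_open_def
  proof
    fix A assume "A \<in> \<Union>K"
    then obtain U where U: "U \<in> K" "A \<in> U" by (rule UnionE)
    then obtain p where "p \<in> mat_polys UNIV" "p A \<noteq> 0" "{B. p B \<noteq> 0} \<subseteq> U"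
      using K unfolding zariski_open_def by meson
    then show "\<exists>p \<in> mat_polys UNIV. p A \<noteq> 0 \<and> {B. p B \<noteq> 0} \<subseteq> \<Union>K"
      using U(1) by (meson Union_upper order_trans)
  qed
qed

lemma openin_zariski: "openin zariski U \<longleftrightarrow> zariski_open U"
  by (simp add: zariski_def topology_inverse'[OF istopology_zariski_open])

definition GL :: "('k::field^'n^'n) monoid" where
  "GL = \<lparr>carrier = {A. invertible A}, mult = (**), one = mat 1\<rparr>"

abbreviation matgroup :: "('k::field^'n^'n) set \<Rightarrow> ('k^'n^'n) monoid" where
  "matgroup H \<equiv> GL\<lparr>carrier := H\<rparr>"

definition algebraic_group :: "('k::field^'n^'n) set \<Rightarrow> bool" where
  "algebraic_group G \<longleftrightarrow> subgroup G GL \<and> closedin (subtopology zariski (carrier GL)) G"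

text \<open>
  Definedness over a subfield \<open>C\<close>; over a perfect field it is enough that the points be cut out by
  polynomials with coefficients in \<open>C\<close>.
\<close>

definition defined_over :: "'k::field set \<Rightarrow> ('k^'n^'n) set \<Rightarrow> bool" where
  "defined_over C G \<longleftrightarrow> (\<exists>P \<subseteq> mat_polys C. G = {g. invertible g \<and> (\<forall>p\<in>P. p g = 0)})"

definition connected_group :: "('k::field^'n^'n) set \<Rightarrow> bool" where
  "connected_group G \<longleftrightarrow> algebraic_group G \<and> connected_space (subtopology zariski G)"

definition unipotent :: "'k::field^'n^'n \<Rightarrow> bool" where
  "unipotent u \<longleftrightarrow> (\<exists>k::nat. (((**) (u - mat 1)) ^^ k) (mat 1) = 0)"

definition connected_reductive :: "('k::field^'n^'n) set \<Rightarrow> bool" where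
  "connected_reductive G \<longleftrightarrow> connected_group G \<and>
     (\<forall>U. connected_group U \<and> U \<lhd> matgroup G \<and> (\<forall>u\<in>U. unipotent u) \<longrightarrow> U = {mat 1})"

definition torus :: "('k::field^'n^'n) set \<Rightarrow> bool" where
  "torus T \<longleftrightarrow> connected_group T \<and>
     (\<exists>P::'k^'n^'n. invertible P \<and>
        (\<forall>t\<in>T. \<forall>i j. i \<noteq> j \<longrightarrow> (P ** t ** matrix_inv P) $ i $ j = 0))"

definition maximal_torus :: "('k::field^'n^'n) set \<Rightarrow> ('k^'n^'n) set \<Rightarrow> bool" where
  "maximal_torus G T \<longleftrightarrow> torus T \<and> T \<subseteq> G \<and> (\<forall>T'. torus T' \<and> T \<subseteq> T' \<and> T' \<subseteq> G \<longrightarrow> T' = T)"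

definition borel_subgroup :: "('k::field^'n^'n) set \<Rightarrow> ('k^'n^'n) set \<Rightarrow> bool" where
  "borel_subgroup G B \<longleftrightarrow>
     connected_group B \<and> solvable (matgroup B) \<and> B \<subseteq> G \<and>
     (\<forall>B'. connected_group B' \<and> solvable (matgroup B') \<and> B \<subseteq> B' \<and> B' \<subseteq> G \<longrightarrow> B' = B)"

definition quasi_split :: "'k::field set \<Rightarrow> ('k^'n^'n) set \<Rightarrow> bool" where
  "quasi_split C G \<longleftrightarrow> defined_over C G \<and> (\<exists>B. borel_subgroup G B \<and> defined_over C B)"

definition regular_on :: "('k::field^'n^'n) set \<Rightarrow> ('k^'n^'n \<Rightarrow> 'k) \<Rightarrow> bool" where
  "regular_on G f \<longleftrightarrow> (\<exists>p \<in> mat_polys UNIV. \<exists>k::nat. \<forall>g\<in>G. f g = p g / det g ^ k)"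

definition regular_map_on :: "('k::field^'n^'n) set \<Rightarrow> ('k^'n^'n \<Rightarrow> 'k^'m^'m) \<Rightarrow> bool" where
  "regular_map_on G f \<longleftrightarrow> (\<forall>i j. regular_on G (\<lambda>g. f g $ i $ j))"

text \<open>
  The Zariski tangent space at the identity: every polynomial vanishing on \<open>G\<close> vanishes to second
  order at \<open>1\<close> in the direction \<open>Z\<close>.
\<close>

definition lie_algebra :: "('k::field^'n^'n) set \<Rightarrow> ('k^'n^'n) set" where
  "lie_algebra G = {Z. \<forall>p \<in> mat_polys UNIV. (\<forall>g\<in>G. p g = 0) \<longrightarrow>
     (\<exists>r::'k poly. \<forall>t. p (mat 1 + mat t ** Z) = t^2 * poly r t)}"


section \<open>Root data\<close>

definition char_group :: "('k::field^'n^'n) set \<Rightarrow> ('k^'n^'n \<Rightarrow> 'k) monoid" where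
  "char_group T = \<lparr>
     carrier = {c \<in> extensional T. regular_on T c \<and> (\<forall>t\<in>T. c t \<noteq> 0) \<and>
       (\<forall>s\<in>T. \<forall>t\<in>T. c (s ** t) = c s * c t)},
     mult = (\<lambda>c d. \<lambda>t\<in>T. c t * d t),
     one = (\<lambda>t\<in>T. 1)\<rparr>"

definition cochar_group :: "('k::field^'n^'n) set \<Rightarrow> ('k \<Rightarrow> 'k^'n^'n) monoid" where
  "cochar_group T = \<lparr>
     carrier = {m \<in> extensional (- {0}). (\<forall>z. z \<noteq> 0 \<longrightarrow> m z \<in> T) \<and>
       (\<forall>i j. \<exists>(p::'k poly) (k::nat). \<forall>z. z \<noteq> 0 \<longrightarrow> m z $ i $ j = poly p z / z ^ k) \<and>
       (\<forall>y z. y \<noteq> 0 \<longrightarrow> z \<noteq> 0 \<longrightarrow> m (y * z) = m y ** m z)},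
     mult = (\<lambda>m l. \<lambda>z\<in>- {0}. m z ** l z),
     one = (\<lambda>z\<in>- {0}. mat 1)\<rparr>"

definition char_pairing :: "('k::field^'n^'n \<Rightarrow> 'k) \<Rightarrow> ('k \<Rightarrow> 'k^'n^'n) \<Rightarrow> int" where
  "char_pairing c m = (THE n. \<forall>z. z \<noteq> 0 \<longrightarrow> c (m z) = z powi n)"

text \<open>With a Borel subgroup in place of \<open>G\<close> this yields the corresponding positive roots.\<close>

definition roots :: "('k::field^'n^'n) set \<Rightarrow> ('k^'n^'n) set \<Rightarrow> ('k^'n^'n \<Rightarrow> 'k) set" where
  "roots G T = {a \<in> carrier (char_group T). a \<noteq> one (char_group T) \<and>
     (\<exists>Z \<in> lie_algebra G. Z \<noteq> 0 \<and> (\<forall>t\<in>T. t ** Z ** matrix_inv t = mat (a t) ** Z))}"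

definition simple_roots :: "('k::field^'n^'n) set \<Rightarrow> ('k^'n^'n) set \<Rightarrow> ('k^'n^'n \<Rightarrow> 'k) set" where
  "simple_roots B T =
     {a \<in> roots B T. \<not> (\<exists>b\<in>roots B T. \<exists>c\<in>roots B T. a = b \<otimes>\<^bsub>char_group T\<^esub> c)}"

definition SL2 :: "('k::field^2^2) set" where
  "SL2 = {A. det A = 1}"

definition mat2 :: "'k \<Rightarrow> 'k \<Rightarrow> 'k \<Rightarrow> 'k \<Rightarrow> 'k::zero^2^2" where
  "mat2 a b c d = vector [vector [a, b], vector [c, d]]"

definition root_hom ::
  "('k::field^'n^'n) set \<Rightarrow> ('k^'n^'n) set \<Rightarrow> ('k^'n^'n \<Rightarrow> 'k) \<Rightarrow> ('k \<Rightarrow> 'k^'n^'n) \<Rightarrow> bool" where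
  "root_hom G T a x \<longleftrightarrow>
     (\<forall>c. x c \<in> G) \<and> inj x \<and> (\<forall>c d. x (c + d) = x c ** x d) \<and>
     (\<forall>i j. \<exists>p::'k poly. \<forall>c. x c $ i $ j = poly p c) \<and>
     (\<forall>t\<in>T. \<forall>c. t ** x c ** matrix_inv t = x (a t * c))"

definition is_coroot ::
  "('k::field^'n^'n) set \<Rightarrow> ('k^'n^'n) set \<Rightarrow> ('k^'n^'n \<Rightarrow> 'k) \<Rightarrow> ('k \<Rightarrow> 'k^'n^'n) \<Rightarrow> bool" where
  "is_coroot G T a m \<longleftrightarrow> a \<in> roots G T \<and> m \<in> carrier (cochar_group T) \<and>
     (\<exists>f. f \<in> hom (matgroup SL2) (matgroup G) \<and> regular_map_on SL2 f \<and>
        root_hom G T a (\<lambda>c. f (mat2 1 c 0 1)) \<and>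
        root_hom G T (\<lambda>t. inverse (a t)) (\<lambda>c. f (mat2 1 0 c 1)) \<and>
        (\<forall>z. z \<noteq> 0 \<longrightarrow> m z = f (mat2 z 0 0 (inverse z))))"


section \<open>The dual group and the L-group\<close>

definition mat_map :: "('k \<Rightarrow> 'k) \<Rightarrow> 'k^'n^'n \<Rightarrow> 'k^'n^'n" where
  "mat_map s A = (\<chi> i j. s (A $ i $ j))"

definition gal_cochar :: "('k::field \<Rightarrow> 'k) \<Rightarrow> ('k \<Rightarrow> 'k^'n^'n) \<Rightarrow> ('k \<Rightarrow> 'k^'n^'n)" where
  "gal_cochar s m = (\<lambda>z\<in>- {0}. mat_map s (m (inv_into UNIV s z)))"

definition dual_char ::
  "(('f alg_closure \<Rightarrow> 'f::field alg_closure) \<Rightarrow> 'k^'m^'m \<Rightarrow> 'k^'m^'m) \<Rightarrow> ('k::field^'m^'m) set \<Rightarrow>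
   ('f alg_closure \<Rightarrow> 'f alg_closure) \<Rightarrow> ('k^'m^'m \<Rightarrow> 'k) \<Rightarrow> ('k^'m^'m \<Rightarrow> 'k)" where
  "dual_char act T w b = (\<lambda>t\<in>T. b (act (inv_into UNIV w) t))"

text \<open>
  \<open>(B, T)\<close> is a Borel pair of \<open>G\<close> defined over the base field.  The complex group \<open>Gd\<close> with Borel
  pair \<open>(Bd, Td)\<close> has the root datum dual to that of \<open>G\<close>, based by \<open>B\<close>: the mutually transposed
  isomorphisms \<open>D\<close> and \<open>D'\<close> identify characters of \<open>Td\<close> with cocharacters of \<open>T\<close> and characters of
  \<open>T\<close> with cocharacters of \<open>Td\<close>, exchanging roots and coroots and preserving positivity.
  The Weil group acts on \<open>Gd\<close> through a finite quotient, preserving the pinning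
  \<open>(Bd, Td, pin)\<close> and inducing the Galois action on the based root datum.
\<close>

definition dual_group_datum ::
  "('f::field \<Rightarrow> real) \<Rightarrow>
   ('f alg_closure^'n^'n) set \<Rightarrow> ('f alg_closure^'n^'n) set \<Rightarrow> ('f alg_closure^'n^'n) set \<Rightarrow>
   (complex^'m^'m) set \<Rightarrow> (complex^'m^'m) set \<Rightarrow> (complex^'m^'m) set \<Rightarrow>
   ((complex^'m^'m \<Rightarrow> complex) \<Rightarrow> complex \<Rightarrow> complex^'m^'m) \<Rightarrow>
   (('f alg_closure \<Rightarrow> 'f alg_closure) \<Rightarrow> complex^'m^'m \<Rightarrow> complex^'m^'m) \<Rightarrow> bool" where
  "dual_group_datum v G B T Gd Bd Td pin act \<longleftrightarrow>
     borel_subgroup G B \<and> maximal_torus G T \<and> T \<subseteq> B \<and>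
     defined_over (range to_ac) B \<and> defined_over (range to_ac) T \<and>
     connected_reductive Gd \<and> borel_subgroup Gd Bd \<and> maximal_torus Gd Td \<and> Td \<subseteq> Bd \<and>
     (\<forall>b\<in>simple_roots Bd Td. root_hom Gd Td b (pin b)) \<and>
     (\<forall>w\<in>carrier (weil v).
        act w \<in> iso (matgroup Gd) (matgroup Gd) \<and> regular_map_on Gd (act w) \<and>
        act w ` Bd = Bd \<and> act w ` Td = Td \<and>
        (\<forall>b\<in>simple_roots Bd Td. \<forall>c. act w (pin b c) = pin (dual_char act Td w b) c)) \<and>
     (\<forall>g\<in>Gd. act id g = g) \<and>
     (\<forall>w\<in>carrier (weil v). \<forall>u\<in>carrier (weil v). \<forall>g\<in>Gd. act (w \<circ> u) g = act w (act u g)) \<and>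
     (\<exists>A. finite A \<and> (\<forall>w\<in>carrier (weil v). (\<forall>x\<in>A. w x = x) \<longrightarrow> (\<forall>g\<in>Gd. act w g = g))) \<and>
     (\<exists>D D'.
        D \<in> iso (char_group Td) (cochar_group T) \<and>
        D' \<in> iso (char_group T) (cochar_group Td) \<and>
        (\<forall>a\<in>carrier (char_group T). \<forall>b\<in>carrier (char_group Td).
           char_pairing a (D b) = char_pairing b (D' a) \<and>
           (is_coroot G T a (D b) \<longleftrightarrow> is_coroot Gd Td b (D' a)) \<and>
           (is_coroot G T a (D b) \<longrightarrow> (a \<in> roots B T \<longleftrightarrow> b \<in> roots Bd Td))) \<and>
        (\<forall>w\<in>carrier (weil v). \<forall>b\<in>carrier (char_group Td).
           D (dual_char act Td w b) = gal_cochar w (D b)))"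

definition L_group ::
  "('f::field \<Rightarrow> real) \<Rightarrow> (complex^'m^'m) set \<Rightarrow>
   (('f alg_closure \<Rightarrow> 'f alg_closure) \<Rightarrow> complex^'m^'m \<Rightarrow> complex^'m^'m) \<Rightarrow>
   ((complex^'m^'m) \<times> ('f alg_closure \<Rightarrow> 'f alg_closure)) monoid" where
  "L_group v Gd act = \<lparr>
     carrier = Gd \<times> carrier (weil v),
     mult = (\<lambda>(g, w) (h, u). (g ** act w h, w \<circ> u)),
     one = (mat 1, id)\<rparr>"

definition L_topology ::
  "('f::field \<Rightarrow> real) \<Rightarrow> (complex^'m^'m) set \<Rightarrow>
   ((complex^'m^'m) \<times> ('f alg_closure \<Rightarrow> 'f alg_closure)) topology" where
  "L_topology v Gd = prod_topology (top_of_set Gd) (weil_topology v)"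

text \<open>
  Semisimplicity in the L-group means semisimplicity in the linear algebraic groups obtained from it
  by replacing the Weil group by the Galois groups of finite extensions.  The regular functions on
  these groups are the functions in \<open>L_regular\<close>, and an element is semisimple if right translation by
  it acts semisimply on the (locally finite) space of regular functions, i.e. every regular function
  is a sum of eigenfunctions.
\<close>

definition L_regular ::
  "('f::field \<Rightarrow> real) \<Rightarrow> (complex^'m^'m) set \<Rightarrow>
   ((complex^'m^'m) \<times> ('f alg_closure \<Rightarrow> 'f alg_closure) \<Rightarrow> complex) set" where
  "L_regular v Gd = {f.
     (\<forall>w\<in>carrier (weil v). regular_on Gd (\<lambda>g. f (g, w))) \<and>
     (\<exists>A. finite A \<and> (\<forall>w\<in>carrier (weil v). \<forall>u\<in>carrier (weil v).
        (\<forall>x\<in>A. w x = u x) \<longrightarrow> (\<forall>g\<in>Gd. f (g, w) = f (g, u))))}"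

definition L_semisimple ::
  "('f::field \<Rightarrow> real) \<Rightarrow> (complex^'m^'m) set \<Rightarrow>
   (('f alg_closure \<Rightarrow> 'f alg_closure) \<Rightarrow> complex^'m^'m \<Rightarrow> complex^'m^'m) \<Rightarrow>
   (complex^'m^'m) \<times> ('f alg_closure \<Rightarrow> 'f alg_closure) \<Rightarrow> bool" where
  "L_semisimple v Gd act s \<longleftrightarrow>
     (\<forall>f \<in> L_regular v Gd. \<exists>E. finite E \<and> E \<subseteq> L_regular v Gd \<and>
        (\<forall>e\<in>E. \<exists>c. \<forall>y\<in>carrier (L_group v Gd act). e (y \<otimes>\<^bsub>L_group v Gd act\<^esub> s) = c * e y) \<and>
        (\<forall>y\<in>carrier (L_group v Gd act). f y = (\<Sum>e\<in>E. e y)))"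


section \<open>Langlands and Arthur parameters\<close>

type_synonym ('f, 'm) L_param =
  "('f alg_closure \<Rightarrow> 'f alg_closure) \<times> (complex^2^2) \<Rightarrow>
   (complex^'m^'m) \<times> ('f alg_closure \<Rightarrow> 'f alg_closure)"

type_synonym ('f, 'm) A_param =
  "('f alg_closure \<Rightarrow> 'f alg_closure) \<times> (complex^2^2) \<times> (complex^2^2) \<Rightarrow>
   (complex^'m^'m) \<times> ('f alg_closure \<Rightarrow> 'f alg_closure)"

definition langlands_parameter ::
  "('f::field \<Rightarrow> real) \<Rightarrow> (complex^'m^'m) set \<Rightarrow>
   (('f alg_closure \<Rightarrow> 'f alg_closure) \<Rightarrow> complex^'m^'m \<Rightarrow> complex^'m^'m) \<Rightarrow>
   ('f alg_closure \<Rightarrow> 'f alg_closure) \<Rightarrow> ('f, 'm::finite) L_param \<Rightarrow> bool" where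
  "langlands_parameter v Gd act Fr phi \<longleftrightarrow>
     phi \<in> hom (weil v \<times>\<times> matgroup SL2) (L_group v Gd act) \<and>
     continuous_map (prod_topology (weil_topology v) (top_of_set SL2)) (L_topology v Gd) phi \<and>
     (\<forall>w\<in>carrier (weil v). \<forall>x\<in>SL2. snd (phi (w, x)) = w) \<and>
     L_semisimple v Gd act (phi (Fr, mat 1)) \<and>
     regular_map_on SL2 (\<lambda>x. fst (phi (id, x)))"

definition bounded_in :: "(complex^'m^'m) set \<Rightarrow> (complex^'m^'m) set \<Rightarrow> bool" where
  "bounded_in Gd S \<longleftrightarrow> (\<exists>K. compact K \<and> K \<subseteq> Gd \<and> S \<subseteq> K)"

definition tempered ::
  "('f::field \<Rightarrow> real) \<Rightarrow> (complex^'m^'m) set \<Rightarrow> ('f, 'm::finite) L_param \<Rightarrow> bool" where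
  "tempered v Gd phi \<longleftrightarrow> bounded_in Gd ((\<lambda>w. fst (phi (w, mat 1))) ` carrier (weil v))"

definition arthur_parameter ::
  "('f::field \<Rightarrow> real) \<Rightarrow> (complex^'m^'m) set \<Rightarrow>
   (('f alg_closure \<Rightarrow> 'f alg_closure) \<Rightarrow> complex^'m^'m \<Rightarrow> complex^'m^'m) \<Rightarrow>
   ('f alg_closure \<Rightarrow> 'f alg_closure) \<Rightarrow> ('f, 'm::finite) A_param \<Rightarrow> bool" where
  "arthur_parameter v Gd act Fr psi \<longleftrightarrow>
     psi \<in> hom (weil v \<times>\<times> (matgroup SL2 \<times>\<times> matgroup SL2)) (L_group v Gd act) \<and>
     continuous_map
       (prod_topology (weil_topology v) (prod_topology (top_of_set SL2) (top_of_set SL2)))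
       (L_topology v Gd) psi \<and>
     (\<forall>w\<in>carrier (weil v). \<forall>x\<in>SL2. \<forall>y\<in>SL2. snd (psi (w, x, y)) = w) \<and>
     L_semisimple v Gd act (psi (Fr, mat 1, mat 1)) \<and>
     (\<forall>i j. \<exists>p \<in> polyfuns UNIV ({f. \<exists>k l. f = (\<lambda>(x, y). x $ k $ l)} \<union>
                                 {f. \<exists>k l. f = (\<lambda>(x, y). y $ k $ l)}).
        \<forall>x\<in>SL2. \<forall>y\<in>SL2. fst (psi (id, x, y)) $ i $ j = p (x, y)) \<and>
     bounded_in Gd ((\<lambda>w. fst (psi (w, mat 1, mat 1))) ` carrier (weil v))"

definition norm_diag ::
  "('f::field \<Rightarrow> real) \<Rightarrow> ('f alg_closure \<Rightarrow> 'f alg_closure) \<Rightarrow> ('f alg_closure \<Rightarrow> 'f alg_closure) \<Rightarrow>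
   complex^2^2" where
  "norm_diag v Fr w =
     mat2 (complex_of_real (weil_norm v Fr w powr (1/2))) 0
          0 (complex_of_real (weil_norm v Fr w powr (-1/2)))"

definition arthur_type ::
  "('f::field \<Rightarrow> real) \<Rightarrow> (complex^'m^'m) set \<Rightarrow>
   (('f alg_closure \<Rightarrow> 'f alg_closure) \<Rightarrow> complex^'m^'m \<Rightarrow> complex^'m^'m) \<Rightarrow>
   ('f alg_closure \<Rightarrow> 'f alg_closure) \<Rightarrow> ('f, 'm::finite) L_param \<Rightarrow> bool" where
  "arthur_type v Gd act Fr phi \<longleftrightarrow>
     (\<exists>psi. arthur_parameter v Gd act Fr psi \<and>
        (\<forall>w\<in>carrier (weil v). \<forall>x\<in>SL2. phi (w, x) = psi (w, x, norm_diag v Fr w)))"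

definition infinitesimal_parameter ::
  "('f::field \<Rightarrow> real) \<Rightarrow> ('f alg_closure \<Rightarrow> 'f alg_closure) \<Rightarrow> ('f, 'm::finite) L_param \<Rightarrow>
   ('f alg_closure \<Rightarrow> 'f alg_closure) \<Rightarrow> (complex^'m^'m) \<times> ('f alg_closure \<Rightarrow> 'f alg_closure)" where
  "infinitesimal_parameter v Fr phi w = phi (w, norm_diag v Fr w)"

text \<open>The differential at the identity of a map on \<open>G\<close>, on velocities of curves in \<open>G\<close>.\<close>

definition differential ::
  "(complex^'n^'n) set \<Rightarrow> (complex^'n^'n \<Rightarrow> complex^'m^'m) \<Rightarrow> complex^'n^'n \<Rightarrow> complex^'m^'m" where
  "differential G f Z = (THE Y. \<exists>\<gamma>::real \<Rightarrow> complex^'n^'n.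
     \<gamma> 0 = mat 1 \<and> (\<forall>t. \<gamma> t \<in> G) \<and> (\<gamma> has_vector_derivative Z) (at 0) \<and>
     ((\<lambda>t. f (\<gamma> t)) has_vector_derivative Y) (at 0))"

definition L_Ad ::
  "(complex^'m^'m) set \<Rightarrow>
   (('f::field alg_closure \<Rightarrow> 'f alg_closure) \<Rightarrow> complex^'m^'m \<Rightarrow> complex^'m^'m) \<Rightarrow>
   (complex^'m^'m) \<times> ('f alg_closure \<Rightarrow> 'f alg_closure) \<Rightarrow> complex^'m^'m \<Rightarrow> complex^'m^'m" where
  "L_Ad Gd act = (\<lambda>(g, w) Z. g ** differential Gd (act w) Z ** matrix_inv g)"

definition V_space ::
  "('f::field \<Rightarrow> real) \<Rightarrow> (complex^'m^'m) set \<Rightarrow>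
   (('f alg_closure \<Rightarrow> 'f alg_closure) \<Rightarrow> complex^'m^'m \<Rightarrow> complex^'m^'m) \<Rightarrow>
   ('f alg_closure \<Rightarrow> 'f alg_closure) \<Rightarrow>
   (('f alg_closure \<Rightarrow> 'f alg_closure) \<Rightarrow> (complex^'m^'m) \<times> ('f alg_closure \<Rightarrow> 'f alg_closure)) \<Rightarrow>
   (complex^'m^'m) set" where
  "V_space v Gd act Fr lam = {Z \<in> lie_algebra Gd.
     \<forall>w\<in>carrier (weil v). L_Ad Gd act (lam w) Z = weil_norm v Fr w *\<^sub>R Z}"

definition H_group ::
  "('f::field \<Rightarrow> real) \<Rightarrow> (complex^'m^'m) set \<Rightarrow>
   (('f alg_closure \<Rightarrow> 'f alg_closure) \<Rightarrow> complex^'m^'m \<Rightarrow> complex^'m^'m) \<Rightarrow>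
   (('f alg_closure \<Rightarrow> 'f alg_closure) \<Rightarrow> (complex^'m^'m) \<times> ('f alg_closure \<Rightarrow> 'f alg_closure)) \<Rightarrow>
   (complex^'m^'m) set" where
  "H_group v Gd act lam = {h \<in> Gd. \<forall>w\<in>carrier (weil v).
     (h, id) \<otimes>\<^bsub>L_group v Gd act\<^esub> lam w = lam w \<otimes>\<^bsub>L_group v Gd act\<^esub> (h, id)}"

definition x_elem :: "('f::field, 'm::finite) L_param \<Rightarrow> complex^'m^'m" where
  "x_elem phi = differential SL2 (\<lambda>x. fst (phi (id, x))) (mat2 0 1 0 0)"

definition open_parameter ::
  "('f::field \<Rightarrow> real) \<Rightarrow> (complex^'m^'m) set \<Rightarrow>
   (('f alg_closure \<Rightarrow> 'f alg_closure) \<Rightarrow> complex^'m^'m \<Rightarrow> complex^'m^'m) \<Rightarrow>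
   ('f alg_closure \<Rightarrow> 'f alg_closure) \<Rightarrow> ('f, 'm::finite) L_param \<Rightarrow> bool" where
  "open_parameter v Gd act Fr phi \<longleftrightarrow>
     (let lam = infinitesimal_parameter v Fr phi;
          V = V_space v Gd act Fr lam;
          H = H_group v Gd act lam
      in \<exists>Q. (\<exists>y\<in>V. Q = {h ** y ** matrix_inv h | h. h \<in> H}) \<and>
             openin (subtopology zariski V) Q \<and> x_elem phi \<in> Q)"

end

(* The image of SL2 x SL2 in the dual group is studied through sl2-weights.  If phi is tempered, boundedness of
   phi(W_F) forces V_lambda to be the weight-2 part of the centralizer m of phi(W_F) in the Lie algebra.  There
   ad(x_phi) maps the weight-0 part of m, which lies in the Lie algebra of H_lambda, onto V_lambda, so by the inverse
   function theorem and the connectedness of complex lines minus finitely many points the orbit of x_phi contains a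
   Zariski neighbourhood.  Conversely, let phi come from psi and let e1, e2 be the nilpotent elements of its two SL2.
   The element e1 + t e2 lies in V_lambda, so openness makes it conjugate to x_phi = e1 for some nonzero t.  The
   trace of the square of the neutral element is an invariant of a conjugacy class of nilpotents, hence
   tr(h2^2) = 0, the second SL2 acts trivially, and phi is tempered. *)
theory Submission
  imports Defs "HOL-Complex_Analysis.Conformal_Mappings"
begin

text \<open>Three obstacles shape the proof. The norm is a definite description, so its exponent at
  \<open>Fr\<close> has to be shown unique; integral closure in the algebraic closure is developed
  for this, up to the fact that no positive power of \<open>Fr\<close> acts trivially on the residue
  field. Only the value at \<open>Fr\<close> and positivity of the norm enter; elsewhere its square
  root is just some positive real r in diag(r, 1/r). Secondly, conjugation in the L-group involves
  the action of the Weil group. This action factors through a finite quotient, so boundedness is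
  exploited along powers of \<open>Fr\<close> that act trivially, where Ad is plain conjugation of
  matrices. Thirdly, the Lie algebra is a Zariski tangent space while differentials are taken along
  curves. The matrix exponential connects the two, and it produces the elements of the group H that
  move x_phi. Surjectivity of ad(x_phi) is deduced from injectivity of ad(e) ad(f) on vectors of
  weight 2, so no decomposition into irreducibles is required. For tempered phi the Arthur parameter
  is phi itself, trivial on the second SL2.\<close>

no_notation fps_nth (infixl \<open>$\<close> 75)

section \<open>Matrices\<close>

text \<open>Complex scaling of matrices, the same as multiplication by \<open>mat c\<close>. The
  class operation \<open>*\<^sub>R\<close> scales by reals only, while weights and Lie algebras are
  complex linear.\<close>

definition cscale :: "complex \<Rightarrow> complex^'n^'m \<Rightarrow> complex^'n^'m" (infixr \<open>*\<^sub>c\<close> 75) where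
  "c *\<^sub>c A = (\<chi> i j. c * A $ i $ j)"

lemma cscale_nth [simp]: "(c *\<^sub>c A) $ i $ j = c * A $ i $ j"
  by (simp add: cscale_def)

lemma matrix_mult_nth: "(A ** B) $ i $ j = (\<Sum>k\<in>UNIV. A $ i $ k * B $ k $ j)"
  by (simp add: matrix_matrix_mult_def)

lemma mat_nth: "mat c $ i $ j = (if i = j then c else 0)"
  by (simp add: mat_def)

lemma mat_mult_cscale: "mat c ** A = c *\<^sub>c A"
  by (simp add: vec_eq_iff matrix_mult_nth mat_nth if_distrib if_distribR sum.delta cong: if_cong)

lemma cscale_mult_left: "(c *\<^sub>c A) ** B = c *\<^sub>c (A ** B)"
  by (simp add: vec_eq_iff matrix_mult_nth sum_distrib_left mult_ac)

lemma cscale_mult_right: "A ** (c *\<^sub>c B) = c *\<^sub>c (A ** B)"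
  by (simp add: vec_eq_iff matrix_mult_nth sum_distrib_left mult_ac)

lemma cscale_cscale [simp]: "c *\<^sub>c d *\<^sub>c A = (c * d) *\<^sub>c A"
  by (simp add: vec_eq_iff mult_ac)

lemma cscale_add_right: "c *\<^sub>c (A + B) = c *\<^sub>c A + c *\<^sub>c B"
  by (simp add: vec_eq_iff distrib_left)

lemma cscale_diff_right: "c *\<^sub>c (A - B) = c *\<^sub>c A - c *\<^sub>c B"
  by (simp add: vec_eq_iff right_diff_distrib)

lemma cscale_add_left: "(c + d) *\<^sub>c A = c *\<^sub>c A + d *\<^sub>c A"
  by (simp add: vec_eq_iff distrib_right)

lemma cscale_1 [simp]: "1 *\<^sub>c A = A" and cscale_0 [simp]: "0 *\<^sub>c A = 0"
  and cscale_zero [simp]: "c *\<^sub>c 0 = 0" and cscale_minus_1: "(-1) *\<^sub>c A = - A"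
  by (simp_all add: vec_eq_iff)

lemma cscale_eq_0_iff [simp]: "c *\<^sub>c A = 0 \<longleftrightarrow> c = 0 \<or> A = 0"
  by (auto simp: vec_eq_iff)

lemma cscale_of_real: "complex_of_real r *\<^sub>c A = r *\<^sub>R A"
  by (simp add: vec_eq_iff complex_eq_iff)

lemma matrix_minus_left: "(- A) ** B = - (A ** (B::'a::comm_ring_1^'n^'m))"
  and matrix_minus_right: "A ** (- B) = - (A ** (B::'a::comm_ring_1^'n^'m))"
  by (simp_all add: vec_eq_iff matrix_mult_nth sum_negf)

lemma matrix_add_rdistrib: "(A + B) ** C = A ** C + B ** (C::'a::comm_ring_1^'n^'m)"
  by (simp add: vec_eq_iff matrix_mult_nth sum.distrib distrib_right)

lemma matrix_diff_ldistrib: "A ** (B - C) = A ** B - A ** (C::'a::comm_ring_1^'n^'m)"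
  by (simp add: vec_eq_iff matrix_mult_nth sum_subtractf right_diff_distrib)

lemma matrix_diff_rdistrib: "(A - B) ** C = A ** C - B ** (C::'a::comm_ring_1^'n^'m)"
  by (simp add: vec_eq_iff matrix_mult_nth sum_subtractf left_diff_distrib)

lemmas matrix_ring_simps = matrix_add_ldistrib matrix_add_rdistrib matrix_diff_ldistrib
  matrix_diff_rdistrib matrix_minus_left matrix_minus_right matrix_mul_assoc

lemma bounded_bilinear_matrix_mult:
  "bounded_bilinear ((**) :: complex^'n^'m \<Rightarrow> complex^'k^'n \<Rightarrow> complex^'k^'m)"
  unfolding bilinear_conv_bounded_bilinear[symmetric] bilinear_def
  by (intro conjI allI linearI)
     (simp_all add: matrix_add_ldistrib matrix_add_rdistrib scalar_matrix_assoc matrix_scalar_ac)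

lemmas bounded_linear_matrix_left = bounded_bilinear.bounded_linear_right[OF bounded_bilinear_matrix_mult]
lemmas bounded_linear_matrix_right = bounded_bilinear.bounded_linear_left[OF bounded_bilinear_matrix_mult]

lemma bounded_linear_nth_nth: "bounded_linear (\<lambda>A::complex^'n^'m. A $ i $ j)"
  using bounded_linear_compose[OF bounded_linear_vec_nth bounded_linear_vec_nth] .

lemma norm_nth_nth_le: "norm ((A::complex^'n^'m) $ i $ j) \<le> norm A"
  using Finite_Cartesian_Product.norm_nth_le[of "A $ i" j] Finite_Cartesian_Product.norm_nth_le[of A i] by linarith

lemma has_derivative_matrixI:
  fixes f :: "'a::real_normed_vector \<Rightarrow> complex^'n^'m"
  assumes "\<And>i j. ((\<lambda>x. f x $ i $ j) has_derivative (\<lambda>h. f' h $ i $ j)) (at x)"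
  shows "(f has_derivative f') (at x)"
proof -
  have "((\<lambda>x. f x \<bullet> b) has_derivative (\<lambda>h. f' h \<bullet> b)) (at x)" if b: "b \<in> Basis" for b
  proof -
    obtain i j u where "b = axis i (axis j u)"
      using b by (auto simp: Basis_vec_def)
    then show ?thesis
      using has_derivative_inner_left[OF assms[of i j], of u] by (simp add: inner_axis)
  qed
  then show ?thesis
    using has_derivative_componentwise_within[of f f' x UNIV] by simp
qed

lemma has_vector_derivative_matrixI:
  fixes f :: "real \<Rightarrow> complex^'n^'m"
  assumes "\<And>i j. ((\<lambda>x. f x $ i $ j) has_vector_derivative D $ i $ j) (at x)"
  shows "(f has_vector_derivative D) (at x)"
  unfolding has_vector_derivative_def
  by (rule has_derivative_matrixI) (use assms in \<open>simp add: has_vector_derivative_def\<close>)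

lemma has_vector_derivative_matrix_mult:
  fixes f :: "real \<Rightarrow> complex^'n^'m" and g :: "real \<Rightarrow> complex^'k^'n"
  assumes "(f has_vector_derivative f') (at x)" "(g has_vector_derivative g') (at x)"
  shows "((\<lambda>x. f x ** g x) has_vector_derivative f x ** g' + f' ** g x) (at x)"
  using bounded_bilinear.has_vector_derivative[OF bounded_bilinear_matrix_mult assms] .

lemma has_vector_derivative_conj:
  fixes f :: "real \<Rightarrow> complex^'n^'n"
  assumes "(f has_vector_derivative f') (at x)"
  shows "((\<lambda>x. A ** f x ** B) has_vector_derivative A ** f' ** B) (at x)"
  using bounded_linear.has_vector_derivative[OF bounded_linear_compose[OF bounded_linear_matrix_right bounded_linear_matrix_left] assms] .

lemma matrix_inv_mult:
  fixes A :: "'a::field^'n^'n"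
  assumes "invertible A"
  shows "matrix_inv A ** A = mat 1" "A ** matrix_inv A = mat 1"
proof -
  have "\<exists>B. A ** B = mat 1 \<and> B ** A = mat 1" using assms by (simp add: invertible_def)
  then have "A ** matrix_inv A = mat 1 \<and> matrix_inv A ** A = mat 1"
    unfolding matrix_inv_def by (rule someI_ex)
  then show "matrix_inv A ** A = mat 1" "A ** matrix_inv A = mat 1" by auto
qed

lemma matrix_inv_eqI:
  fixes A :: "'a::field^'n^'n"
  assumes "A ** B = mat 1"
  shows "matrix_inv A = B"
proof -
  have "invertible A" using assms by (meson invertible_right_inverse)
  then have "matrix_inv A ** (A ** B) = B" by (simp add: matrix_mul_assoc matrix_inv_mult)
  then show ?thesis using assms by simp
qed

lemma invertibleI:
  fixes A :: "'a::field^'n^'n"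
  shows "A ** B = mat 1 \<Longrightarrow> invertible A"
  by (meson invertible_right_inverse)

lemma matrix_inv_mult_distrib:
  fixes A B :: "'a::field^'n^'n"
  assumes "invertible A" "invertible B"
  shows "matrix_inv (A ** B) = matrix_inv B ** matrix_inv A"
proof (rule matrix_inv_eqI)
  have "A ** B ** (matrix_inv B ** matrix_inv A) = A ** (B ** matrix_inv B) ** matrix_inv A"
    by (simp only: matrix_mul_assoc)
  then show "A ** B ** (matrix_inv B ** matrix_inv A) = mat 1"
    by (simp add: assms matrix_inv_mult)
qed

subsection \<open>Polynomial functions of matrix entries\<close>

lemma polyfuns_compose:
  fixes F :: "'x \<Rightarrow> 'k::field^'n^'n"
  assumes "p \<in> mat_polys UNIV" "\<And>i j. (\<lambda>x. F x $ i $ j) \<in> polyfuns UNIV Z"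
  shows "(\<lambda>x. p (F x)) \<in> polyfuns UNIV Z"
  using assms(1) unfolding mat_polys_def
proof induction
  case (coord f)
  then show ?case using assms(2) by auto
qed (auto intro: polyfuns.intros)

lemma polyfuns_sum:
  "(\<And>i. i \<in> I \<Longrightarrow> f i \<in> polyfuns UNIV Z) \<Longrightarrow> (\<lambda>x. \<Sum>i\<in>I. f i x) \<in> polyfuns UNIV Z"
  by (induction I rule: infinite_finite_induct) (auto intro: polyfuns.intros)

lemma polyfuns_prod:
  "(\<And>i. i \<in> I \<Longrightarrow> f i \<in> polyfuns UNIV Z) \<Longrightarrow> (\<lambda>x. \<Prod>i\<in>I. f i x) \<in> polyfuns UNIV Z"
  by (induction I rule: infinite_finite_induct) (auto intro: polyfuns.intros)

lemma polyfuns_diff: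
  "f \<in> polyfuns UNIV Z \<Longrightarrow> g \<in> polyfuns UNIV Z \<Longrightarrow> (\<lambda>x. f x - g x) \<in> polyfuns UNIV Z"
  using polyfuns.add[of f UNIV Z "\<lambda>x. (-1) * g x"] polyfuns.mult[of "\<lambda>_. -1" UNIV Z g]
    polyfuns.const[of "-1" UNIV Z] by simp

lemma polyfuns_det:
  fixes F :: "'x \<Rightarrow> 'k::field^'n^'n"
  assumes "\<And>i j. (\<lambda>x. F x $ i $ j) \<in> polyfuns UNIV Z"
  shows "(\<lambda>x. det (F x)) \<in> polyfuns UNIV Z"
  unfolding det_def
  by (intro polyfuns_sum polyfuns.mult polyfuns_prod assms polyfuns.const UNIV_I)

lemma coord_mat_polys: "(\<lambda>A. A $ i $ j) \<in> mat_polys UNIV"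
  unfolding mat_polys_def by (rule polyfuns.coord) auto

lemma mat_polys_left_translate:
  fixes g :: "'a::field^'b^'b"
  assumes "p \<in> mat_polys UNIV"
  shows "(\<lambda>A. p (g ** A)) \<in> mat_polys UNIV"
  unfolding mat_polys_def
proof (rule polyfuns_compose[OF assms])
  fix i j
  have "(\<lambda>A. g $ i $ k * A $ k $ j) \<in> polyfuns UNIV {f. \<exists>i j. f = (\<lambda>A::'a^'b^'b. A $ i $ j)}" for k
    by (rule polyfuns.mult) (rule polyfuns.const, simp, rule polyfuns.coord, auto)
  then show "(\<lambda>A. (g ** A) $ i $ j) \<in> polyfuns UNIV {f. \<exists>i j. f = (\<lambda>A. A $ i $ j)}"
    unfolding matrix_mult_nth by (rule polyfuns_sum)
qed

lemma polyfuns_one_variable: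
  "f \<in> polyfuns UNIV {\<lambda>t. t} \<Longrightarrow> \<exists>P. \<forall>t. f t = poly P t"
proof (induction rule: polyfuns.induct)
  case (const c)
  show ?case by (rule exI[of _ "[:c:]"]) simp
next
  case (coord f)
  then show ?case by (intro exI[of _ "[:0,1:]"]) simp
qed (metis poly_add poly_mult)+

text \<open>Reduces to one variable. It serves the second-order condition in
  \<open>lie_algebra\<close>, the connectedness argument along complex lines in
  \<open>open_orbit\<close>, and the choice of t in the pencil e1 + t e2.\<close>

lemma mat_poly_affine_line:
  assumes "p \<in> mat_polys UNIV"
  shows "\<exists>P. \<forall>t. p (A + t *\<^sub>c B) = poly P t"
proof (rule polyfuns_one_variable, rule polyfuns_compose[OF assms])
  fix i j
  have "(\<lambda>t. A $ i $ j + t * B $ i $ j) \<in> polyfuns UNIV {\<lambda>t. t}"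
    by (rule polyfuns.add, rule polyfuns.const, simp, rule polyfuns.mult, rule polyfuns.coord, simp,
        rule polyfuns.const, simp)
  then show "(\<lambda>t. (A + t *\<^sub>c B) $ i $ j) \<in> polyfuns UNIV {\<lambda>t. t}" by simp
qed

text \<open>The partial derivatives are polynomials again, so differentiation can be iterated inside
  \<open>mat_polys\<close>; \<open>mexp_mem\<close> relies on this.\<close>

lemma mat_poly_gradient:
  fixes p :: "complex^'n^'n \<Rightarrow> complex"
  assumes "p \<in> mat_polys UNIV"
  shows "\<exists>g. (\<forall>i j. g i j \<in> mat_polys UNIV) \<and>
    (\<forall>A. (p has_derivative (\<lambda>U. \<Sum>i\<in>UNIV. \<Sum>j\<in>UNIV. g i j A * U $ i $ j)) (at A))"
  using assms unfolding mat_polys_def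
proof induction
  case (const c)
  show ?case
    by (rule exI[of _ "\<lambda>i j A. 0"]) (auto intro: polyfuns.const)
next
  case (coord f)
  then obtain k l where f: "f = (\<lambda>A. A $ k $ l)" by auto
  have "(\<Sum>i\<in>UNIV. \<Sum>j\<in>UNIV. (if i = k \<and> j = l then 1 else 0) * U $ i $ j) = U $ k $ l"
    for U :: "complex^'n^'n"
  proof -
    have "(\<Sum>j\<in>UNIV. (if i = k \<and> j = l then 1 else 0) * U $ i $ j) = (if i = k then U $ k $ l else 0)" for i
      by (cases "i = k") (simp_all add: if_distrib if_distribR cong: if_cong)
    then show ?thesis by simp
  qed
  then have d: "\<forall>A. (f has_derivative (\<lambda>U. \<Sum>i\<in>UNIV. \<Sum>j\<in>UNIV. (if i = k \<and> j = l then 1 else 0) * U $ i $ j)) (at A)"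
    using bounded_linear_imp_has_derivative[OF bounded_linear_nth_nth[of k l]] by (simp add: f)
  have m: "\<forall>i j. (\<lambda>A. if i = k \<and> j = l then 1 else 0) \<in> polyfuns UNIV {f. \<exists>i j. f = (\<lambda>A::complex^'n^'n. A $ i $ j)}"
    by (intro allI polyfuns.const UNIV_I)
  show ?case
    by (rule exI[where x = "\<lambda>i j A. if i = k \<and> j = l then 1 else 0"]) (rule conjI[OF m d])
next
  case (add f g)
  then obtain a b where a: "\<forall>i j. a i j \<in> polyfuns UNIV {f. \<exists>i j. f = (\<lambda>A. A $ i $ j)}"
      "\<forall>A. (f has_derivative (\<lambda>U. \<Sum>i\<in>UNIV. \<Sum>j\<in>UNIV. a i j A * U $ i $ j)) (at A)"
    and b: "\<forall>i j. b i j \<in> polyfuns UNIV {f. \<exists>i j. f = (\<lambda>A. A $ i $ j)}"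
      "\<forall>A. (g has_derivative (\<lambda>U. \<Sum>i\<in>UNIV. \<Sum>j\<in>UNIV. b i j A * U $ i $ j)) (at A)"
    by blast
  have "((\<lambda>A. f A + g A) has_derivative (\<lambda>U. \<Sum>i\<in>UNIV. \<Sum>j\<in>UNIV. (a i j A + b i j A) * U $ i $ j)) (at A)" for A
    using has_derivative_add[OF a(2)[rule_format, of A] b(2)[rule_format, of A]]
    by (simp add: distrib_right sum.distrib)
  then have d: "\<forall>A. ((\<lambda>A. f A + g A) has_derivative
      (\<lambda>U. \<Sum>i\<in>UNIV. \<Sum>j\<in>UNIV. (a i j A + b i j A) * U $ i $ j)) (at A)" ..
  have m: "\<forall>i j. (\<lambda>A. a i j A + b i j A) \<in> polyfuns UNIV {f. \<exists>i j. f = (\<lambda>A. A $ i $ j)}"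
    by (intro allI polyfuns.add a(1)[rule_format] b(1)[rule_format])
  show ?case
    by (rule exI[where x = "\<lambda>i j A. a i j A + b i j A"]) (rule conjI[OF m d])
next
  case (mult f g)
  then obtain a b where a: "\<forall>i j. a i j \<in> polyfuns UNIV {f. \<exists>i j. f = (\<lambda>A. A $ i $ j)}"
      "\<forall>A. (f has_derivative (\<lambda>U. \<Sum>i\<in>UNIV. \<Sum>j\<in>UNIV. a i j A * U $ i $ j)) (at A)"
    and b: "\<forall>i j. b i j \<in> polyfuns UNIV {f. \<exists>i j. f = (\<lambda>A. A $ i $ j)}"
      "\<forall>A. (g has_derivative (\<lambda>U. \<Sum>i\<in>UNIV. \<Sum>j\<in>UNIV. b i j A * U $ i $ j)) (at A)"
    by blast
  have "((\<lambda>A. f A * g A) has_derivative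
      (\<lambda>U. \<Sum>i\<in>UNIV. \<Sum>j\<in>UNIV. (f A * b i j A + g A * a i j A) * U $ i $ j)) (at A)" for A
    by (rule has_derivative_eq_rhs[OF has_derivative_mult[OF a(2)[rule_format, of A] b(2)[rule_format, of A]]])
       (simp only: mult.commute[of _ "g A"] distrib_right sum.distrib sum_distrib_left mult.assoc)
  then have d: "\<forall>A. ((\<lambda>A. f A * g A) has_derivative
      (\<lambda>U. \<Sum>i\<in>UNIV. \<Sum>j\<in>UNIV. (f A * b i j A + g A * a i j A) * U $ i $ j)) (at A)" ..
  have m: "\<forall>i j. (\<lambda>A. f A * b i j A + g A * a i j A) \<in> polyfuns UNIV {f. \<exists>i j. f = (\<lambda>A. A $ i $ j)}"
    by (intro allI polyfuns.add polyfuns.mult mult.hyps a(1)[rule_format] b(1)[rule_format])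
  show ?case
    by (rule exI[where x = "\<lambda>i j A. f A * b i j A + g A * a i j A"]) (rule conjI[OF m d])
qed

subsection \<open>The matrix exponential\<close>

definition matpow :: "complex^'n^'n \<Rightarrow> nat \<Rightarrow> complex^'n^'n" where
  "matpow A k = ((**) A ^^ k) (mat 1)"

lemma matpow_0 [simp]: "matpow A 0 = mat 1"
  and matpow_Suc: "matpow A (Suc k) = A ** matpow A k"
  by (simp_all add: matpow_def)

lemma matpow_Suc2: "matpow A (Suc k) = matpow A k ** A"
proof (induction k)
  case (Suc k)
  then show ?case by (metis matpow_Suc matrix_mul_assoc)
qed (simp add: matpow_Suc)

lemma matpow_cscale: "matpow (c *\<^sub>c A) k = c ^ k *\<^sub>c matpow A k"
  by (induction k) (simp_all add: matpow_Suc cscale_mult_left cscale_mult_right mult_ac)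

text \<open>Each row-by-column sum has \<open>CARD('n)\<close> terms, which accounts for the
  factor.\<close>

lemma norm_matpow_nth_le:
  fixes A :: "complex^'n^'n"
  shows "norm (matpow A k $ i $ j) \<le> (real CARD('n) * norm A) ^ k"
proof (induction k arbitrary: i j)
  case (Suc k)
  have "norm (matpow A (Suc k) $ i $ j) \<le> (\<Sum>l\<in>UNIV. norm (A $ i $ l * matpow A k $ l $ j))"
    by (simp add: matpow_Suc matrix_mult_nth norm_sum)
  also have "\<dots> \<le> (\<Sum>l\<in>(UNIV::'n set). norm A * (real CARD('n) * norm A) ^ k)"
    by (rule sum_mono) (auto simp: norm_mult intro!: mult_mono norm_nth_nth_le Suc.IH)
  finally show ?case by simp
qed (simp add: mat_nth)

text \<open>The series is taken entry by entry, so that convergence and differentiation along t A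
  become statements about scalar power series.\<close>

definition mexp :: "complex^'n^'n \<Rightarrow> complex^'n^'n" where
  "mexp A = (\<chi> i j. \<Sum>k. matpow A k $ i $ j / fact k)"

lemma summable_mexp: "summable (\<lambda>k. norm (matpow A k $ i $ j / fact k))"
proof (rule summable_comparison_test')
  show "summable (\<lambda>k. (real CARD('a) * norm A) ^ k / fact k)"
    using summable_exp[of "real CARD('a) * norm A"] by (simp add: divide_inverse mult.commute)
qed (simp add: norm_divide divide_right_mono norm_matpow_nth_le)

lemma mexp_nth_sums: "(\<lambda>k. matpow A k $ i $ j / fact k) sums (mexp A $ i $ j)"
  using summable_norm_cancel[OF summable_mexp[of A i j]] by (simp add: mexp_def summable_sums)

lemma mexp_mult_left_sums: "(\<lambda>k. (B ** matpow A k) $ i $ j / fact k) sums ((B ** mexp A) $ i $ j)"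
  unfolding matrix_mult_nth sum_divide_distrib times_divide_eq_right[symmetric]
  by (intro sums_sum sums_mult mexp_nth_sums)

lemma mexp_mult_right_sums: "(\<lambda>k. (matpow A k ** B) $ i $ j / fact k) sums ((mexp A ** B) $ i $ j)"
  unfolding matrix_mult_nth sum_divide_distrib times_divide_eq_left[symmetric]
  by (intro sums_sum sums_mult2 mexp_nth_sums)

lemma mexp_commute: "mexp A ** A = A ** mexp A"
proof -
  have "(mexp A ** A) $ i $ j = (A ** mexp A) $ i $ j" for i j
    using sums_unique2[OF mexp_mult_right_sums[of A A i j]] mexp_mult_left_sums[of A A i j]
    by (simp add: matpow_Suc[symmetric] matpow_Suc2[symmetric])
  then show ?thesis by (simp add: vec_eq_iff)
qed

lemma mexp_0 [simp]: "mexp 0 = mat 1"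
proof -
  have "matpow (0::complex^'a^'a) k = (if k = 0 then mat 1 else 0)" for k
    by (cases k) (simp_all add: matpow_Suc)
  then have "(\<lambda>k. matpow (0::complex^'a^'a) k $ i $ j / fact k) = (\<lambda>k. if k = 0 then mat 1 $ i $ j else 0)" for i j
    by auto
  then have "mexp 0 $ i $ j = (mat 1 :: complex^'a^'a) $ i $ j" for i j
    using sums_unique2[OF mexp_nth_sums[of 0 i j]] sums_single[of 0 "\<lambda>_. (mat 1 :: complex^'a^'a) $ i $ j"] by simp
  then show ?thesis by (simp add: vec_eq_iff)
qed

text \<open>Every entry is an everywhere convergent power series in the complex variable t. Termwise
  differentiation shifts the powers of \<open>A\<close> by one, which is right multiplication by
  \<open>A\<close>.\<close>

lemma mexp_cscale_has_field_derivative: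
  "((\<lambda>t. mexp (t *\<^sub>c A) $ i $ j) has_field_derivative (mexp (t *\<^sub>c A) ** A) $ i $ j) (at t)"
proof -
  define c where "c k = matpow A k $ i $ j / fact k" for k
  have eq: "mexp (z *\<^sub>c A) $ i $ j = (\<Sum>k. c k * z ^ k)" for z
    by (simp add: mexp_def c_def matpow_cscale mult_ac)
  have "summable (\<lambda>k. c k * z ^ k)" for z
    using summable_norm_cancel[OF summable_mexp[of "z *\<^sub>c A" i j]] by (simp add: c_def matpow_cscale mult_ac)
  then have "((\<lambda>z. \<Sum>k. c k * z ^ k) has_field_derivative (\<Sum>k. diffs c k * t ^ k)) (at t)"
    by (rule termdiffs_strong_converges_everywhere)
  moreover have "of_nat (Suc k) * (y / fact (Suc k)) = y / fact k" for k and y :: complex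
    by (simp del: of_nat_Suc)
  then have "diffs c k * t ^ k = (matpow (t *\<^sub>c A) k ** A) $ i $ j / fact k" for k
    by (simp add: diffs_def c_def matpow_cscale matpow_Suc2 cscale_mult_left del: of_nat_Suc fact_Suc)
  ultimately show ?thesis
    using mexp_mult_right_sums[of "t *\<^sub>c A" A i j] by (simp add: eq sums_iff)
qed

lemma mexp_scaleR_has_vector_derivative:
  "((\<lambda>t::real. mexp (t *\<^sub>R A)) has_vector_derivative mexp (t *\<^sub>R A) ** A) (at t)"
proof (rule has_vector_derivative_matrixI)
  fix i j
  have "((\<lambda>z. mexp (of_real z *\<^sub>c A) $ i $ j) has_vector_derivative (mexp (of_real t *\<^sub>c A) ** A) $ i $ j) (at t)"
    using mexp_cscale_has_field_derivative[of A i j "of_real t"]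
    by (rule has_vector_derivative_real_field)
  then show "((\<lambda>t. mexp (t *\<^sub>R A) $ i $ j) has_vector_derivative (mexp (t *\<^sub>R A) ** A) $ i $ j) (at t)"
    by (simp add: cscale_of_real)
qed

lemma mexp_scaleR_commute: "mexp (t *\<^sub>R A) ** A = A ** mexp (t *\<^sub>R A)"
proof (cases "t = 0")
  case False
  then show ?thesis
    using mexp_commute[of "t *\<^sub>R A"] by (simp add: matrix_scalar_ac scalar_matrix_assoc[symmetric])
qed simp

text \<open>The contributions of \<open>- Y\<close> and \<open>Y\<close> to the derivative of the
  product cancel, so it keeps its value at t = 0.\<close>

lemma flow_unique_aux:
  fixes \<gamma> :: "real \<Rightarrow> complex^'n^'n"
  assumes "\<gamma> 0 = mat 1" "\<And>t. (\<gamma> has_vector_derivative Y ** \<gamma> t) (at t)"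
  shows "mexp (- t *\<^sub>R Y) ** \<gamma> t = mat 1"
proof -
  have d: "((\<lambda>t. mexp (t *\<^sub>R (- Y)) ** \<gamma> t) has_vector_derivative 0) (at t)" for t
    by (rule has_vector_derivative_eq_rhs[OF has_vector_derivative_matrix_mult[OF mexp_scaleR_has_vector_derivative assms(2)]])
       (simp add: matrix_ring_simps)
  then obtain c where "\<And>t. mexp (t *\<^sub>R (- Y)) ** \<gamma> t = c"
    using has_vector_derivative_zero_constant[of UNIV "\<lambda>t. mexp (t *\<^sub>R (- Y)) ** \<gamma> t"] by auto
  from this[of 0] this[of t] show ?thesis using assms(1) by simp
qed

lemma mexp_minus: "mexp (- A) ** mexp A = mat 1"
  using flow_unique_aux[of "\<lambda>t. mexp (t *\<^sub>R A)" A 1]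
    mexp_scaleR_has_vector_derivative[of A] by (simp add: mexp_scaleR_commute)

lemma mexp_minus': "mexp A ** mexp (- A) = mat 1"
  using mexp_minus[of "- A"] by simp

lemma invertible_mexp: "invertible (mexp A)"
  using invertibleI mexp_minus' by blast

lemma matrix_inv_mexp: "matrix_inv (mexp A) = mexp (- A)"
  by (rule matrix_inv_eqI) (rule mexp_minus')

lemma flow_unique:
  fixes \<gamma> :: "real \<Rightarrow> complex^'n^'n"
  assumes "\<gamma> 0 = mat 1" "\<And>t. (\<gamma> has_vector_derivative Y ** \<gamma> t) (at t)"
  shows "\<gamma> t = mexp (t *\<^sub>R Y)"
proof -
  have "mexp (t *\<^sub>R Y) ** (mexp (- (t *\<^sub>R Y)) ** \<gamma> t) = mexp (t *\<^sub>R Y)"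
    using flow_unique_aux[OF assms, of t] by simp
  then show ?thesis by (simp add: matrix_mul_assoc mexp_minus')
qed

lemma mexp_add_scaleR: "mexp ((s + t) *\<^sub>R A) = mexp (s *\<^sub>R A) ** mexp (t *\<^sub>R A)"
proof -
  have "((\<lambda>s. mexp ((s + t) *\<^sub>R A)) has_vector_derivative mexp ((s + t) *\<^sub>R A) ** A) (at s)" for s
    using vector_diff_chain_at[of "\<lambda>s. s + t" 1 s "\<lambda>t. mexp (t *\<^sub>R A)" "mexp ((s + t) *\<^sub>R A) ** A"]
      mexp_scaleR_has_vector_derivative[of A "s + t"]
    by (simp add: o_def has_vector_derivative_add_const has_vector_derivative_id)
  then have d: "((\<lambda>s. mexp ((s + t) *\<^sub>R A) ** mexp (- (t *\<^sub>R A))) has_vector_derivative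
      mexp ((s + t) *\<^sub>R A) ** A ** mexp (- (t *\<^sub>R A))) (at s)" for s
    using bounded_linear.has_vector_derivative[OF bounded_linear_matrix_right] by blast
  have "mexp ((s + t) *\<^sub>R A) ** mexp (- (t *\<^sub>R A)) = mexp (s *\<^sub>R A)"
    by (rule flow_unique)
       (use d in \<open>simp_all add: mexp_minus' mexp_scaleR_commute matrix_mul_assoc\<close>)
  then have "mexp ((s + t) *\<^sub>R A) ** (mexp (- (t *\<^sub>R A)) ** mexp (t *\<^sub>R A)) = mexp (s *\<^sub>R A) ** mexp (t *\<^sub>R A)"
    by (simp add: matrix_mul_assoc)
  then show ?thesis by (simp add: mexp_minus)
qed

text \<open>A derivative at 0 suffices: \<open>\<beta> s = \<beta> (s - t) ** \<beta> t\<close>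
  carries it to every t and yields the linear equation whose only solution is the
  exponential.\<close>

lemma one_parameter_group:
  fixes \<beta> :: "real \<Rightarrow> complex^'n^'n"
  assumes "\<And>s t. \<beta> (s + t) = \<beta> s ** \<beta> t" "\<beta> 0 = mat 1" "(\<beta> has_vector_derivative Y) (at 0)"
  shows "\<beta> t = mexp (t *\<^sub>R Y)"
proof (rule flow_unique)
  show "\<beta> 0 = mat 1" by fact
  fix t
  have "((\<lambda>s. s - t) has_vector_derivative 1) (at t)"
    by (auto intro!: derivative_eq_intros)
  then have "((\<lambda>s. \<beta> (s - t)) has_vector_derivative Y) (at t)"
    using vector_diff_chain_at[of "\<lambda>s. s - t" 1 t \<beta> Y] assms(3) by (simp add: o_def)
  then have "((\<lambda>s. \<beta> (s - t) ** \<beta> t) has_vector_derivative Y ** \<beta> t) (at t)"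
    using bounded_linear.has_vector_derivative[OF bounded_linear_matrix_right] by blast
  then show "(\<beta> has_vector_derivative Y ** \<beta> t) (at t)"
    by (simp add: assms(1)[symmetric])
qed

text \<open>The left side is the tail from k = 2 on. With c = \<open>CARD('n) * norm U\<close> it is
  at most c^2 exp(c), because (k+2)! is at least k!; and \<open>norm U \<le> 1\<close> bounds exp(c)
  by a constant.\<close>

lemma mexp_minus_linear_bound:
  fixes U :: "complex^'n^'n"
  assumes "norm U \<le> 1"
  shows "norm (mexp U $ i $ j - mat 1 $ i $ j - U $ i $ j) \<le> ((real CARD('n))\<^sup>2 * exp (real CARD('n))) * (norm U)\<^sup>2"
proof -
  define c where "c = real CARD('n) * norm U"
  have c: "0 \<le> c" "c \<le> real CARD('n)"
    using assms by (auto simp: c_def intro: mult_left_le)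
  let ?a = "\<lambda>k. matpow U k $ i $ j / fact k"
  have s: "summable ?a" by (rule summable_norm_cancel[OF summable_mexp])
  have "mexp U $ i $ j - mat 1 $ i $ j - U $ i $ j = (\<Sum>k. ?a (k + 2))"
    using suminf_split_initial_segment[OF s, of 2] sums_unique[OF mexp_nth_sums[of U i j]]
    by (simp add: numeral_2_eq_2 matpow_Suc)
  also have "norm \<dots> \<le> (\<Sum>k. c\<^sup>2 * (c ^ k / fact k))"
  proof (rule norm_suminf_le)
    show "summable (\<lambda>k. c\<^sup>2 * (c ^ k / fact k))"
      using summable_exp[of c] by (intro summable_mult) (simp add: divide_inverse mult.commute)
    fix k
    have "norm (?a (k + 2)) \<le> c ^ (k + 2) / fact (k + 2)"
      using norm_matpow_nth_le[of U "k + 2" i j] by (simp add: norm_divide divide_right_mono c_def del: fact_Suc)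
    also have "\<dots> \<le> c ^ (k + 2) / fact k"
      using c by (intro divide_left_mono fact_mono) auto
    finally show "norm (?a (k + 2)) \<le> c\<^sup>2 * (c ^ k / fact k)"
      by (simp only: power_add mult.commute[of "c ^ k"] times_divide_eq_right)
  qed
  also have "\<dots> = c\<^sup>2 * exp c"
    using summable_exp[of c] by (subst suminf_mult) (simp_all add: exp_def divide_inverse mult.commute)
  also have "\<dots> \<le> c\<^sup>2 * exp (real CARD('n))" using c by (intro mult_left_mono) auto
  finally show ?thesis by (simp add: c_def power_mult_distrib mult_ac)
qed

lemma mexp_has_derivative_0: "(mexp has_derivative (\<lambda>U. U)) (at (0::complex^'n^'n))"
proof (rule has_derivative_matrixI)
  fix i j
  define K where "K = (real CARD('n))\<^sup>2 * exp (real CARD('n))"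
  have "((\<lambda>U::complex^'n^'n. (norm (mexp U $ i $ j - mexp 0 $ i $ j - U $ i $ j)) / norm U) \<longlongrightarrow> 0) (at 0)"
  proof (rule Lim_null_comparison)
    show "((\<lambda>U::complex^'n^'n. K * norm U) \<longlongrightarrow> 0) (at 0)"
      by (auto intro!: tendsto_eq_intros)
    have "norm (norm (mexp U $ i $ j - mexp 0 $ i $ j - U $ i $ j) / norm U) \<le> K * norm U"
      if "dist U 0 < 1" "U \<noteq> 0" for U :: "complex^'n^'n"
      using mexp_minus_linear_bound[of U i j] that
      by (simp add: K_def divide_simps power2_eq_square mult_ac)
    then show "\<forall>\<^sub>F U::complex^'n^'n in at 0. norm (norm (mexp U $ i $ j - mexp 0 $ i $ j - U $ i $ j) / norm U) \<le> K * norm U"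
      unfolding eventually_at by (intro exI[of _ 1]) auto
  qed
  then show "((\<lambda>U::complex^'n^'n. mexp U $ i $ j) has_derivative (\<lambda>U. U $ i $ j)) (at 0)"
    unfolding has_derivative_at using bounded_linear_nth_nth by simp
qed

text \<open>Together with the derivative at 0 this is all that the open mapping theorem in
  \<open>open_orbit\<close> asks of the exponential. The series converges uniformly on every
  ball.\<close>

lemma continuous_on_mexp: "continuous_on UNIV (mexp :: complex^'n^'n \<Rightarrow> _)"
proof -
  have cont: "continuous_on A (\<lambda>U::complex^'n^'n. matpow U k)" for k A
    by (induction k) (auto simp: matpow_Suc intro: bounded_bilinear.continuous_on[OF bounded_bilinear_matrix_mult])
  have "continuous_on (ball 0 R) (\<lambda>U::complex^'n^'n. mexp U $ i $ j)" for R i j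
    unfolding mexp_def vec_lambda_beta
  proof (rule uniform_limit_theorem[OF _ Weierstrass_m_test])
    show "summable (\<lambda>k. (real CARD('n) * \<bar>R\<bar>) ^ k / fact k)"
      using summable_exp[of "real CARD('n) * \<bar>R\<bar>"] by (simp add: divide_inverse mult.commute)
    show "norm (matpow U k $ i $ j / fact k) \<le> (real CARD('n) * \<bar>R\<bar>) ^ k / fact k"
      if "U \<in> ball 0 R" for k and U :: "complex^'n^'n"
    proof -
      have "norm (matpow U k $ i $ j) \<le> (real CARD('n) * norm U) ^ k" by (rule norm_matpow_nth_le)
      also have "\<dots> \<le> (real CARD('n) * \<bar>R\<bar>) ^ k"
        using that by (intro power_mono mult_left_mono) auto
      finally show ?thesis by (simp add: norm_divide divide_right_mono)
    qed
    show "\<forall>\<^sub>F n in sequentially. continuous_on (ball 0 R) (\<lambda>U::complex^'n^'n. \<Sum>k<n. matpow U k $ i $ j / fact k)"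
      by (intro always_eventually allI continuous_intros cont) auto
  qed simp
  note c = this
  have "continuous_on (ball 0 R) (mexp :: complex^'n^'n \<Rightarrow> _)" for R
  proof -
    have "continuous_on (ball 0 R) (\<lambda>U::complex^'n^'n. \<chi> i j. mexp U $ i $ j)"
      by (intro continuous_on_vec_lambda c)
    then show ?thesis by simp
  qed
  then have "isCont (mexp :: complex^'n^'n \<Rightarrow> _) U" for U
    using continuous_on_eq_continuous_at[of "ball 0 (norm U + 1)" mexp] by auto
  then show ?thesis by (simp add: continuous_on_eq_continuous_at)
qed

section \<open>Complex-linear maps and differentials of regular maps\<close>

definition clinear_functional :: "(complex^'n^'n \<Rightarrow> complex) \<Rightarrow> bool" where
  "clinear_functional f \<longleftrightarrow> (\<exists>g. f = (\<lambda>U. \<Sum>i\<in>UNIV. \<Sum>j\<in>UNIV. g i j * U $ i $ j))"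

lemma clinear_functionalD:
  assumes "clinear_functional f"
  shows "f (A + B) = f A + f B" "f (c *\<^sub>c A) = c * f A" "f 0 = 0"
  using assms unfolding clinear_functional_def
  by (auto simp: distrib_left sum.distrib sum_distrib_left mult_ac)

lemma mat_poly_has_derivative:
  fixes p :: "complex^'n^'n \<Rightarrow> complex"
  assumes "p \<in> mat_polys UNIV"
  shows "\<exists>g. (p has_derivative (\<lambda>U. \<Sum>i\<in>UNIV. \<Sum>j\<in>UNIV. g i j * U $ i $ j)) (at A)"
  using mat_poly_gradient[OF assms]
proof (elim exE conjE)
  fix g :: "'n \<Rightarrow> 'n \<Rightarrow> complex^'n^'n \<Rightarrow> complex"
  assume "\<forall>A. (p has_derivative (\<lambda>U. \<Sum>i\<in>UNIV. \<Sum>j\<in>UNIV. g i j A * U $ i $ j)) (at A)"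
  then have "(p has_derivative (\<lambda>U. \<Sum>i\<in>UNIV. \<Sum>j\<in>UNIV. g i j A * U $ i $ j)) (at A)" ..
  then show ?thesis by (rule exI[where x = "\<lambda>i j. g i j A"])
qed

text \<open>Real linearity is kept as a conjunct of its own because derivatives and dimension
  arguments are taken over the reals.\<close>

definition clinear :: "(complex^'n^'n \<Rightarrow> complex^'m^'m) \<Rightarrow> bool" where
  "clinear f \<longleftrightarrow> linear f \<and> (\<forall>c A. f (c *\<^sub>c A) = c *\<^sub>c f A)"

lemma clinearD:
  assumes "clinear f"
  shows "f (A + B) = f A + f B" "f (A - B) = f A - f B" "f (c *\<^sub>c A) = c *\<^sub>c f A" "f 0 = 0"
    "f (- A) = - f A" "linear f" "bounded_linear f" "f (r *\<^sub>R A) = r *\<^sub>R f A"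
proof -
  show l: "linear f" and "f (c *\<^sub>c A) = c *\<^sub>c f A" using assms unfolding clinear_def by blast+
  show "f (A + B) = f A + f B" "f (A - B) = f A - f B" "f 0 = 0" "f (- A) = - f A" "f (r *\<^sub>R A) = r *\<^sub>R f A"
    using l by (rule linear_add linear_diff linear_0 linear_neg linear_scale)+
  show "bounded_linear f" using l by (simp add: linear_conv_bounded_linear)
qed

lemma clinearI:
  assumes "\<And>A B. f (A + B) = f A + f B" "\<And>c A. f (c *\<^sub>c A) = c *\<^sub>c f A"
  shows "clinear f"
proof -
  have "linear f"
    using assms(2)[of "of_real r" for r] by (intro linearI assms(1)) (simp add: cscale_of_real)
  then show ?thesis using assms(2) unfolding clinear_def by blast
qed

text \<open>The function is controlled on \<open>G\<close> only, but \<open>p / det ^ k\<close>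
  extends it to a neighbourhood of the identity, where det is 1; this extension has an ambient
  derivative.\<close>

lemma regular_on_has_derivative:
  fixes f :: "complex^'n^'n \<Rightarrow> complex"
  assumes "regular_on G f"
  obtains F f' where "clinear_functional f'" "(F has_derivative f') (at (mat 1))" "\<And>g. g \<in> G \<Longrightarrow> f g = F g"
proof -
  obtain p k where p: "p \<in> mat_polys UNIV" "\<And>g. g \<in> G \<Longrightarrow> f g = p g / det g ^ k"
    using assms unfolding regular_on_def by auto
  have dd: "(\<lambda>A::complex^'n^'n. det A) \<in> mat_polys UNIV"
    unfolding mat_polys_def by (rule polyfuns_det[OF coord_mat_polys[unfolded mat_polys_def]])
  have d: "(\<lambda>A::complex^'n^'n. det A ^ k) \<in> mat_polys UNIV"
    using polyfuns_prod[of "{..<k}" "\<lambda>_ A. det A", OF dd[unfolded mat_polys_def]] unfolding mat_polys_def by simp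
  obtain a where a: "(p has_derivative (\<lambda>U. \<Sum>i\<in>UNIV. \<Sum>j\<in>UNIV. a i j * U $ i $ j)) (at (mat 1))"
    using mat_poly_has_derivative[OF p(1)] ..
  obtain b where b: "((\<lambda>A::complex^'n^'n. det A ^ k) has_derivative (\<lambda>U. \<Sum>i\<in>UNIV. \<Sum>j\<in>UNIV. b i j * U $ i $ j)) (at (mat 1))"
    using mat_poly_has_derivative[OF d] ..
  have d: "((\<lambda>A::complex^'n^'n. p A / det A ^ k) has_derivative
      (\<lambda>U. \<Sum>i\<in>UNIV. \<Sum>j\<in>UNIV. (a i j - p (mat 1) * b i j) * U $ i $ j)) (at (mat 1))"
  proof (rule has_derivative_eq_rhs[OF has_derivative_divide'[OF a b]])
    show "det (mat 1 :: complex^'n^'n) ^ k \<noteq> 0" by simp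
    show "(\<lambda>h. ((\<Sum>i\<in>UNIV. \<Sum>j\<in>UNIV. a i j * h $ i $ j) * det (mat 1 :: complex^'n^'n) ^ k -
        p (mat 1) * (\<Sum>i\<in>UNIV. \<Sum>j\<in>UNIV. b i j * h $ i $ j)) /
        (det (mat 1 :: complex^'n^'n) ^ k * det (mat 1 :: complex^'n^'n) ^ k)) =
      (\<lambda>U. \<Sum>i\<in>UNIV. \<Sum>j\<in>UNIV. (a i j - p (mat 1) * b i j) * U $ i $ j)"
      by (simp add: left_diff_distrib sum_subtractf sum_distrib_left mult.assoc)
  qed
  show ?thesis
    by (rule that[OF _ d p(2)]) (unfold clinear_functional_def, rule exI, rule refl)
qed

lemma regular_map_has_derivative:
  fixes f :: "complex^'n^'n \<Rightarrow> complex^'m^'m"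
  assumes "regular_map_on G f"
  shows "\<exists>F f'. clinear f' \<and> (F has_derivative f') (at (mat 1)) \<and> (\<forall>g\<in>G. f g = F g)"
proof -
  have "\<exists>F f'. clinear_functional f' \<and> (F has_derivative f') (at (mat 1)) \<and> (\<forall>g\<in>G. f g $ i $ j = F g)" for i j
  proof -
    have r: "regular_on G (\<lambda>g. f g $ i $ j)"
      using assms unfolding regular_map_on_def by blast
    show ?thesis by (rule regular_on_has_derivative[OF r]) blast
  qed
  then obtain F f' where F: "\<And>i j. clinear_functional (f' i j)" "\<And>i j. (F i j has_derivative f' i j) (at (mat 1))"
    "\<And>i j g. g \<in> G \<Longrightarrow> f g $ i $ j = F i j g" by metis
  show ?thesis
  proof (intro exI conjI ballI)
    show "clinear (\<lambda>U. \<chi> i j. f' i j U)"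
      by (rule clinearI) (simp_all add: vec_eq_iff clinear_functionalD[OF F(1)])
    show "((\<lambda>U. \<chi> i j. F i j U) has_derivative (\<lambda>U. \<chi> i j. f' i j U)) (at (mat 1))"
      by (rule has_derivative_matrixI) (simp add: F(2))
  qed (simp add: vec_eq_iff F(3))
qed

definition curve_in :: "(complex^'n^'n) set \<Rightarrow> (real \<Rightarrow> complex^'n^'n) \<Rightarrow> complex^'n^'n \<Rightarrow> bool" where
  "curve_in G \<gamma> Z \<longleftrightarrow> \<gamma> 0 = mat 1 \<and> (\<forall>t. \<gamma> t \<in> G) \<and> (\<gamma> has_vector_derivative Z) (at 0)"

text \<open>All curves in \<open>G\<close> with velocity \<open>Z\<close> have images with the same
  velocity, given by the ambient derivative, so the definite description in
  \<open>differential\<close> is well defined. This covers exactly those \<open>Z\<close> that are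
  velocities of curves.\<close>

lemma regular_map_differential:
  fixes f :: "complex^'n^'n \<Rightarrow> complex^'m^'m"
  assumes "regular_map_on G f"
  shows "\<exists>f'. clinear f' \<and> (\<forall>\<gamma> Z. curve_in G \<gamma> Z \<longrightarrow>
    ((\<lambda>t. f (\<gamma> t)) has_vector_derivative f' Z) (at 0) \<and> differential G f Z = f' Z)"
proof -
  obtain F f' where F: "clinear f'" "(F has_derivative f') (at (mat 1))" "\<And>g. g \<in> G \<Longrightarrow> f g = F g"
    using regular_map_has_derivative[OF assms] by blast
  have curve: "((\<lambda>t. f (\<gamma> t)) has_vector_derivative f' Z) (at 0)" if "curve_in G \<gamma> Z" for \<gamma> Z
  proof -
    have c: "\<gamma> 0 = mat 1" "\<And>t. \<gamma> t \<in> G" "(\<gamma> has_derivative (\<lambda>h. h *\<^sub>R Z)) (at 0)"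
      using that by (simp_all add: curve_in_def has_vector_derivative_def)
    from c(3) have "((\<lambda>t. F (\<gamma> t)) has_derivative (\<lambda>h. f' (h *\<^sub>R Z))) (at 0)"
      by (rule has_derivative_compose) (use F(2) c(1) in simp)
    then have "((\<lambda>t. F (\<gamma> t)) has_vector_derivative f' Z) (at 0)"
      by (simp add: has_vector_derivative_def clinearD(8)[OF F(1)])
    then show ?thesis using F(3)[OF c(2)] by simp
  qed
  have "differential G f Z = f' Z" if \<gamma>: "curve_in G \<gamma> Z" for \<gamma> Z
    unfolding differential_def
  proof (rule the_equality)
    show "\<exists>\<gamma>. \<gamma> 0 = mat 1 \<and> (\<forall>t. \<gamma> t \<in> G) \<and> (\<gamma> has_vector_derivative Z) (at 0) \<and>
        ((\<lambda>t. f (\<gamma> t)) has_vector_derivative f' Z) (at 0)"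
      using \<gamma> curve[OF \<gamma>] unfolding curve_in_def by blast
    fix Y assume "\<exists>\<gamma>. \<gamma> 0 = mat 1 \<and> (\<forall>t. \<gamma> t \<in> G) \<and> (\<gamma> has_vector_derivative Z) (at 0) \<and>
        ((\<lambda>t. f (\<gamma> t)) has_vector_derivative Y) (at 0)"
    then obtain \<delta> where \<delta>: "curve_in G \<delta> Z" "((\<lambda>t. f (\<delta> t)) has_vector_derivative Y) (at 0)"
      unfolding curve_in_def by blast
    show "Y = f' Z" using vector_derivative_unique_at[OF \<delta>(2) curve[OF \<delta>(1)]] .
  qed
  then show ?thesis using F(1) curve by blast
qed

section \<open>The Weil group\<close>

text \<open>The condition \<open>P\<close> on the lower coefficients is a parameter, so that the
  ring of integers and its maximal ideal are treated together, with plain coefficient sequences in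
  place of polynomials.\<close>

lemma monic_root_iff:
  fixes z :: "'f::field alg_closure"
  shows "(\<exists>p. Polynomial.lead_coeff p = 1 \<and> (\<forall>i<Polynomial.degree p. P (Polynomial.coeff p i)) \<and>
      poly (map_poly to_ac p) z = 0) \<longleftrightarrow>
    (\<exists>k c. (\<forall>i<k. P (c i)) \<and> z ^ k + (\<Sum>i<k. to_ac (c i) * z ^ i) = 0)" (is "?L \<longleftrightarrow> ?R")
proof
  assume ?L
  then obtain p where p: "Polynomial.lead_coeff p = 1" "\<forall>i<Polynomial.degree p. P (Polynomial.coeff p i)"
    "poly (map_poly to_ac p) z = 0" by blast
  have "Polynomial.degree (map_poly to_ac p) = Polynomial.degree p"
    by (rule degree_map_poly) auto
  then have "poly (map_poly to_ac p) z = z ^ Polynomial.degree p + (\<Sum>i<Polynomial.degree p. to_ac (Polynomial.coeff p i) * z ^ i)"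
    using p(1) by (simp add: poly_altdef coeff_map_poly lessThan_Suc_atMost[symmetric])
  then show ?R using p(2,3) by (intro exI[of _ "Polynomial.degree p"] exI[of _ "Polynomial.coeff p"]) simp
next
  assume ?R
  then obtain k c where c: "\<forall>i<k. P (c i)" "z ^ k + (\<Sum>i<k. to_ac (c i) * z ^ i) = 0" by blast
  define p where "p = Polynomial.monom 1 k + (\<Sum>i<k. Polynomial.monom (c i) i)"
  have cf: "Polynomial.coeff p i = (if i = k then 1 else if i < k then c i else 0)" for i
    by (simp add: p_def coeff_sum)
  have deg: "Polynomial.degree p = k"
    by (rule antisym) (auto intro!: degree_le le_degree simp: cf)
  have "Polynomial.degree (map_poly to_ac p) = k"
    using deg by (subst degree_map_poly) auto
  then have "poly (map_poly to_ac p) z = 0"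
    using c(2) by (simp add: poly_altdef coeff_map_poly cf lessThan_Suc_atMost[symmetric] add.commute)
  then show ?L using c(1) by (intro exI[of _ p]) (auto simp: deg cf)
qed

locale padic =
  fixes v :: "'f::field_char_0 \<Rightarrow> real"
  assumes padic: "padic_field v"
begin

lemma v_nonneg [simp]: "0 \<le> v x" and v_eq_0_iff [simp]: "v x = 0 \<longleftrightarrow> x = 0"
  and v_mult: "v (x * y) = v x * v y" and v_add_le_max: "v (x + y) \<le> max (v x) (v y)"
proof -
  note p = padic[unfolded padic_field_def]
  show "0 \<le> v x" "v x = 0 \<longleftrightarrow> x = 0"
    using p[THEN conjunct1] p[THEN conjunct2, THEN conjunct1] by simp_all
  show "v (x * y) = v x * v y" "v (x + y) \<le> max (v x) (v y)"
    using p[THEN conjunct2, THEN conjunct2, THEN conjunct1]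
      p[THEN conjunct2, THEN conjunct2, THEN conjunct2, THEN conjunct1] by simp_all
qed

lemma v_0 [simp]: "v 0 = 0" and v_1 [simp]: "v 1 = 1"
proof -
  show "v 0 = 0" by simp
  have "v (1 * 1) = v 1 * v 1" by (rule v_mult)
  moreover have "v 1 \<noteq> 0" by simp
  ultimately show "v 1 = 1" by (metis mult_1 mult_cancel_left1)
qed

lemma v_minus [simp]: "v (- x) = v x"
proof -
  have "v (-1) * v (-1) = 1" using v_mult[of "-1" "-1"] by simp
  then have "(v (-1))\<^sup>2 = 1\<^sup>2" by (simp add: power2_eq_square)
  then have "v (-1) = 1" by (rule power2_eq_imp_eq) simp_all
  then show ?thesis using v_mult[of "-1" x] by simp
qed

lemma v_power: "v (x ^ n) = v x ^ n"
  by (induction n) (simp_all add: v_mult)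

lemma v_add_le: "v x \<le> c \<Longrightarrow> v y \<le> c \<Longrightarrow> v (x + y) \<le> c"
  using v_add_le_max[of x y] by linarith

lemma v_sum_less: "finite A \<Longrightarrow> (\<And>i. i \<in> A \<Longrightarrow> v (f i) < c) \<Longrightarrow> 0 < c \<Longrightarrow> v (sum f A) < c"
proof (induction A rule: finite_induct)
  case (insert x F)
  then have "v (f x) < c" "v (sum f F) < c" by auto
  then have "v (f x + sum f F) < c" using v_add_le_max[of "f x" "sum f F"] by linarith
  then show ?case using insert.hyps by simp
qed simp

lemma v_divide: "y \<noteq> 0 \<Longrightarrow> v (x / y) = v x / v y"
  using v_mult[of "x / y" y] by (simp add: field_simps)

definition unif :: 'f where
  "unif = (SOME p. 0 < v p \<and> v p < 1 \<and> (\<forall>x. v x < 1 \<longrightarrow> v x \<le> v p))"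

lemma unif: "0 < v unif" "v unif < 1" "v x < 1 \<Longrightarrow> v x \<le> v unif" "unif \<noteq> 0"
proof -
  have "\<exists>p. 0 < v p \<and> v p < 1 \<and> (\<forall>x. v x < 1 \<longrightarrow> v x \<le> v p)"
    using padic unfolding padic_field_def by (elim conjE)
  from someI_ex[OF this] show *: "0 < v unif" "v unif < 1" "v x < 1 \<Longrightarrow> v x \<le> v unif"
    unfolding unif_def[symmetric] by blast+
  then show "unif \<noteq> 0" by auto
qed

text \<open>The value group is discrete: a strictly larger value is larger at least by the factor 1
  / \<open>v unif\<close>. Without a maximum one could climb forever, past the bound 1.\<close>

lemma ex_max_v:
  fixes a :: "nat \<Rightarrow> 'f"
  assumes "\<And>k. v (a k) \<le> 1"
  shows "\<exists>m. \<forall>k. v (a k) \<le> v (a m)"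
proof (rule ccontr)
  assume "\<not> ?thesis"
  then have up: "\<exists>k. v (a m) < v (a k)" for m by (meson not_le)
  have step: "v x \<le> v unif * v y" if "v x < v y" for x y
  proof -
    have y: "0 < v y" using that v_nonneg[of x] by linarith
    then have y0: "y \<noteq> 0" by auto
    have "v x / v y < 1" using that y by simp
    then have "v x / v y \<le> v unif" using unif(3)[of "x / y"] by (simp add: v_divide[OF y0])
    then show ?thesis using y by (simp add: pos_divide_le_eq)
  qed
  obtain k0 where "v (a 0) < v (a k0)" using up by blast
  then have k0: "0 < v (a k0)" using v_nonneg[of "a 0"] by linarith
  have "\<exists>k. v (a k0) \<le> v unif ^ j * v (a k)" for j
  proof (induction j)
    case (Suc j)
    then obtain k where k: "v (a k0) \<le> v unif ^ j * v (a k)" by blast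
    obtain l where "v (a k) < v (a l)" using up by blast
    then have "v (a k) \<le> v unif * v (a l)" by (rule step)
    then have "v unif ^ j * v (a k) \<le> v unif ^ j * (v unif * v (a l))"
      by (intro mult_left_mono) auto
    then show ?case using k by (intro exI[of _ l]) (simp add: mult_ac)
  qed auto
  moreover obtain j where j: "v unif ^ j < v (a k0)"
    using real_arch_pow_inv[OF k0 unif(2)] by blast
  ultimately obtain k where k: "v (a k0) \<le> v unif ^ j * v (a k)" by blast
  also have "\<dots> \<le> v unif ^ j * 1" using assms by (intro mult_left_mono) auto
  finally show False using j by simp
qed

subsection \<open>Integral closure\<close>

text \<open>The module generated by \<open>S\<close> over the ring of integers of the base
  field.\<close>

inductive_set ospan :: "'f alg_closure set \<Rightarrow> 'f alg_closure set" for S where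
  zero: "0 \<in> ospan S"
| step: "s \<in> S \<Longrightarrow> v a \<le> 1 \<Longrightarrow> y \<in> ospan S \<Longrightarrow> to_ac a * s + y \<in> ospan S"

lemma ospan_add: "x \<in> ospan S \<Longrightarrow> y \<in> ospan S \<Longrightarrow> x + y \<in> ospan S"
  by (induction rule: ospan.induct) (auto simp: add.assoc intro: ospan.step)

lemma ospan_scale: "x \<in> ospan S \<Longrightarrow> v a \<le> 1 \<Longrightarrow> to_ac a * x \<in> ospan S"
proof (induction rule: ospan.induct)
  case (step s b y)
  have "v (a * b) \<le> 1" using step by (simp add: v_mult mult_le_one)
  from ospan.step[OF step(1) this step(4)[OF step(5)]] show ?case by (simp add: distrib_left mult.assoc)
qed (simp add: ospan.zero)

lemma ospan_base: "s \<in> S \<Longrightarrow> s \<in> ospan S"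
  using ospan.step[of s S 1 0] ospan.zero by simp

lemma ospan_uminus: "x \<in> ospan S \<Longrightarrow> - x \<in> ospan S"
  using ospan_scale[of x S "-1"] by simp

lemma ospan_diff: "x \<in> ospan S \<Longrightarrow> y \<in> ospan S \<Longrightarrow> x - y \<in> ospan S"
  using ospan_add[of x S "- y"] ospan_uminus[of y S] by simp

lemma ospan_sum: "(\<And>i. i \<in> A \<Longrightarrow> f i \<in> ospan S) \<Longrightarrow> sum f A \<in> ospan S"
  by (induction A rule: infinite_finite_induct) (auto intro: ospan_add ospan.zero)

lemma ospan_trans: "x \<in> ospan S \<Longrightarrow> S \<subseteq> ospan T \<Longrightarrow> x \<in> ospan T"
  by (induction rule: ospan.induct) (auto intro: ospan_add ospan_scale ospan.zero)

lemma ospan_mult_closed: "x \<in> ospan S \<Longrightarrow> (\<And>s. s \<in> S \<Longrightarrow> z * s \<in> ospan T) \<Longrightarrow> z * x \<in> ospan T"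
proof (induction rule: ospan.induct)
  case (step s a y)
  have "to_ac a * (z * s) + z * y \<in> ospan T" using step by (intro ospan_add ospan_scale) auto
  then show ?case by (simp add: algebra_simps)
qed (simp add: ospan.zero)

lemma ospan_mult:
  assumes "x \<in> ospan S" "y \<in> ospan T"
  shows "x * y \<in> ospan ((\<lambda>(s, t). s * t) ` (S \<times> T))"
proof (rule ospan_mult_closed[OF assms(2)])
  fix t assume t: "t \<in> T"
  have "t * x \<in> ospan ((\<lambda>(s, t). s * t) ` (S \<times> T))"
    by (rule ospan_mult_closed[OF assms(1)]) (use t in \<open>auto intro!: ospan_base simp: mult.commute\<close>)
  then show "x * t \<in> ospan ((\<lambda>(s, t). s * t) ` (S \<times> T))" by (simp add: mult.commute)
qed

lemma ospan_insert: "x \<in> ospan (insert s S) \<Longrightarrow> \<exists>a. v a \<le> 1 \<and> x - to_ac a * s \<in> ospan S"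
proof (induction rule: ospan.induct)
  case zero
  show ?case by (rule exI[of _ 0]) (simp add: ospan.zero)
next
  case (step t b y)
  then obtain a where a: "v a \<le> 1" "y - to_ac a * s \<in> ospan S" by blast
  show ?case
  proof (cases "t = s")
    case True
    then show ?thesis using a step(2)
      by (intro exI[of _ "b + a"]) (auto simp: algebra_simps intro: v_add_le)
  next
    case False
    then have "to_ac b * t + (y - to_ac a * s) \<in> ospan S" using step a by (intro ospan.step) auto
    then show ?thesis using a(1) by (intro exI[of _ a]) (simp add: algebra_simps)
  qed
qed

lemma ospan_powers: "x \<in> ospan ((\<lambda>i. z ^ i) ` {..<k}) \<Longrightarrow> \<exists>c. (\<forall>i. v (c i) \<le> 1) \<and> x = (\<Sum>i<k. to_ac (c i) * z ^ i)"
proof (induction rule: ospan.induct)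
  case zero
  show ?case by (rule exI[of _ "\<lambda>_. 0"]) simp
next
  case (step s a y)
  then obtain c j where c: "\<forall>i. v (c i) \<le> 1" "y = (\<Sum>i<k. to_ac (c i) * z ^ i)" and j: "j < k" "s = z ^ j" by blast
  have "(\<Sum>i<k. to_ac ((c(j := c j + a)) i) * z ^ i) = (\<Sum>i<k. to_ac (c i) * z ^ i + (if i = j then to_ac a * z ^ j else 0))"
    by (rule sum.cong) (auto simp: algebra_simps)
  also have "\<dots> = to_ac a * s + y" using j by (simp add: sum.distrib c(2))
  finally show ?case using c(1) step(2) by (intro exI[of _ "c(j := c j + a)"]) (auto intro: v_add_le)
qed

text \<open>Finitely generated modules over the valuation ring are noetherian, in the form needed
  here. Induction on the generators: a term whose coefficient at \<open>s\<close> has maximal value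
  divides the coefficients of all others, so it can be used to eliminate \<open>s\<close>.\<close>

lemma ospan_noetherian:
  fixes r :: "nat \<Rightarrow> 'f alg_closure"
  assumes "finite S" "\<And>k. r k \<in> ospan S"
  shows "\<exists>k. r k \<in> ospan (r ` {..<k})"
  using assms
proof (induction S arbitrary: r rule: finite_induct)
  case empty
  have "x = 0" if "x \<in> ospan {}" for x using that by (cases rule: ospan.cases) auto
  then have r0: "r 0 = 0" using empty(1) by blast
  show ?case by (rule exI[where x = 0]) (simp add: r0 ospan.zero)
next
  case (insert s S)
  have "\<exists>a. v a \<le> 1 \<and> r k - to_ac a * s \<in> ospan S" for k using insert.prems ospan_insert by blast
  then obtain a where a: "\<And>k. v (a k) \<le> 1" "\<And>k. r k - to_ac (a k) * s \<in> ospan S" by metis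
  obtain m where m: "\<And>k. v (a k) \<le> v (a m)" using ex_max_v[of a] a(1) by blast
  define b where "b k = a k / a m" for k
  have b1: "v (b k) \<le> 1" for k
  proof (cases "a m = 0")
    case False
    then have "0 < v (a m)" by (simp add: less_le)
    then show ?thesis using m[of k] False by (simp add: b_def v_divide)
  qed (simp add: b_def)
  have b2: "a k = b k * a m" for k
  proof (cases "a m = 0")
    case True
    then have "v (a k) = 0" using m[of k] v_nonneg[of "a k"] by (simp add: antisym del: v_eq_0_iff v_nonneg)
    then show ?thesis using True by simp
  qed (simp add: b_def)
  \<comment> \<open>The terms after the m-th, with their \<open>s\<close>-component cancelled by a
    multiple of \<open>r m\<close>; they lie in the span of one generator less.\<close>
  define r' where "r' j = r (m + 1 + j) - to_ac (b (m + 1 + j)) * r m" for j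
  have "r' j \<in> ospan S" for j
  proof -
    have "r' j = (r (m + 1 + j) - to_ac (a (m + 1 + j)) * s) - to_ac (b (m + 1 + j)) * (r m - to_ac (a m) * s)"
      using b2[of "m + 1 + j"] by (simp add: r'_def algebra_simps)
    then show ?thesis using ospan_diff[OF a(2) ospan_scale[OF a(2) b1]] by simp
  qed
  then obtain j where j: "r' j \<in> ospan (r' ` {..<j})" using insert.IH by blast
  have "r' ` {..<j} \<subseteq> ospan (r ` {..<m + 1 + j})"
  proof (rule image_subsetI)
    fix i assume "i \<in> {..<j}"
    then have "r (m + 1 + i) \<in> r ` {..<m + 1 + j}" "r m \<in> r ` {..<m + 1 + j}" by auto
    then show "r' i \<in> ospan (r ` {..<m + 1 + j})"
      unfolding r'_def by (intro ospan_diff ospan_scale b1 ospan_base)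
  qed
  then have "r' j \<in> ospan (r ` {..<m + 1 + j})" using j ospan_trans by blast
  moreover have "to_ac (b (m + 1 + j)) * r m \<in> ospan (r ` {..<m + 1 + j})"
    by (intro ospan_scale[OF ospan_base b1]) auto
  ultimately have "r' j + to_ac (b (m + 1 + j)) * r m \<in> ospan (r ` {..<m + 1 + j})"
    by (rule ospan_add)
  then show ?case by (intro exI[of _ "m + 1 + j"]) (simp add: r'_def)
qed

abbreviation "\<O> \<equiv> ac_integers v"
abbreviation "\<M> \<equiv> ac_maximal_ideal v"

lemma O_iff: "z \<in> \<O> \<longleftrightarrow> (\<exists>k c. (\<forall>i<k. v (c i) \<le> 1) \<and> z ^ k + (\<Sum>i<k. to_ac (c i) * z ^ i) = 0)"
proof -
  have "(\<forall>i. v (Polynomial.coeff p i) \<le> 1) \<longleftrightarrow> (\<forall>i<Polynomial.degree p. v (Polynomial.coeff p i) \<le> 1)"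
    if l: "Polynomial.lead_coeff p = 1" for p :: "'f poly"
  proof
    assume a: "\<forall>i<Polynomial.degree p. v (Polynomial.coeff p i) \<le> 1"
    show "\<forall>i. v (Polynomial.coeff p i) \<le> 1"
    proof
      fix i
      consider "i < Polynomial.degree p" | "i = Polynomial.degree p" | "Polynomial.degree p < i"
        by linarith
      then show "v (Polynomial.coeff p i) \<le> 1"
        using a l by cases (simp_all add: coeff_eq_0)
    qed
  qed simp
  then have "z \<in> \<O> \<longleftrightarrow> (\<exists>p. Polynomial.lead_coeff p = 1 \<and>
      (\<forall>i<Polynomial.degree p. v (Polynomial.coeff p i) \<le> 1) \<and> poly (map_poly to_ac p) z = 0)"
    unfolding ac_integers_def mem_Collect_eq by (simp cong: conj_cong)
  then show ?thesis using monic_root_iff[where P = "\<lambda>a. v a \<le> 1" and z = z] by (rule trans)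
qed

lemma M_iff: "z \<in> \<M> \<longleftrightarrow> (\<exists>k c. (\<forall>i<k. v (c i) < 1) \<and> z ^ k + (\<Sum>i<k. to_ac (c i) * z ^ i) = 0)"
  unfolding ac_maximal_ideal_def mem_Collect_eq
  by (rule monic_root_iff[where P = "\<lambda>a. v a < 1"])

text \<open>The monic equation of degree n rewrites \<open>z ^ n\<close>, so the span of the first n
  powers is stable under multiplication by \<open>z\<close>.\<close>

lemma O_powers_ospan:
  assumes "z \<in> \<O>"
  shows "\<exists>S. finite S \<and> (\<forall>k. z ^ k \<in> ospan S)"
proof -
  obtain n c where c: "\<forall>i<n. v (c i) \<le> 1" "z ^ n + (\<Sum>i<n. to_ac (c i) * z ^ i) = 0"
    using assms unfolding O_iff by blast
  define S where "S = (\<lambda>i. z ^ i) ` {..<n}"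
  have n: "n > 0" using c(2) by (cases n) auto
  have "(\<Sum>i<n. to_ac (c i) * z ^ i) \<in> ospan S"
    using c(1) by (intro ospan_sum ospan_scale ospan_base) (auto simp: S_def)
  then have zn: "z ^ n \<in> ospan S" using c(2) ospan_uminus by (metis add_eq_0_iff2)
  have "z * s \<in> ospan S" if s: "s \<in> S" for s
  proof -
    obtain i where i: "i < n" "s = z ^ i" using s by (auto simp: S_def)
    show ?thesis
    proof (cases "Suc i = n")
      case True
      then show ?thesis using zn i by (metis power_Suc)
    next
      case False
      then have "z ^ Suc i \<in> S" using i unfolding S_def by (intro imageI) auto
      then show ?thesis using i ospan_base by simp
    qed
  qed
  then have "z ^ k \<in> ospan S" for k
  proof (induction k)
    case 0
    have "z ^ 0 \<in> S" unfolding S_def using n by (intro imageI) auto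
    then show ?case by (rule ospan_base)
  next
    case (Suc k)
    then show ?case using ospan_mult_closed[of "z ^ k" S z S] by simp
  qed
  then show ?thesis unfolding S_def by (intro exI[of _ "(\<lambda>i. z ^ i) ` {..<n}"]) auto
qed

text \<open>By the noetherian property some power is a combination of the earlier ones, and this is
  a monic integral equation.\<close>

lemma ospan_powers_O:
  assumes "finite S" "\<And>k. z ^ k \<in> ospan S"
  shows "z \<in> \<O>"
proof -
  obtain k where "z ^ k \<in> ospan ((\<lambda>i. z ^ i) ` {..<k})"
    using ospan_noetherian[of S "\<lambda>i. z ^ i"] assms by blast
  then obtain c where c: "\<forall>i. v (c i) \<le> 1" "z ^ k = (\<Sum>i<k. to_ac (c i) * z ^ i)" using ospan_powers by blast
  then have "z ^ k + (\<Sum>i<k. to_ac (- c i) * z ^ i) = 0" by (simp add: sum_negf)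
  then show ?thesis unfolding O_iff using c(1) by (intro exI[of _ k] exI[of _ "\<lambda>i. - c i"]) auto
qed

lemma O_add: "x \<in> \<O> \<Longrightarrow> y \<in> \<O> \<Longrightarrow> x + y \<in> \<O>"
  and O_mult: "x \<in> \<O> \<Longrightarrow> y \<in> \<O> \<Longrightarrow> x * y \<in> \<O>"
proof -
  assume x: "x \<in> \<O>" and y: "y \<in> \<O>"
  obtain S where S: "finite S" "\<And>k. x ^ k \<in> ospan S" using O_powers_ospan[OF x] by blast
  obtain T where T: "finite T" "\<And>k. y ^ k \<in> ospan T" using O_powers_ospan[OF y] by blast
  define R where "R = (\<lambda>(s, t). s * t) ` (S \<times> T)"
  have R: "finite R" "\<And>i j. x ^ i * y ^ j \<in> ospan R"
    using S T ospan_mult by (auto simp: R_def)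
  have "(x * y) ^ k \<in> ospan R" for k using R(2)[of k k] by (simp add: power_mult_distrib)
  then show "x * y \<in> \<O>" by (rule ospan_powers_O[OF R(1)])
  \<comment> \<open>The infinite set of all monomials is convenient for the induction on the
    exponent; each monomial then lies in the span of the finite set \<open>R\<close>.\<close>
  define P where "P = {x ^ i * y ^ j | i j. True}"
  have "(x + y) ^ k \<in> ospan P" for k
  proof (induction k)
    case 0
    have "x ^ 0 * y ^ 0 \<in> P" unfolding P_def by blast
    then show ?case using ospan_base[of 1 P] by simp
  next
    case (Suc k)
    have "(x + y) * s \<in> ospan P" if "s \<in> P" for s
    proof -
      obtain i j where s: "s = x ^ i * y ^ j" using \<open>s \<in> P\<close> unfolding P_def by blast
      have "x ^ Suc i * y ^ j \<in> P" "x ^ i * y ^ Suc j \<in> P" unfolding P_def by blast+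
      then have "x ^ Suc i * y ^ j + x ^ i * y ^ Suc j \<in> ospan P" by (intro ospan_add ospan_base)
      then show ?thesis by (simp add: s algebra_simps)
    qed
    then show ?case using ospan_mult_closed[OF Suc.IH] by simp
  qed
  moreover have "P \<subseteq> ospan R" using R(2) unfolding P_def by blast
  ultimately have "(x + y) ^ k \<in> ospan R" for k using ospan_trans by blast
  then show "x + y \<in> \<O>" by (rule ospan_powers_O[OF R(1)])
qed

lemma O_to_ac: "v a \<le> 1 \<Longrightarrow> to_ac a \<in> \<O>"
  unfolding O_iff by (intro exI[of _ 1] exI[of _ "\<lambda>_. - a"]) simp

lemma O_1: "1 \<in> \<O>" and O_0: "0 \<in> \<O>" and O_minus_1: "- 1 \<in> \<O>"
  using O_to_ac[of 1] O_to_ac[of 0] O_to_ac[of "-1"] by simp_all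

lemma O_power: "x \<in> \<O> \<Longrightarrow> x ^ n \<in> \<O>"
  by (induction n) (auto intro: O_1 O_mult)

lemma O_sum: "(\<And>i. i \<in> A \<Longrightarrow> f i \<in> \<O>) \<Longrightarrow> sum f A \<in> \<O>"
  by (induction A rule: infinite_finite_induct) (auto intro: O_add O_0)

lemma M_subset_O: "\<M> \<subseteq> \<O>"
  unfolding M_iff O_iff subset_iff by (meson less_imp_le)

text \<open>Since \<open>unif\<close> generates the maximal ideal downstairs, \<open>\<M>\<close> is the radical of \<open>unif \<O>\<close>;
  its ideal properties follow from this description.\<close>

lemma M_iff_power: "z \<in> \<M> \<longleftrightarrow> (\<exists>d\<ge>1. z ^ d / to_ac unif \<in> \<O>)"
proof
  assume z: "z \<in> \<M>"
  then obtain k c where c: "\<forall>i<k. v (c i) < 1" "z ^ k + (\<Sum>i<k. to_ac (c i) * z ^ i) = 0"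
    unfolding M_iff by blast
  have k: "k \<ge> 1" using c(2) by (cases k) auto
  \<comment> \<open>Coefficients of value below 1 remain integral after division by
    \<open>unif\<close>, whose value is the largest below 1.\<close>
  have eq: "z ^ k / to_ac unif = (\<Sum>i<k. to_ac (- (c i / unif)) * z ^ i)"
  proof -
    have "z ^ k = - (\<Sum>i<k. to_ac (c i) * z ^ i)" using c(2) by (simp add: eq_neg_iff_add_eq_0)
    then show ?thesis by (simp add: sum_divide_distrib sum_negf)
  qed
  have "to_ac (- (c i / unif)) \<in> \<O>" if "i < k" for i
    using c(1) that unif(1,3,4) by (intro O_to_ac) (simp add: v_divide)
  then have "z ^ k / to_ac unif \<in> \<O>"
    unfolding eq using z M_subset_O by (intro O_sum O_mult O_power) auto
  then show "\<exists>d\<ge>1. z ^ d / to_ac unif \<in> \<O>" using k by blast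
next
  assume "\<exists>d\<ge>1. z ^ d / to_ac unif \<in> \<O>"
  then obtain d where d: "d \<ge> 1" "z ^ d / to_ac unif \<in> \<O>" by blast
  then obtain n b where b: "\<forall>i<n. v (b i) \<le> 1"
    "(z ^ d / to_ac unif) ^ n + (\<Sum>i<n. to_ac (b i) * (z ^ d / to_ac unif) ^ i) = 0"
    unfolding O_iff by blast
  \<comment> \<open>Multiplying the equation of \<open>z ^ d / unif\<close> by
    \<open>unif ^ n\<close> leaves in degree d i the coefficient
    \<open>b i * unif ^ (n - i)\<close>; since i < n, at least one factor \<open>unif\<close>
    remains.\<close>
  define c where "c j = (if d dvd j then b (j div d) * unif ^ (n - j div d) else 0)" for j
  have "v (c j) < 1" if "j < d * n" for j
  proof (cases "d dvd j")
    case True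
    then have "j div d < n" using that d(1) by (auto simp: div_less_iff_less_mult mult.commute)
    then have "v (b (j div d)) \<le> 1" and "v unif ^ (n - j div d) < 1"
      using b(1) unif(1,2) by (auto simp: power_less_one_iff)
    moreover have "v (b (j div d)) * v unif ^ (n - j div d) \<le> 1 * v unif ^ (n - j div d)"
      using calculation(1) by (intro mult_right_mono) auto
    ultimately have "v (b (j div d)) * v unif ^ (n - j div d) < 1" by linarith
    then show ?thesis using True by (simp add: c_def v_mult v_power)
  qed (simp add: c_def)
  moreover have "z ^ (d * n) + (\<Sum>j<d * n. to_ac (c j) * z ^ j) = 0"
  proof -
    have "(\<Sum>j<d * n. to_ac (c j) * z ^ j) = (\<Sum>j\<in>(*) d ` {..<n}. to_ac (c j) * z ^ j)"
    proof (intro sum.mono_neutral_right ballI)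
      show "(*) d ` {..<n} \<subseteq> {..<d * n}" using d(1) by auto
      fix j assume j: "j \<in> {..<d * n} - (*) d ` {..<n}"
      have "\<not> d dvd j"
      proof
        assume "d dvd j"
        then obtain e where "j = d * e" by (rule dvdE)
        then show False using j by auto
      qed
      then show "to_ac (c j) * z ^ j = 0" by (simp add: c_def)
    qed simp
    also have "\<dots> = (\<Sum>i<n. to_ac (c (d * i)) * z ^ (d * i))"
      using d(1) by (subst sum.reindex) (auto simp: inj_on_def)
    also have "\<dots> = (\<Sum>i<n. to_ac (b i) * to_ac unif ^ (n - i) * (z ^ d) ^ i)"
      using d(1) by (intro sum.cong) (auto simp: c_def power_mult)
    also have "\<dots> = (\<Sum>i<n. to_ac unif ^ n * (to_ac (b i) * (z ^ d / to_ac unif) ^ i))"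
      using unif(4) by (intro sum.cong) (auto simp: power_divide power_diff)
    also have "\<dots> = - (to_ac unif ^ n * (z ^ d / to_ac unif) ^ n)"
    proof -
      have "(\<Sum>i<n. to_ac (b i) * (z ^ d / to_ac unif) ^ i) = - ((z ^ d / to_ac unif) ^ n)"
        using b(2) by (simp only: eq_neg_iff_add_eq_0 add.commute)
      then show ?thesis by (simp only: sum_distrib_left[symmetric] mult_minus_right)
    qed
    also have "\<dots> = - (z ^ (d * n))" using unif(4) by (simp add: power_divide power_mult)
    finally show ?thesis by simp
  qed
  ultimately show "z \<in> \<M>" unfolding M_iff by blast
qed

lemma M_mult: "x \<in> \<M> \<Longrightarrow> y \<in> \<O> \<Longrightarrow> x * y \<in> \<M>"
proof -
  assume "x \<in> \<M>" and y: "y \<in> \<O>"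
  then obtain d where d: "d \<ge> 1" "x ^ d / to_ac unif \<in> \<O>" unfolding M_iff_power by blast
  have "(x ^ d / to_ac unif) * y ^ d \<in> \<O>" by (intro O_mult d O_power y)
  then have "(x * y) ^ d / to_ac unif \<in> \<O>" by (simp add: power_mult_distrib)
  then show ?thesis unfolding M_iff_power using d(1) by blast
qed

text \<open>In the binomial expansion with exponent d + e, every term contains \<open>x ^ d\<close>
  or \<open>y ^ e\<close>, hence is divisible by \<open>unif\<close>.\<close>

lemma M_add: assumes x: "x \<in> \<M>" and y: "y \<in> \<M>" shows "x + y \<in> \<M>"
proof -
  obtain d where d: "d \<ge> 1" "x ^ d / to_ac unif \<in> \<O>" using x unfolding M_iff_power by blast
  obtain e where e: "e \<ge> 1" "y ^ e / to_ac unif \<in> \<O>" using y unfolding M_iff_power by blast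
  have xO: "x \<in> \<O>" "y \<in> \<O>" using x y M_subset_O by auto
  have nat: "of_nat n \<in> \<O>" for n :: nat by (induction n) (auto intro: O_0 O_1 O_add)
  have eq: "(x + y) ^ (d + e) / to_ac unif =
      (\<Sum>k\<le>d + e. of_nat (d + e choose k) * (x ^ k * y ^ (d + e - k) / to_ac unif))"
    by (simp add: binomial_ring sum_divide_distrib mult.assoc)
  have "x ^ k * y ^ (d + e - k) / to_ac unif \<in> \<O>" if "k \<le> d + e" for k
  proof (cases "k \<ge> d")
    case True
    have "(x ^ d / to_ac unif) * (x ^ (k - d) * y ^ (d + e - k)) \<in> \<O>" by (intro O_mult O_power d xO)
    then show ?thesis using True by (simp add: power_add[symmetric] mult.assoc[symmetric])
  next
    case False
    have "(y ^ e / to_ac unif) * (x ^ k * y ^ (d - k)) \<in> \<O>" by (intro O_mult O_power e xO)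
    moreover have "y ^ (d + e - k) = y ^ e * y ^ (d - k)" using False by (simp add: power_add[symmetric] add.commute)
    ultimately show ?thesis by (simp add: mult_ac)
  qed
  then have "(x + y) ^ (d + e) / to_ac unif \<in> \<O>"
    unfolding eq by (intro O_sum O_mult nat) auto
  then show ?thesis unfolding M_iff_power using d(1) by (intro exI[of _ "d + e"]) auto
qed

lemma M_0: "0 \<in> \<M>" unfolding M_iff by (intro exI[of _ 1] exI[of _ "\<lambda>_. 0"]) simp

lemma M_uminus: "x \<in> \<M> \<Longrightarrow> - x \<in> \<M>"
  using M_mult[OF _ O_minus_1] by simp

text \<open>Otherwise 1 would be minus a sum of elements of value below 1, against the ultrametric
  inequality. Congruence modulo \<open>\<M>\<close> is therefore not trivial.\<close>

lemma one_not_in_M: "1 \<notin> \<M>"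
proof
  assume "1 \<in> \<M>"
  then obtain k c where c: "\<forall>i<k. v (c i) < 1" "1 ^ k + (\<Sum>i<k. to_ac (c i) * 1 ^ i) = 0"
    unfolding M_iff by blast
  then have "to_ac (1 + (\<Sum>i<k. c i)) = 0" by (simp add: to_ac_sum)
  then have "1 = - (\<Sum>i<k. c i)" by (metis add_eq_0_iff2 to_ac_eq_0_iff)
  moreover have "v (\<Sum>i<k. c i) < 1" by (rule v_sum_less) (use c(1) in auto)
  ultimately show False by (metis less_irrefl v_1 v_minus)
qed

definition cong_M :: "'f alg_closure \<Rightarrow> 'f alg_closure \<Rightarrow> bool" (infix "\<doteq>" 50) where
  "x \<doteq> y \<longleftrightarrow> x - y \<in> \<M>"

lemma cong_refl: "x \<doteq> x" by (simp add: cong_M_def M_0)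
lemma cong_sym: "x \<doteq> y \<Longrightarrow> y \<doteq> x" using M_uminus[of "x - y"] by (simp add: cong_M_def)
lemma cong_trans [trans]: "x \<doteq> y \<Longrightarrow> y \<doteq> z \<Longrightarrow> x \<doteq> z"
  using M_add[of "x - y" "y - z"] by (simp add: cong_M_def)

lemma cong_power: assumes "x \<doteq> y" "x \<in> \<O>" "y \<in> \<O>" shows "x ^ n \<doteq> y ^ n"
proof (cases n)
  case (Suc m)
  have "x ^ n - y ^ n = (x - y) * (\<Sum>i<n. y ^ (n - Suc i) * x ^ i)" by (rule power_diff_sumr2)
  then show ?thesis using assms unfolding cong_M_def
    by (auto intro!: M_mult O_sum O_mult O_power)
qed (simp add: cong_refl)

end

subsection \<open>Powers of a Frobenius element\<close>

lemma galoisD: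
  assumes "s \<in> absolute_galois"
  shows "bij s" "s (x + y) = s x + s y" "s (x * y) = s x * s y" "s (to_ac a) = to_ac a"
    "s 0 = 0" "s 1 = 1" "s (- x) = - s x" "s (x - y) = s x - s y" "s (x ^ n) = s x ^ n"
proof -
  show b: "bij s" and add: "\<And>x y. s (x + y) = s x + s y" and mult: "\<And>x y. s (x * y) = s x * s y"
    and ac: "\<And>a. s (to_ac a) = to_ac a"
    using assms unfolding absolute_galois_def by blast+
  show "s 0 = 0" "s 1 = 1" using ac[of 0] ac[of 1] by simp_all
  then have "s x + s (- x) = 0" for x using add[of x "- x"] by simp
  then show m: "\<And>x. s (- x) = - s x" by (metis add.inverse_unique)
  show "s (x - y) = s x - s y" using add[of x "- y"] m by simp
  show "s (x ^ n) = s x ^ n" using \<open>s 1 = 1\<close> by (induction n) (simp_all add: mult)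
qed

lemma galois_sum: "s \<in> absolute_galois \<Longrightarrow> s (sum f A) = (\<Sum>i\<in>A. s (f i))"
  by (induction A rule: infinite_finite_induct) (auto simp: galoisD)

lemma galois_id: "id \<in> absolute_galois"
  by (simp add: absolute_galois_def)

lemma galois_comp: "s \<in> absolute_galois \<Longrightarrow> t \<in> absolute_galois \<Longrightarrow> s \<circ> t \<in> absolute_galois"
  by (auto simp: absolute_galois_def bij_comp)

lemma galois_inv: assumes s: "s \<in> absolute_galois" shows "inv_into UNIV s \<in> absolute_galois"
proof -
  let ?t = "inv_into UNIV s"
  have st: "s (?t x) = x" for x using galoisD(1)[OF s] by (simp add: bij_is_surj surj_f_inv_f)
  have inj: "s x = s y \<longleftrightarrow> x = y" for x y using galoisD(1)[OF s] by (meson bij_def inj_eq)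
  have "?t (x + y) = ?t x + ?t y" "?t (x * y) = ?t x * ?t y" "?t (to_ac a) = to_ac a" for x y a
    by (subst inj[symmetric], simp add: st galoisD[OF s])+
  moreover have "bij ?t" using galoisD(1)[OF s] by (rule bij_imp_bij_inv)
  ultimately show ?thesis unfolding absolute_galois_def by blast
qed

lemma galois_funpow: "s \<in> absolute_galois \<Longrightarrow> s ^^ k \<in> absolute_galois"
  by (induction k) (auto simp: galois_id galois_comp)

lemma galois_root:
  assumes "s \<in> absolute_galois"
  shows "s (poly (map_poly to_ac p) x) = poly (map_poly to_ac p) (s x)"
  by (simp add: poly_altdef galois_sum[OF assms] galoisD[OF assms] coeff_map_poly)

text \<open>The orbit stays among the finitely many roots of one polynomial, so two iterates agree,
  and bijectivity cancels the smaller one.\<close>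

lemma galois_finite_orbit:
  fixes s :: "'f::field alg_closure \<Rightarrow> _"
  assumes s: "s \<in> absolute_galois"
  shows "\<exists>N\<ge>1. (s ^^ N) x = x"
proof -
  obtain p :: "'f poly" where p: "p \<noteq> 0" "poly (map_poly to_ac p) x = 0"
    by (rule alg_closure_algebraic)
  have "map_poly to_ac p \<noteq> 0" using p(1) by (auto simp: poly_eq_iff coeff_map_poly)
  then have fin: "finite {y. poly (map_poly to_ac p) y = 0}" by (rule poly_roots_finite)
  have "(s ^^ i) x \<in> {y. poly (map_poly to_ac p) y = 0}" for i
    using galois_root[OF galois_funpow[OF s, of i], of p x] p(2) galoisD(5)[OF galois_funpow[OF s]] by simp
  then have "\<not> inj (\<lambda>i. (s ^^ i) x)"
    using fin by (metis (no_types, lifting) finite_imageD finite_subset image_subsetI infinite_UNIV_nat)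
  then obtain i j where ij: "i < j" "(s ^^ i) x = (s ^^ j) x"
    unfolding inj_def by (metis linorder_neqE_nat)
  have "(s ^^ i) ((s ^^ (j - i)) x) = (s ^^ j) x"
    using ij(1) by (metis add_diff_inverse_nat comp_apply funpow_add less_imp_le_nat not_le)
  then have "(s ^^ (j - i)) x = x"
    using ij(2) galoisD(1)[OF galois_funpow[OF s, of i]] by (metis bij_def injD)
  then show ?thesis using ij(1) by (intro exI[of _ "j - i"]) auto
qed

lemma funpow_fixed: "f x = x \<Longrightarrow> (f ^^ k) x = x"
  by (induction k) auto

lemma galois_finite_order_on:
  assumes s: "s \<in> absolute_galois" and "finite A"
  shows "\<exists>N\<ge>1. \<forall>x\<in>A. (s ^^ N) x = x"
  using assms(2)
proof (induction A rule: finite_induct)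
  case (insert x A)
  obtain N where N: "N \<ge> 1" "\<forall>x\<in>A. (s ^^ N) x = x" using insert.IH by blast
  obtain L where L: "L \<ge> 1" "(s ^^ L) x = x" using galois_finite_orbit[OF s] by blast
  have "(s ^^ (N * L)) y = y" if "y \<in> insert x A" for y
  proof (cases "y = x")
    case True
    then show ?thesis using funpow_fixed[of "s ^^ L" x N] L by (simp add: funpow_mult mult.commute)
  next
    case False
    then show ?thesis using that funpow_fixed[of "s ^^ N" y L] N by (simp add: funpow_mult)
  qed
  then show ?case using N(1) L(1) by (intro exI[of _ "N * L"]) auto
qed auto

context padic
begin

abbreviation "q \<equiv> residue_card v"

lemma galois_O: assumes "s \<in> absolute_galois" "x \<in> \<O>" shows "s x \<in> \<O>"
proof -
  obtain p where p: "Polynomial.lead_coeff p = 1" "\<forall>i. v (Polynomial.coeff p i) \<le> 1" "poly (map_poly to_ac p) x = 0"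
    using assms(2) unfolding ac_integers_def by blast
  then have "poly (map_poly to_ac p) (s x) = 0" by (metis galois_root galoisD(5) assms(1))
  then show ?thesis using p unfolding ac_integers_def by blast
qed

lemma q_ge_2: "q \<ge> 2"
proof -
  let ?r = "{(x, y). v x \<le> 1 \<and> v y \<le> 1 \<and> v (x - y) < 1}"
  have "?r `` {0} \<in> {x. v x \<le> 1} // ?r" "?r `` {1} \<in> {x. v x \<le> 1} // ?r"
    by (rule quotientI, simp)+
  then have "{?r `` {0}, ?r `` {1}} \<subseteq> {x. v x \<le> 1} // ?r" by blast
  moreover have "finite ({x. v x \<le> 1} // ?r)" using padic unfolding padic_field_def by (elim conjE)
  ultimately have "card {?r `` {0}, ?r `` {1}} \<le> q" unfolding residue_card_def by (rule card_mono[rotated])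
  moreover have "1 \<in> ?r `` {1}" "1 \<notin> ?r `` {0}" by auto
  then have "?r `` {0} \<noteq> ?r `` {1}" by blast
  ultimately show ?thesis by simp
qed

text \<open>The two signs in \<open>residue_power\<close> are separated, with natural exponents, so
  that iterates can be handled by induction and inverses by exchanging the two notions.\<close>

definition frob_power :: "('f alg_closure \<Rightarrow> 'f alg_closure) \<Rightarrow> nat \<Rightarrow> bool" where
  "frob_power s k \<longleftrightarrow> (\<forall>x\<in>\<O>. s x \<doteq> x ^ (q ^ k))"

definition frob_inv :: "('f alg_closure \<Rightarrow> 'f alg_closure) \<Rightarrow> nat \<Rightarrow> bool" where
  "frob_inv s k \<longleftrightarrow> (\<forall>x\<in>\<O>. x \<doteq> s x ^ (q ^ k))"

lemma residue_power_iff: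
  "residue_power v s (int k) \<longleftrightarrow> frob_power s k" "residue_power v s (- int k) \<longleftrightarrow> frob_inv s k"
proof -
  show "residue_power v s (int k) \<longleftrightarrow> frob_power s k"
    by (simp add: residue_power_def frob_power_def cong_M_def)
  show "residue_power v s (- int k) \<longleftrightarrow> frob_inv s k"
    by (cases "k = 0") (auto simp: residue_power_def frob_inv_def cong_M_def[symmetric] intro: cong_sym)
qed

lemma weil_carrier_iff:
  "s \<in> carrier (weil v) \<longleftrightarrow> s \<in> absolute_galois \<and> (\<exists>k. frob_power s k \<or> frob_inv s k)"
proof -
  have "(\<exists>n. residue_power v s n) \<longleftrightarrow> (\<exists>k. frob_power s k \<or> frob_inv s k)"
    by (metis int_cases2 residue_power_iff)
  then show ?thesis by (simp add: weil_def)
qed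

lemma frob_power_funpow: assumes s: "s \<in> absolute_galois" and "frob_power s 1" shows "frob_power (s ^^ k) k"
  unfolding frob_power_def
proof
  fix x assume x: "x \<in> \<O>"
  show "(s ^^ k) x \<doteq> x ^ (q ^ k)"
  proof (induction k)
    case (Suc k)
    have o: "(s ^^ k) x \<in> \<O>" using galois_O[OF galois_funpow[OF s] x] .
    have "s ((s ^^ k) x) \<doteq> (s ^^ k) x ^ q" using assms(2) o by (simp add: frob_power_def)
    also have "(s ^^ k) x ^ q \<doteq> (x ^ (q ^ k)) ^ q" by (intro cong_power Suc o O_power x)
    finally show ?case by (simp add: power_mult[symmetric] mult.commute)
  qed (simp add: cong_refl)
qed

lemma frob_inv_funpow: assumes s: "s \<in> absolute_galois" and "frob_inv s 1" shows "frob_inv (s ^^ k) k"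
  unfolding frob_inv_def
proof
  fix x assume x: "x \<in> \<O>"
  show "x \<doteq> (s ^^ k) x ^ (q ^ k)"
  proof (induction k)
    case (Suc k)
    have o: "(s ^^ k) x \<in> \<O>" using galois_O[OF galois_funpow[OF s] x] .
    have o': "s ((s ^^ k) x) \<in> \<O>" using galois_O[OF s o] .
    have "(s ^^ k) x \<doteq> s ((s ^^ k) x) ^ q" using assms(2) o by (simp add: frob_inv_def)
    then have "(s ^^ k) x ^ (q ^ k) \<doteq> (s ((s ^^ k) x) ^ q) ^ (q ^ k)" by (intro cong_power o O_power o')
    then show ?case using Suc cong_trans by (simp add: power_mult[symmetric])
  qed (simp add: cong_refl)
qed

lemma galois_inv_apply: "s \<in> absolute_galois \<Longrightarrow> s (inv_into UNIV s x) = x"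
  by (meson bij_is_surj galoisD(1) surj_f_inv_f)

lemma frob_power_inv: assumes "s \<in> absolute_galois" "frob_power s k" shows "frob_inv (inv_into UNIV s) k"
  using assms galois_O[OF galois_inv[OF assms(1)]] unfolding frob_power_def frob_inv_def
  by (metis galois_inv_apply)

lemma frob_inv_inv: assumes "s \<in> absolute_galois" "frob_inv s k" shows "frob_power (inv_into UNIV s) k"
  using assms galois_O[OF galois_inv[OF assms(1)]] unfolding frob_power_def frob_inv_def
  by (metis galois_inv_apply)

lemma frobenius_galois: "frobenius_element v Fr \<Longrightarrow> Fr \<in> absolute_galois"
  by (simp add: frobenius_element_def weil_carrier_iff)

lemma frobenius_cases:
  assumes "frobenius_element v Fr"
  shows "frob_power Fr 1 \<or> frob_inv Fr 1"
  using assms residue_power_iff(1)[of Fr 1] residue_power_iff(2)[of Fr 1] by (auto simp: frobenius_element_def)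

lemma frobenius_funpow_weil:
  assumes "frobenius_element v Fr"
  shows "Fr ^^ k \<in> carrier (weil v)" "inv_into UNIV (Fr ^^ k) \<in> carrier (weil v)"
  using frobenius_cases[OF assms] frob_power_funpow frob_inv_funpow frob_power_inv frob_inv_inv
    galois_funpow galois_inv frobenius_galois[OF assms] unfolding weil_carrier_iff by blast+

lemma weil_id: "id \<in> carrier (weil v)"
  unfolding weil_carrier_iff by (auto simp: galois_id frob_power_def intro!: exI[of _ 0] cong_refl)

lemma inertia_iff: "i \<in> inertia v \<longleftrightarrow> i \<in> absolute_galois \<and> (\<forall>x\<in>\<O>. i x \<doteq> x)"
  using residue_power_iff(1)[of i 0] by (simp add: inertia_def frob_power_def)

text \<open>On the residue field an element \<open>x\<close> with \<open>x ^ Q - x = 1\<close> is not fixed by the \<open>Q\<close>-th power map.\<close>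

lemma ex_not_frobenius_fixed:
  assumes "Q \<ge> 2"
  shows "\<exists>x\<in>\<O>. x ^ Q - x = 1"
proof -
  define c :: "nat \<Rightarrow> 'f" where "c k = (if k \<le> 1 then -1 else 0)" for k
  define f where "f k = (if k = Q then 1 else to_ac (c k))" for k
  obtain x where "(\<Sum>k\<le>Q. f k * x ^ k) = 0"
    using alg_closed[of Q f] assms by (auto simp: f_def)
  then have x: "x ^ Q + (\<Sum>k<Q. to_ac (c k) * x ^ k) = 0"
    by (simp add: lessThan_Suc_atMost[symmetric] f_def add.commute)
  then have "x \<in> \<O>" unfolding O_iff by (intro exI[of _ Q] exI[of _ c]) (auto simp: c_def)
  moreover have "(\<Sum>k<Q. to_ac (c k) * x ^ k) = (\<Sum>k\<in>{0, 1}. to_ac (c k) * x ^ k)"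
    using assms by (intro sum.mono_neutral_right) (auto simp: c_def)
  then have "(\<Sum>k<Q. to_ac (c k) * x ^ k) = - 1 - x" by (simp add: c_def)
  then have "x ^ Q = - (- 1 - x)" using x by (simp only: eq_neg_iff_add_eq_0)
  then have "x ^ Q - x = 1" by simp
  ultimately show ?thesis by blast
qed

text \<open>Otherwise every integral x would satisfy x^(q^m) = x modulo \<open>\<M>\<close>, which
  fails for a root of x^Q - x = 1 with Q = q^m. The exponent in \<open>weil_norm\<close> is unique
  for this reason.\<close>

lemma frobenius_power_not_inertia:
  assumes Fr: "frobenius_element v Fr" and m: "m \<ge> 1"
  shows "\<exists>x\<in>\<O>. \<not> (Fr ^^ m) x \<doteq> x"
proof (rule ccontr)
  assume "\<not> ?thesis"
  then have fix_: "\<And>x. x \<in> \<O> \<Longrightarrow> (Fr ^^ m) x \<doteq> x" by blast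
  have g: "Fr ^^ m \<in> absolute_galois" using Fr frobenius_galois galois_funpow by blast
  have "q ^ 1 \<le> q ^ m" using q_ge_2 m by (intro power_increasing) auto
  then obtain x where x: "x \<in> \<O>" "x ^ (q ^ m) - x = 1"
    using ex_not_frobenius_fixed[of "q ^ m"] q_ge_2 by auto
  have "x ^ (q ^ m) \<doteq> x"
    using frobenius_cases[OF Fr]
  proof
    assume "frob_power Fr 1"
    then have "(Fr ^^ m) x \<doteq> x ^ (q ^ m)"
      using frob_power_funpow frobenius_galois[OF Fr] x(1) unfolding frob_power_def by blast
    then show ?thesis using fix_[OF x(1)] cong_sym cong_trans by blast
  next
    assume "frob_inv Fr 1"
    then have "x \<doteq> (Fr ^^ m) x ^ (q ^ m)"
      using frob_inv_funpow frobenius_galois[OF Fr] x(1) unfolding frob_inv_def by blast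
    also have "(Fr ^^ m) x ^ (q ^ m) \<doteq> x ^ (q ^ m)"
      by (intro cong_power fix_ galois_O[OF g] x)
    finally show ?thesis by (rule cong_sym)
  qed
  then show False using x(2) one_not_in_M by (simp add: cong_M_def)
qed

lemma weil_nat_pow: "Fr [^]\<^bsub>weil v\<^esub> (k::nat) = Fr ^^ k"
  by (induction k) (simp_all add: nat_pow_def weil_def funpow_swap1 fun_eq_iff)

lemma weil_inv_funpow:
  assumes "frobenius_element v Fr"
  shows "inv\<^bsub>weil v\<^esub> (Fr ^^ k) = inv_into UNIV (Fr ^^ k)"
proof -
  have b: "bij (Fr ^^ k)" using assms frobenius_galois galois_funpow galoisD(1) by blast
  show ?thesis
    unfolding m_inv_def
  proof (rule the_equality)
    show "inv_into UNIV (Fr ^^ k) \<in> carrier (weil v) \<and>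
      Fr ^^ k \<otimes>\<^bsub>weil v\<^esub> inv_into UNIV (Fr ^^ k) = \<one>\<^bsub>weil v\<^esub> \<and>
      inv_into UNIV (Fr ^^ k) \<otimes>\<^bsub>weil v\<^esub> Fr ^^ k = \<one>\<^bsub>weil v\<^esub>"
      using frobenius_funpow_weil(2)[OF assms] b
      by (simp add: weil_def surj_iff[symmetric] inj_iff[symmetric] bij_is_inj bij_is_surj)
    fix y assume "y \<in> carrier (weil v) \<and> Fr ^^ k \<otimes>\<^bsub>weil v\<^esub> y = \<one>\<^bsub>weil v\<^esub> \<and> y \<otimes>\<^bsub>weil v\<^esub> Fr ^^ k = \<one>\<^bsub>weil v\<^esub>"
    then have "y \<circ> (Fr ^^ k) = id" "(Fr ^^ k) \<circ> y = id" by (simp_all add: weil_def)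
    then show "y = inv_into UNIV (Fr ^^ k)" using inv_unique_comp by metis
  qed
qed

text \<open>The exponent 1 is admissible with the inertia element \<open>id\<close>. Any other
  exponent n would make a positive power of \<open>Fr\<close> trivial on the residue field.\<close>

lemma weil_norm_frobenius:
  assumes Fr: "frobenius_element v Fr"
  shows "weil_norm v Fr Fr = inverse (real q)"
proof -
  have g: "Fr \<in> absolute_galois" by (rule frobenius_galois[OF Fr])
  have gk: "Fr ^^ k \<in> absolute_galois" for k by (rule galois_funpow[OF g])
  have inj: "inj (Fr ^^ k)" for k using galoisD(1)[OF gk] bij_is_inj by blast
  have "(THE n::int. \<exists>i\<in>inertia v. Fr = (Fr [^]\<^bsub>weil v\<^esub> n) \<circ> i) = 1"
  proof (rule the_equality)
    have "Fr [^]\<^bsub>weil v\<^esub> (1::int) = Fr"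
      using weil_nat_pow[of Fr 1] by (simp add: int_pow_def nat_pow_def)
    moreover have "id \<in> inertia v" by (simp add: inertia_iff galois_id cong_refl)
    ultimately show "\<exists>i\<in>inertia v. Fr = (Fr [^]\<^bsub>weil v\<^esub> (1::int)) \<circ> i" by (intro bexI[of _ id]) simp_all
    fix n :: int assume "\<exists>i\<in>inertia v. Fr = (Fr [^]\<^bsub>weil v\<^esub> n) \<circ> i"
    then obtain i where "i \<in> inertia v" and i3: "Fr = (Fr [^]\<^bsub>weil v\<^esub> n) \<circ> i" by blast
    then have i: "i \<in> absolute_galois" "\<forall>x\<in>\<O>. i x \<doteq> x" unfolding inertia_iff by blast+
    show "n = 1"
    proof (rule ccontr)
      assume n: "n \<noteq> 1"
      have "\<exists>m\<ge>1. \<forall>x\<in>\<O>. (Fr ^^ m) x \<doteq> x"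
      proof (cases "n < 0")
        case True
        define k where "k = nat (- n)"
        have "Fr = inv_into UNIV (Fr ^^ k) \<circ> i"
          using i3 True weil_nat_pow[of Fr k] weil_inv_funpow[OF Fr, of k]
          by (simp add: int_pow_def nat_pow_def k_def)
        then have "(Fr ^^ k) (Fr x) = i x" for x
          using galois_inv_apply[OF gk, of k] by (metis comp_apply)
        \<comment> \<open>Here k = -n, so the exponent is 1 - n.\<close>
        then have "(Fr ^^ Suc k) x = i x" for x by (simp add: funpow_swap1)
        then show ?thesis using i(2) by (intro exI[of _ "Suc k"]) auto
      next
        case False
        define k where "k = nat n"
        have e: "Fr = (Fr ^^ k) \<circ> i"
          using i3 False weil_nat_pow[of Fr k] by (simp add: int_pow_def nat_pow_def k_def)
        show ?thesis
        proof (cases k)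
          case 0
          then show ?thesis using e i(2) by (intro exI[of _ 1]) auto
        next
          case (Suc l)
          then have "Fr x = Fr ((Fr ^^ l) (i x))" for x using e by (metis comp_apply funpow.simps(2))
          \<comment> \<open>Here l = n - 1 and \<open>Fr ^^ l\<close> is inverse to
            \<open>i\<close>. To see that it is trivial on residues, x is written as the image under
            \<open>i\<close> of an integral element.\<close>
          then have l: "(Fr ^^ l) (i x) = x" for x using inj[of 1] by (simp add: inj_eq)
          have "(Fr ^^ l) x \<doteq> x" if x: "x \<in> \<O>" for x
          proof -
            obtain y where y: "x = i y" using galoisD(1)[OF i(1)] by (metis bij_pointE)
            have "y = inv_into UNIV i x" using y galoisD(1)[OF i(1)] by (simp add: bij_is_inj)
            then have "y \<in> \<O>" using galois_O[OF galois_inv[OF i(1)] x] by simp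
            then have "i y \<doteq> y" using i(2) by blast
            then show ?thesis using y l cong_sym by simp
          qed
          moreover have "l \<ge> 1" using n Suc False by (cases l) (auto simp: k_def)
          ultimately show ?thesis by blast
        qed
      qed
      then show False using frobenius_power_not_inertia[OF Fr] by blast
    qed
  qed
  then show ?thesis by (simp add: weil_norm_def power_int_minus)
qed

text \<open>Holds whatever integer the description in \<open>weil_norm\<close> denotes; apart from
  the value at \<open>Fr\<close>, no further property of the norm is used.\<close>

lemma weil_norm_pos: "0 < weil_norm v Fr w"
  unfolding weil_norm_def using q_ge_2 by (intro zero_less_power_int) auto

end

section \<open>Algebraic groups and their Lie algebras\<close>

lemma topspace_zariski: "topspace (zariski :: ('k::field^'n^'n) topology) = UNIV"
proof -
  have "zariski_open (UNIV :: ('k^'n^'n) set)"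
    unfolding zariski_open_def mat_polys_def
    by (intro ballI bexI[where x = "\<lambda>_. 1"] polyfuns.const) simp_all
  then have "openin (zariski :: ('k^'n^'n) topology) UNIV" by (simp add: openin_zariski)
  from openin_subset[OF this] show ?thesis by (rule top.extremum_uniqueI)
qed

lemma inv_GL:
  assumes "invertible (g :: 'k::field^'n^'n)"
  shows "inv\<^bsub>GL\<^esub> g = matrix_inv g"
  unfolding m_inv_def
proof (rule the_equality)
  show "matrix_inv g \<in> carrier GL \<and> g \<otimes>\<^bsub>GL\<^esub> matrix_inv g = \<one>\<^bsub>GL\<^esub> \<and> matrix_inv g \<otimes>\<^bsub>GL\<^esub> g = \<one>\<^bsub>GL\<^esub>"
    using matrix_inv_mult[OF assms] invertibleI[of "matrix_inv g" g] by (simp add: GL_def)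
  fix y assume "y \<in> carrier GL \<and> g \<otimes>\<^bsub>GL\<^esub> y = \<one>\<^bsub>GL\<^esub> \<and> y \<otimes>\<^bsub>GL\<^esub> g = \<one>\<^bsub>GL\<^esub>"
  then have "g ** y = mat 1" by (simp add: GL_def)
  then show "y = matrix_inv g" by (rule matrix_inv_eqI[symmetric])
qed

locale alg_group =
  fixes Gd :: "(complex^'m^'m) set"
  assumes alg: "algebraic_group Gd"
begin

lemma sub: "subgroup Gd GL"
  using alg by (simp add: algebraic_group_def)

lemma one_mem: "mat 1 \<in> Gd" and mult_mem: "g \<in> Gd \<Longrightarrow> h \<in> Gd \<Longrightarrow> g ** h \<in> Gd"
  and invertible_mem: "g \<in> Gd \<Longrightarrow> invertible g"
  using subgroup.one_closed[OF sub] subgroup.m_closed[OF sub, of g h] subgroup.mem_carrier[OF sub, of g]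
  by (simp_all add: GL_def)

lemma inv_mem: "g \<in> Gd \<Longrightarrow> matrix_inv g \<in> Gd"
  using subgroup.m_inv_closed[OF sub, of g] by (simp add: inv_GL invertible_mem)

lemma memI:
  assumes "invertible g" "\<And>p. p \<in> mat_polys UNIV \<Longrightarrow> (\<And>h. h \<in> Gd \<Longrightarrow> p h = 0) \<Longrightarrow> p g = 0"
  shows "g \<in> Gd"
proof -
  have "\<exists>T. closedin zariski T \<and> Gd = T \<inter> carrier GL"
    using alg by (simp add: algebraic_group_def closedin_subtopology)
  then obtain T where T: "closedin zariski T" "Gd = T \<inter> carrier GL" by (elim exE conjE)
  have "g \<in> T"
  proof (rule ccontr)
    assume g: "g \<notin> T"
    have "zariski_open (UNIV - T)"
      using T(1) by (simp add: closedin_def topspace_zariski openin_zariski)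
    then have "\<exists>p \<in> mat_polys UNIV. p g \<noteq> 0 \<and> {B. p B \<noteq> 0} \<subseteq> UNIV - T"
      using g by (simp add: zariski_open_def)
    then obtain p where p: "p \<in> mat_polys UNIV" "p g \<noteq> 0" "{B. p B \<noteq> 0} \<subseteq> UNIV - T"
      by (elim bexE conjE)
    have "p h = 0" if "h \<in> Gd" for h using that T(2) p(3) by auto
    then show False using assms(2)[OF p(1)] p(2) by simp
  qed
  then show ?thesis using T(2) assms(1) by (simp add: GL_def)
qed

lemma lie_algebraD:
  assumes Z: "Z \<in> lie_algebra Gd" and p: "p \<in> mat_polys UNIV" "\<And>g. g \<in> Gd \<Longrightarrow> p g = 0"
    and D: "(p has_derivative D) (at (mat 1))"
  shows "D Z = 0"
proof -
  have "\<exists>r. \<forall>t. p (mat 1 + mat t ** Z) = t^2 * poly r t"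
    using Z[unfolded lie_algebra_def mem_Collect_eq, THEN bspec, OF p(1)] p(2) by simp
  then obtain r where r: "\<And>t. p (mat 1 + t *\<^sub>c Z) = t^2 * poly r t"
    by (auto simp: mat_mult_cscale)
  have "((\<lambda>t::real. mat 1 + t *\<^sub>R Z) has_derivative (\<lambda>h. h *\<^sub>R Z)) (at 0)"
    by (auto intro!: derivative_eq_intros)
  then have "((\<lambda>t::real. p (mat 1 + t *\<^sub>R Z)) has_derivative (\<lambda>h. D (h *\<^sub>R Z))) (at 0)"
    by (rule has_derivative_compose) (use D in simp)
  then have "((\<lambda>t::real. p (mat 1 + t *\<^sub>R Z)) has_vector_derivative D Z) (at 0)"
    using has_derivative_bounded_linear[OF D] by (simp add: has_vector_derivative_def bounded_linear.linear linear_scale)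
  moreover have "((\<lambda>z. z^2 * poly r z) has_field_derivative 0) (at (of_real 0))"
    by (auto intro!: derivative_eq_intros)
  then have "((\<lambda>t::real. (of_real t)^2 * poly r (of_real t)) has_vector_derivative 0) (at 0)"
    by (rule has_vector_derivative_real_field)
  then have "((\<lambda>t::real. p (mat 1 + t *\<^sub>R Z)) has_vector_derivative 0) (at 0)"
    by (simp add: r[symmetric] cscale_of_real)
  ultimately show ?thesis by (rule vector_derivative_unique_at)
qed

text \<open>On the line through the identity in direction \<open>Z\<close> the constant term
  vanishes because \<open>mat 1 \<in> Gd\<close>, and the linear term because
  \<open>D Z = 0\<close>; the rest is divisible by t^2.\<close>

lemma lie_algebraI:
  assumes "\<And>p D. p \<in> mat_polys UNIV \<Longrightarrow> (\<And>g. g \<in> Gd \<Longrightarrow> p g = 0) \<Longrightarrow> clinear_functional D \<Longrightarrow>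
    (p has_derivative D) (at (mat 1)) \<Longrightarrow> D Z = 0"
  shows "Z \<in> lie_algebra Gd"
  unfolding lie_algebra_def mem_Collect_eq
proof (intro ballI impI)
  fix p assume p: "p \<in> mat_polys UNIV" "\<forall>g\<in>Gd. p g = 0"
  obtain a where D: "(p has_derivative (\<lambda>U. \<Sum>i\<in>UNIV. \<Sum>j\<in>UNIV. a i j * U $ i $ j)) (at (mat 1))"
    using mat_poly_has_derivative[OF p(1)] ..
  define D where "D = (\<lambda>U::complex^'m^'m. \<Sum>i\<in>UNIV. \<Sum>j\<in>UNIV. a i j * U $ i $ j)"
  have D: "(p has_derivative D) (at (mat 1))" "clinear_functional D"
    using D unfolding D_def clinear_functional_def by blast+
  have DZ: "D Z = 0"
    by (rule assms[OF p(1) _ D(2) D(1)]) (use p(2) in simp)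
  obtain P where P: "\<And>t. p (mat 1 + t *\<^sub>c Z) = poly P t" using mat_poly_affine_line[OF p(1)] by blast
  have "poly P 0 = 0" using P[of 0] p(2) one_mem by simp
  then have c0: "Polynomial.coeff P 0 = 0" by (simp add: poly_0_coeff_0)
  have "((\<lambda>t::real. mat 1 + t *\<^sub>R Z) has_derivative (\<lambda>h. h *\<^sub>R Z)) (at 0)"
    by (auto intro!: derivative_eq_intros)
  then have "((\<lambda>t::real. p (mat 1 + t *\<^sub>R Z)) has_derivative (\<lambda>h. D (h *\<^sub>R Z))) (at 0)"
    by (rule has_derivative_compose) (use D in simp)
  then have "((\<lambda>t::real. p (mat 1 + t *\<^sub>R Z)) has_vector_derivative D Z) (at 0)"
    using has_derivative_bounded_linear[OF D(1)] by (simp add: has_vector_derivative_def bounded_linear.linear linear_scale)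
  then have "((\<lambda>t::real. poly P (of_real t)) has_vector_derivative D Z) (at 0)"
    by (simp add: P[symmetric] cscale_of_real)
  moreover have "((\<lambda>t::real. poly P (of_real t)) has_vector_derivative poly (pderiv P) 0) (at 0)"
    using has_vector_derivative_real_field[OF poly_DERIV[of P "of_real 0"]] by simp
  ultimately have "D Z = poly (pderiv P) 0" by (rule vector_derivative_unique_at)
  then have "poly (pderiv P) 0 = 0" using DZ by simp
  then have c1: "Polynomial.coeff P 1 = 0" by (simp add: poly_0_coeff_0 coeff_pderiv)
  have eq: "P = pCons 0 (pCons 0 (poly_shift 2 P))"
    using c0 c1 by (intro poly_eqI) (auto simp: coeff_pCons coeff_poly_shift numeral_2_eq_2 split: nat.splits)
  have "poly P t = t^2 * poly (poly_shift 2 P) t" for t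
    using arg_cong[OF eq, of "\<lambda>p. poly p t"] by (simp add: power2_eq_square mult.assoc)
  then show "\<exists>r. \<forall>t. p (mat 1 + mat t ** Z) = t^2 * poly r t" by (auto simp: mat_mult_cscale P)
qed

lemma lie_algebra_add:
  assumes "Z \<in> lie_algebra Gd" "W \<in> lie_algebra Gd"
  shows "Z + W \<in> lie_algebra Gd"
proof (rule lie_algebraI)
  fix p D assume p: "p \<in> mat_polys UNIV" "\<And>g. g \<in> Gd \<Longrightarrow> p g = 0"
    and D: "clinear_functional D" "(p has_derivative D) (at (mat 1))"
  show "D (Z + W) = 0"
    using lie_algebraD[OF assms(1) p D(2)] lie_algebraD[OF assms(2) p D(2)] clinear_functionalD(1)[OF D(1)] by simp
qed

lemma lie_algebra_cscale:
  assumes "Z \<in> lie_algebra Gd"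
  shows "c *\<^sub>c Z \<in> lie_algebra Gd"
proof (rule lie_algebraI)
  fix p D assume p: "p \<in> mat_polys UNIV" "\<And>g. g \<in> Gd \<Longrightarrow> p g = 0"
    and D: "clinear_functional D" "(p has_derivative D) (at (mat 1))"
  show "D (c *\<^sub>c Z) = 0"
    using lie_algebraD[OF assms p D(2)] clinear_functionalD(2)[OF D(1)] by simp
qed

lemma lie_algebra_curve:
  assumes "curve_in Gd \<gamma> Z"
  shows "Z \<in> lie_algebra Gd"
proof (rule lie_algebraI)
  fix p D assume p: "\<And>g. g \<in> Gd \<Longrightarrow> p g = 0" and D: "(p has_derivative D) (at (mat 1))"
  have c: "\<gamma> 0 = mat 1" "\<And>t. \<gamma> t \<in> Gd" "(\<gamma> has_derivative (\<lambda>h. h *\<^sub>R Z)) (at 0)"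
    using assms by (simp_all add: curve_in_def has_vector_derivative_def)
  from c(3) have "((\<lambda>t. p (\<gamma> t)) has_derivative (\<lambda>h. D (h *\<^sub>R Z))) (at 0)"
    by (rule has_derivative_compose) (use D c(1) in simp)
  then have "((\<lambda>t. p (\<gamma> t)) has_vector_derivative D Z) (at 0)"
    using has_derivative_bounded_linear[OF D] by (simp add: has_vector_derivative_def bounded_linear.linear linear_scale)
  then have "((\<lambda>t::real. 0) has_vector_derivative D Z) (at 0)" using p c(2) by simp
  then show "D Z = 0" using vector_derivative_unique_at[OF has_vector_derivative_const] by fastforce
qed

text \<open>The left-invariant derivation attached to \<open>Z\<close> preserves the ideal of \<open>Gd\<close>, so every polynomial
  in it has vanishing Taylor series along \<open>t \<mapsto> mexp (t Z)\<close>.\<close>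

lemma mexp_mem:
  assumes Z: "Z \<in> lie_algebra Gd"
  shows "mexp Z \<in> Gd"
proof (rule memI[OF invertible_mexp])
  define I where "I = {p. p \<in> mat_polys UNIV \<and> (\<forall>h\<in>Gd. p h = 0)}"
  define f where "f p t = p (mexp (t *\<^sub>c Z))" for p :: "complex^'m^'m \<Rightarrow> complex" and t
  have ex: "\<exists>p'\<in>I. \<forall>t. (f p has_field_derivative f p' t) (at t)" if "p \<in> I" for p
  proof -
    have p: "p \<in> mat_polys UNIV" "\<And>h. h \<in> Gd \<Longrightarrow> p h = 0" using that unfolding I_def by blast+
    have "\<exists>g. (\<forall>i j. g i j \<in> mat_polys UNIV) \<and>
      (\<forall>A. (p has_derivative (\<lambda>U. \<Sum>i\<in>UNIV. \<Sum>j\<in>UNIV. g i j A * U $ i $ j)) (at A))"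
      by (rule mat_poly_gradient[OF p(1)])
    then obtain g where "(\<forall>i j. g i j \<in> mat_polys UNIV) \<and>
      (\<forall>A. (p has_derivative (\<lambda>U. \<Sum>i\<in>UNIV. \<Sum>j\<in>UNIV. g i j A * U $ i $ j)) (at A))" ..
    then have g: "\<And>i j. g i j \<in> mat_polys UNIV"
      "\<And>A. (p has_derivative (\<lambda>U. \<Sum>i\<in>UNIV. \<Sum>j\<in>UNIV. g i j A * U $ i $ j)) (at A)" by simp_all
    define p' where "p' A = (\<Sum>i\<in>UNIV. \<Sum>j\<in>UNIV. g i j A * (A ** Z) $ i $ j)" for A
    have "p' \<in> polyfuns UNIV {f. \<exists>i j. f = (\<lambda>A. A $ i $ j)}"
      unfolding p'_def
    proof (intro polyfuns_sum)
      fix i j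
      have "(\<lambda>A. A $ i $ k * Z $ k $ j) \<in> polyfuns UNIV {f. \<exists>i j. f = (\<lambda>A::complex^'m^'m. A $ i $ j)}" for k
        by (rule polyfuns.mult) (rule polyfuns.coord, blast, rule polyfuns.const, simp)
      then have "(\<lambda>A. (A ** Z) $ i $ j) \<in> polyfuns UNIV {f. \<exists>i j. f = (\<lambda>A::complex^'m^'m. A $ i $ j)}"
        unfolding matrix_mult_nth by (rule polyfuns_sum)
      then show "(\<lambda>A. g i j A * (A ** Z) $ i $ j) \<in> polyfuns UNIV {f. \<exists>i j. f = (\<lambda>A. A $ i $ j)}"
        by (rule polyfuns.mult[OF g(1)[unfolded mat_polys_def]])
    qed
    moreover have "p' h = 0" if h: "h \<in> Gd" for h
    proof -
      \<comment> \<open>The left translate of p by h also vanishes on \<open>Gd\<close>, so tangency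
        of \<open>Z\<close> at the identity gives the vanishing of \<open>p'\<close> at h.\<close>
      have "((\<lambda>A. p (h ** A)) has_derivative (\<lambda>U. \<Sum>i\<in>UNIV. \<Sum>j\<in>UNIV. g i j h * (h ** U) $ i $ j)) (at (mat 1))"
        by (rule has_derivative_compose[OF bounded_linear_imp_has_derivative[OF bounded_linear_matrix_left]])
           (use g(2)[of h] in simp)
      then show ?thesis unfolding p'_def
        using lie_algebraD[OF Z mat_polys_left_translate[OF p(1)]] p(2) mult_mem[OF h] by blast
    qed
    ultimately have "p' \<in> I" unfolding I_def mat_polys_def by blast
    moreover have "(f p has_field_derivative f p' t) (at t)" for t
    proof -
      let ?E = "mexp (t *\<^sub>c Z)"
      have "((\<lambda>t. mexp (t *\<^sub>c Z)) has_derivative (\<lambda>h. h *\<^sub>c (?E ** Z))) (at t)"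
        using mexp_cscale_has_field_derivative
        by (intro has_derivative_matrixI) (simp add: has_field_derivative_def mult.commute mult_commute_abs)
      then have "((\<lambda>t. p (mexp (t *\<^sub>c Z))) has_derivative
          (\<lambda>h. \<Sum>i\<in>UNIV. \<Sum>j\<in>UNIV. g i j ?E * (h *\<^sub>c (?E ** Z)) $ i $ j)) (at t)"
        by (rule has_derivative_compose) (rule g(2))
      then show ?thesis
        unfolding has_field_derivative_def f_def
        by (rule has_derivative_eq_rhs) (simp add: fun_eq_iff p'_def sum_distrib_left mult_ac)
    qed
    ultimately show ?thesis by blast
  qed
  have zero: "(deriv ^^ n) (f p) 0 = 0" if "p \<in> I" for n p
    using that
  proof (induction n arbitrary: p)
    case 0
    then show ?case using one_mem by (simp add: f_def I_def)
  next
    case (Suc n)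
    obtain p' where p': "p' \<in> I" "\<forall>t. (f p has_field_derivative f p' t) (at t)" using ex[OF Suc.prems] ..
    then have "deriv (f p) = f p'" by (auto simp: fun_eq_iff intro: DERIV_imp_deriv)
    then show ?case using Suc.IH[OF p'(1)] by (simp add: funpow_swap1 del: funpow.simps add: funpow_Suc_right)
  qed
  fix p assume p: "p \<in> mat_polys UNIV" "\<And>h. h \<in> Gd \<Longrightarrow> p h = 0"
  then have pI: "p \<in> I" by (simp add: I_def)
  have hol: "f p holomorphic_on UNIV"
  proof -
    obtain p' where "\<forall>t. (f p has_field_derivative f p' t) (at t)" using ex[OF pI] by blast
    then show ?thesis unfolding holomorphic_on_open[OF open_UNIV] by blast
  qed
  have "f p 1 = 0"
    by (rule holomorphic_fun_eq_0_on_connected[OF hol open_UNIV connected_UNIV, of 0]) (auto intro: zero[OF pI])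
  then show "p (mexp Z) = 0" by (simp add: f_def)
qed

lemma mexp_scaleR_mem: "Z \<in> lie_algebra Gd \<Longrightarrow> mexp (t *\<^sub>R Z) \<in> Gd"
  using mexp_mem lie_algebra_cscale[of Z "of_real t"] by (simp add: cscale_of_real)

lemma mexp_curve: "Z \<in> lie_algebra Gd \<Longrightarrow> curve_in Gd (\<lambda>t. mexp (t *\<^sub>R Z)) Z"
  using mexp_scaleR_has_vector_derivative[of Z 0] by (simp add: curve_in_def mexp_scaleR_mem)

end

section \<open>The adjoint action of the L-group\<close>

locale L_datum = alg_group Gd for Gd :: "(complex^'m^'m) set" +
  fixes v :: "'f::field_char_0 \<Rightarrow> real"
    and act :: "('f alg_closure \<Rightarrow> 'f alg_closure) \<Rightarrow> complex^'m^'m \<Rightarrow> complex^'m^'m"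
  assumes act_mem: "w \<in> carrier (weil v) \<Longrightarrow> g \<in> Gd \<Longrightarrow> act w g \<in> Gd"
    and act_mult: "w \<in> carrier (weil v) \<Longrightarrow> g \<in> Gd \<Longrightarrow> h \<in> Gd \<Longrightarrow> act w (g ** h) = act w g ** act w h"
    and act_regular: "w \<in> carrier (weil v) \<Longrightarrow> regular_map_on Gd (act w)"
    and act_id: "g \<in> Gd \<Longrightarrow> act id g = g"
    and act_comp: "w \<in> carrier (weil v) \<Longrightarrow> u \<in> carrier (weil v) \<Longrightarrow> g \<in> Gd \<Longrightarrow> act (w \<circ> u) g = act w (act u g)"
begin

abbreviation "W \<equiv> carrier (weil v)"
abbreviation "LG \<equiv> L_group v Gd act"
abbreviation "\<gg> \<equiv> lie_algebra Gd"

lemma L_carrier: "a \<in> carrier LG \<longleftrightarrow> fst a \<in> Gd \<and> snd a \<in> W"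
  by (cases a) (simp add: L_group_def)

lemma L_mult: "a \<otimes>\<^bsub>LG\<^esub> b = (fst a ** act (snd a) (fst b), snd a \<circ> snd b)"
  by (cases a; cases b) (simp add: L_group_def)

lemma act_one: assumes "w \<in> W" shows "act w (mat 1) = mat 1"
proof -
  let ?a = "act w (mat 1)"
  have "?a ** ?a = ?a" using act_mult[OF assms one_mem one_mem] by simp
  moreover have "invertible ?a" using act_mem[OF assms one_mem] invertible_mem by blast
  ultimately show ?thesis by (metis matrix_inv_mult(1) matrix_mul_assoc matrix_mul_lid)
qed

lemma act_inv: assumes "w \<in> W" "g \<in> Gd" shows "act w (matrix_inv g) = matrix_inv (act w g)"
proof -
  have "act w g ** act w (matrix_inv g) = mat 1"
    using act_mult[OF assms(1,2) inv_mem[OF assms(2)]] act_one[OF assms(1)]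
      matrix_inv_mult(2)[OF invertible_mem[OF assms(2)]] by simp
  then show ?thesis by (rule matrix_inv_eqI[symmetric])
qed

text \<open>The first component of the conjugate a (h, id) a^(-1) in the L-group, written without
  the inverse of \<open>a\<close>.\<close>

definition conjL :: "(complex^'m^'m) \<times> ('f alg_closure \<Rightarrow> 'f alg_closure) \<Rightarrow> complex^'m^'m \<Rightarrow> complex^'m^'m" where
  "conjL a h = fst a ** act (snd a) h ** matrix_inv (fst a)"

lemma conjL_mem: "a \<in> carrier LG \<Longrightarrow> h \<in> Gd \<Longrightarrow> conjL a h \<in> Gd"
  by (simp add: conjL_def L_carrier mult_mem inv_mem act_mem)

lemma conjL_hom:
  assumes a: "a \<in> carrier LG" and h: "h \<in> Gd" "k \<in> Gd"
  shows "conjL a (h ** k) = conjL a h ** conjL a k"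
proof -
  have i: "matrix_inv (fst a) ** fst a = mat 1" using a invertible_mem matrix_inv_mult(1)[of "fst a"] by (simp add: L_carrier)
  have "conjL a h ** conjL a k = fst a ** act (snd a) h ** (matrix_inv (fst a) ** fst a) ** act (snd a) k ** matrix_inv (fst a)"
    by (simp only: conjL_def matrix_mul_assoc)
  then show ?thesis using a h by (simp add: i conjL_def L_carrier act_mult matrix_mul_assoc)
qed

lemma conjL_one: "a \<in> carrier LG \<Longrightarrow> conjL a (mat 1) = mat 1"
  by (simp add: conjL_def L_carrier act_one matrix_inv_mult invertible_mem)

lemma conjL_mult:
  assumes a: "a \<in> carrier LG" and b: "b \<in> carrier LG" and h: "h \<in> Gd"
  shows "conjL (a \<otimes>\<^bsub>LG\<^esub> b) h = conjL a (conjL b h)"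
proof -
  note m = a b h L_carrier act_mem act_comp act_mult act_inv mult_mem inv_mem invertible_mem
  have "matrix_inv (fst a ** act (snd a) (fst b)) = matrix_inv (act (snd a) (fst b)) ** matrix_inv (fst a)"
    by (rule matrix_inv_mult_distrib) (use m in auto)
  then show ?thesis using m by (simp add: conjL_def L_mult matrix_mul_assoc)
qed

lemma L_Ad_eq: "L_Ad Gd act a Z = fst a ** differential Gd (act (snd a)) Z ** matrix_inv (fst a)"
  by (cases a) (simp add: L_Ad_def)

text \<open>\<open>L_Ad\<close> contains a definite description, so it is compared with one
  complex-linear map on velocities of curves. Exponential curves realise all of the Lie
  algebra.\<close>

lemma conjL_linearization:
  assumes a: "a \<in> carrier LG"
  shows "\<exists>L. clinear L \<and> (\<forall>\<gamma> Z. curve_in Gd \<gamma> Z \<longrightarrow>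
    L_Ad Gd act a Z = L Z \<and> ((\<lambda>t. conjL a (\<gamma> t)) has_vector_derivative L Z) (at 0))"
proof -
  have "snd a \<in> W" using a by (simp add: L_carrier)
  from regular_map_differential[OF act_regular[OF this]]
  obtain f' where f': "clinear f'" and f'2: "\<forall>\<gamma> Z. curve_in Gd \<gamma> Z \<longrightarrow>
      ((\<lambda>t. act (snd a) (\<gamma> t)) has_vector_derivative f' Z) (at 0) \<and> differential Gd (act (snd a)) Z = f' Z"
    by blast
  have "clinear (\<lambda>Z. fst a ** f' Z ** matrix_inv (fst a))"
    by (rule clinearI) (simp_all add: clinearD[OF f'] matrix_ring_simps cscale_mult_left cscale_mult_right)
  moreover have "L_Ad Gd act a Z = fst a ** f' Z ** matrix_inv (fst a) \<and>
      ((\<lambda>t. conjL a (\<gamma> t)) has_vector_derivative fst a ** f' Z ** matrix_inv (fst a)) (at 0)"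
    if "curve_in Gd \<gamma> Z" for \<gamma> Z
  proof -
    have c: "((\<lambda>t. act (snd a) (\<gamma> t)) has_vector_derivative f' Z) (at 0)" "differential Gd (act (snd a)) Z = f' Z"
      using f'2 that by blast+
    show ?thesis using has_vector_derivative_conj[OF c(1)] c(2) by (simp add: L_Ad_eq conjL_def)
  qed
  ultimately show ?thesis by blast
qed

text \<open>Ad may be computed along any curve with the right velocity, not only the exponential
  one.\<close>

lemma L_Ad_eqI:
  assumes a: "a \<in> carrier LG" and c: "curve_in Gd \<gamma> Z"
    and Y: "((\<lambda>t. conjL a (\<gamma> t)) has_vector_derivative Y) (at 0)"
  shows "L_Ad Gd act a Z = Y"
proof -
  obtain L where "L_Ad Gd act a Z = L Z" "((\<lambda>t. conjL a (\<gamma> t)) has_vector_derivative L Z) (at 0)"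
    using conjL_linearization[OF a] c by blast
  then show ?thesis using vector_derivative_unique_at[OF Y] by simp
qed

lemma L_Ad_clinear:
  assumes a: "a \<in> carrier LG"
  shows "\<exists>L. clinear L \<and> (\<forall>Z\<in>\<gg>. L_Ad Gd act a Z = L Z)"
  using conjL_linearization[OF a] mexp_curve by blast

lemma conjL_mexp_derivative:
  assumes a: "a \<in> carrier LG" and Z: "Z \<in> \<gg>"
  shows "((\<lambda>t. conjL a (mexp (t *\<^sub>R Z))) has_vector_derivative L_Ad Gd act a Z) (at 0)"
proof -
  obtain L where "L_Ad Gd act a Z = L Z" "((\<lambda>t. conjL a (mexp (t *\<^sub>R Z))) has_vector_derivative L Z) (at 0)"
    using conjL_linearization[OF a] mexp_curve[OF Z] by blast
  then show ?thesis by simp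
qed

text \<open>The conjugate of a one-parameter group is a one-parameter group, determined by its
  derivative at 0.\<close>

lemma conjL_mexp:
  assumes a: "a \<in> carrier LG" and Z: "Z \<in> \<gg>"
  shows "conjL a (mexp (t *\<^sub>R Z)) = mexp (t *\<^sub>R L_Ad Gd act a Z)"
proof (rule one_parameter_group[OF _ _ conjL_mexp_derivative[OF a Z]])
  show "conjL a (mexp ((s + t) *\<^sub>R Z)) = conjL a (mexp (s *\<^sub>R Z)) ** conjL a (mexp (t *\<^sub>R Z))" for s t
    by (simp only: mexp_add_scaleR conjL_hom[OF a mexp_scaleR_mem[OF Z] mexp_scaleR_mem[OF Z]])
qed (simp add: conjL_one[OF a])

lemma L_Ad_curve:
  assumes a: "a \<in> carrier LG" and Z: "Z \<in> \<gg>"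
  shows "curve_in Gd (\<lambda>t. conjL a (mexp (t *\<^sub>R Z))) (L_Ad Gd act a Z)"
  unfolding curve_in_def
  using conjL_mexp_derivative[OF a Z] conjL_mem[OF a mexp_scaleR_mem[OF Z]] conjL_one[OF a] by simp

lemma L_Ad_mem: "a \<in> carrier LG \<Longrightarrow> Z \<in> \<gg> \<Longrightarrow> L_Ad Gd act a Z \<in> \<gg>"
  by (rule lie_algebra_curve[OF L_Ad_curve])

text \<open>Conjugation by \<open>b\<close> turns exp(tZ) into the exponential curve of Ad(b)Z, and
  conjugation by \<open>a\<close> is then differentiated along that curve.\<close>

lemma L_Ad_mult:
  assumes a: "a \<in> carrier LG" and b: "b \<in> carrier LG" and ab: "a \<otimes>\<^bsub>LG\<^esub> b \<in> carrier LG" and Z: "Z \<in> \<gg>"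
  shows "L_Ad Gd act (a \<otimes>\<^bsub>LG\<^esub> b) Z = L_Ad Gd act a (L_Ad Gd act b Z)"
proof (rule L_Ad_eqI[OF ab mexp_curve[OF Z]])
  have "conjL (a \<otimes>\<^bsub>LG\<^esub> b) (mexp (t *\<^sub>R Z)) = conjL a (mexp (t *\<^sub>R L_Ad Gd act b Z))" for t
    by (simp add: conjL_mult[OF a b mexp_scaleR_mem[OF Z]] conjL_mexp[OF b Z])
  then show "((\<lambda>t. conjL (a \<otimes>\<^bsub>LG\<^esub> b) (mexp (t *\<^sub>R Z))) has_vector_derivative L_Ad Gd act a (L_Ad Gd act b Z)) (at 0)"
    using conjL_mexp_derivative[OF a L_Ad_mem[OF b Z]] by simp
qed

lemma L_Ad_inner:
  assumes a: "a \<in> carrier LG" and triv: "\<And>g. g \<in> Gd \<Longrightarrow> act (snd a) g = g" and Z: "Z \<in> \<gg>"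
  shows "L_Ad Gd act a Z = fst a ** Z ** matrix_inv (fst a)"
proof (rule L_Ad_eqI[OF a mexp_curve[OF Z]])
  have "((\<lambda>t. mexp (t *\<^sub>R Z)) has_vector_derivative Z) (at 0)"
    using mexp_curve[OF Z] by (simp add: curve_in_def)
  then show "((\<lambda>t. conjL a (mexp (t *\<^sub>R Z))) has_vector_derivative fst a ** Z ** matrix_inv (fst a)) (at 0)"
    unfolding conjL_def triv[OF mexp_scaleR_mem[OF Z]] by (rule has_vector_derivative_conj)
qed

end

section \<open>Representations of SL2\<close>

lemma mat2_nth [simp]: "mat2 a b c d $ 1 $ 1 = a" "mat2 a b c d $ 1 $ 2 = b"
  "mat2 a b c d $ 2 $ 1 = c" "mat2 a b c d $ 2 $ 2 = d"
  by (simp_all add: mat2_def)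

lemma mat2_eq_iff: "(A :: 'a^2^2) = B \<longleftrightarrow> A $ 1 $ 1 = B $ 1 $ 1 \<and> A $ 1 $ 2 = B $ 1 $ 2 \<and> A $ 2 $ 1 = B $ 2 $ 1 \<and> A $ 2 $ 2 = B $ 2 $ 2"
  by (simp add: vec_eq_iff forall_2)

lemma mat2_mult: "mat2 a b c d ** mat2 a' b' c' d' =
  mat2 (a * a' + b * c') (a * b' + b * d') (c * a' + d * c') (c * b' + d * (d'::'a::comm_ring_1))"
  by (simp add: mat2_eq_iff matrix_mult_nth sum_2)

lemma mat2_diff: "mat2 a b c d - mat2 a' b' c' d' = mat2 (a - a') (b - b') (c - c') (d - (d'::'a::comm_ring_1))"
  and mat2_cscale: "z *\<^sub>c mat2 p r s t = mat2 (z * p) (z * r) (z * s) (z * t)"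
  and mat2_one: "mat 1 = mat2 1 0 0 (1::'a::comm_ring_1)"
  by (simp_all add: mat2_eq_iff mat_nth)

lemma mat2_SL2: "mat2 a b c d \<in> SL2 \<longleftrightarrow> a * d - b * c = (1::'a::field)"
  by (simp add: SL2_def det_2)

lemma SL2_one: "mat 1 \<in> SL2" and SL2_mult: "A \<in> SL2 \<Longrightarrow> B \<in> SL2 \<Longrightarrow> A ** B \<in> SL2"
  by (simp_all add: SL2_def det_mul)

lemma mat2_has_vector_derivative:
  assumes "(a has_vector_derivative a') (at x)" "(b has_vector_derivative b') (at x)"
    "(c has_vector_derivative c') (at x)" "(d has_vector_derivative d') (at x)"
  shows "((\<lambda>x. mat2 (a x) (b x) (c x) (d x) :: complex^2^2) has_vector_derivative mat2 a' b' c' d') (at x)"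
proof (rule has_vector_derivative_matrixI)
  have "\<forall>i j. ((\<lambda>x. (mat2 (a x) (b x) (c x) (d x) :: complex^2^2) $ i $ j) has_vector_derivative (mat2 a' b' c' d' :: complex^2^2) $ i $ j) (at x)"
    using assms by (simp add: forall_2)
  then show "((\<lambda>x. (mat2 (a x) (b x) (c x) (d x) :: complex^2^2) $ i $ j) has_vector_derivative (mat2 a' b' c' d' :: complex^2^2) $ i $ j) (at x)" for i j
    by blast
qed

abbreviation sl_e :: "complex^2^2" where "sl_e \<equiv> mat2 0 1 0 0"
abbreviation sl_f :: "complex^2^2" where "sl_f \<equiv> mat2 0 0 1 0"
abbreviation sl_h :: "complex^2^2" where "sl_h \<equiv> mat2 1 0 0 (-1)"

definition dg :: "complex \<Rightarrow> complex^2^2" where "dg z = mat2 z 0 0 (inverse z)"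

lemma dg_SL2: "z \<noteq> 0 \<Longrightarrow> dg z \<in> SL2" and dg_mult: "dg z ** dg w = dg (z * w)" and dg_1: "dg 1 = mat 1"
  by (simp_all add: dg_def mat2_SL2 mat2_mult mat2_one inverse_mult_distrib mult.commute)

lemma dg_inverse: "z \<noteq> 0 \<Longrightarrow> dg z ** dg (inverse z) = mat 1"
  by (simp add: dg_mult dg_1)

definition uc :: "complex \<Rightarrow> complex^2^2" where "uc s = mat2 1 s 0 1"
definition lc :: "complex \<Rightarrow> complex^2^2" where "lc s = mat2 1 0 s 1"

lemma uc_SL2: "uc s \<in> SL2" and lc_SL2: "lc s \<in> SL2"
  and uc_add: "uc s ** uc t = uc (s + t)" and lc_add: "lc s ** lc t = lc (s + t)"
  and uc_0: "uc 0 = mat 1" and lc_0: "lc 0 = mat 1"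
  by (simp_all add: uc_def lc_def mat2_SL2 mat2_mult mat2_one add.commute)

lemma of_real_linear_derivative: "((\<lambda>s::real. of_real s * c) has_vector_derivative (c::complex)) (at t)"
  by (auto intro!: derivative_eq_intros)

lemma curve_uc: "curve_in SL2 (\<lambda>s. uc (of_real s * c)) (c *\<^sub>c sl_e)"
  and curve_lc: "curve_in SL2 (\<lambda>s. lc (of_real s * c)) (c *\<^sub>c sl_f)"
  unfolding curve_in_def uc_def lc_def mat2_cscale
  by (intro conjI allI; (intro mat2_has_vector_derivative of_real_linear_derivative)?;
      simp add: mat2_SL2 mat2_one of_real_linear_derivative)+

lemma curve_dg: "curve_in SL2 (\<lambda>s. dg (exp (of_real s))) sl_h"
proof -
  have "((exp :: complex \<Rightarrow> complex) has_field_derivative 1) (at (of_real 0))"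
    "((\<lambda>z::complex. exp (- z)) has_field_derivative - 1) (at (of_real 0))"
    by (auto intro!: derivative_eq_intros)
  from this[THEN has_vector_derivative_real_field]
  have "((\<lambda>s::real. exp (of_real s :: complex)) has_vector_derivative 1) (at 0)"
    "((\<lambda>s::real. exp (- of_real s :: complex)) has_vector_derivative - 1) (at 0)" .
  then show ?thesis
    unfolding curve_in_def dg_def exp_minus[symmetric]
    by (intro conjI allI mat2_has_vector_derivative) (simp_all add: mat2_SL2 mat2_one exp_minus_inverse)
qed

definition br :: "complex^'n^'n \<Rightarrow> complex^'n^'n \<Rightarrow> complex^'n^'n" where
  "br A B = A ** B - B ** A"

lemma br_jacobi: "br A (br B C) = br (br A B) C + br B (br A C)"
  by (simp add: br_def matrix_ring_simps)

lemma br_anti: "br A B = - br B A" and br_add_right: "br A (B + C) = br A B + br A C"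
  and br_cscale_right: "br A (c *\<^sub>c B) = c *\<^sub>c br A B" and br_cscale_left: "br (c *\<^sub>c A) B = c *\<^sub>c br A B"
  by (simp_all add: br_def matrix_ring_simps cscale_mult_left cscale_mult_right cscale_diff_right)

section \<open>Differential and weights of a representation of SL2\<close>

locale SL2_rep =
  fixes \<rho> :: "complex^2^2 \<Rightarrow> complex^'m^'m"
  assumes rho_one: "\<rho> (mat 1) = mat 1"
    and rho_mult: "A \<in> SL2 \<Longrightarrow> B \<in> SL2 \<Longrightarrow> \<rho> (A ** B) = \<rho> A ** \<rho> B"
    and rho_regular: "regular_map_on SL2 \<rho>"
begin

text \<open>Linear on all 2 by 2 matrices, but specified only through velocities of curves in
  \<open>SL2\<close>.\<close>

definition drho :: "complex^2^2 \<Rightarrow> complex^'m^'m" where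
  "drho = (SOME f'. clinear f' \<and> (\<forall>\<gamma> Z. curve_in SL2 \<gamma> Z \<longrightarrow>
    ((\<lambda>t. \<rho> (\<gamma> t)) has_vector_derivative f' Z) (at 0) \<and> differential SL2 \<rho> Z = f' Z))"

lemma drho: "clinear drho" "curve_in SL2 \<gamma> Z \<Longrightarrow> ((\<lambda>t. \<rho> (\<gamma> t)) has_vector_derivative drho Z) (at 0)"
  "curve_in SL2 \<gamma> Z \<Longrightarrow> differential SL2 \<rho> Z = drho Z"
  using someI_ex[OF regular_map_differential[OF rho_regular]] unfolding drho_def[symmetric] by blast+

lemma rho_inverse: "A \<in> SL2 \<Longrightarrow> B \<in> SL2 \<Longrightarrow> A ** B = mat 1 \<Longrightarrow> \<rho> A ** \<rho> B = mat 1"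
  using rho_mult[of A B] rho_one by simp

lemma drho_Ad:
  assumes \<gamma>: "curve_in SL2 \<gamma> Z" and g: "g \<in> SL2" "g' \<in> SL2" "g ** g' = mat 1"
  shows "\<rho> g ** drho Z ** \<rho> g' = drho (g ** Z ** g')"
proof -
  have "curve_in SL2 (\<lambda>t. g ** \<gamma> t ** g') (g ** Z ** g')"
    using \<gamma> g has_vector_derivative_conj unfolding curve_in_def by (auto simp: SL2_mult)
  then have d: "((\<lambda>t. \<rho> (g ** \<gamma> t ** g')) has_vector_derivative drho (g ** Z ** g')) (at 0)" by (rule drho(2))
  have "\<rho> (g ** \<gamma> t ** g') = \<rho> g ** \<rho> (\<gamma> t) ** \<rho> g'" for t
    using \<gamma> g by (simp add: curve_in_def rho_mult SL2_mult)
  then have "((\<lambda>t. \<rho> g ** \<rho> (\<gamma> t) ** \<rho> g') has_vector_derivative drho (g ** Z ** g')) (at 0)"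
    using d by simp
  from vector_derivative_unique_at[OF has_vector_derivative_conj[OF drho(2)[OF \<gamma>]] this] show ?thesis .
qed

text \<open>Differentiates the equivariance \<open>drho_Ad\<close> along \<open>\<delta>\<close>.
  The inverse curve \<open>\<delta>'\<close> is supplied with its velocity, so that matrix inversion
  need not be differentiated.\<close>

lemma drho_br:
  assumes \<gamma>: "curve_in SL2 \<gamma> Z" and \<delta>: "curve_in SL2 \<delta> A" "curve_in SL2 \<delta>' (- A)" "\<And>s. \<delta> s ** \<delta>' s = mat 1"
  shows "br (drho A) (drho Z) = drho (br A Z)"
proof -
  have m: "\<delta> s \<in> SL2" "\<delta>' s \<in> SL2" "\<delta> 0 = mat 1" "\<delta>' 0 = mat 1" for s using \<delta> by (simp_all add: curve_in_def)
  have eq: "\<rho> (\<delta> s) ** drho Z ** \<rho> (\<delta>' s) = drho (\<delta> s ** Z ** \<delta>' s)" for s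
    by (rule drho_Ad[OF \<gamma> m(1,2) \<delta>(3)])
  have d: "(\<delta> has_vector_derivative A) (at 0)" "(\<delta>' has_vector_derivative - A) (at 0)"
    using \<delta> by (simp_all add: curve_in_def)
  have "((\<lambda>s. \<delta> s ** Z ** \<delta>' s) has_vector_derivative Z ** (- A) + A ** Z) (at 0)"
    using has_vector_derivative_matrix_mult[OF bounded_linear.has_vector_derivative[OF bounded_linear_matrix_right d(1)] d(2)]
    by (simp add: m)
  from bounded_linear.has_vector_derivative[OF clinearD(7)[OF drho(1)] this]
  have 1: "((\<lambda>s. \<rho> (\<delta> s) ** drho Z ** \<rho> (\<delta>' s)) has_vector_derivative drho (Z ** (- A) + A ** Z)) (at 0)"
    by (simp add: eq)
  have "((\<lambda>s. \<rho> (\<delta> s) ** drho Z ** \<rho> (\<delta>' s)) has_vector_derivative drho Z ** drho (- A) + drho A ** drho Z) (at 0)"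
    using has_vector_derivative_matrix_mult[OF bounded_linear.has_vector_derivative[OF bounded_linear_matrix_right drho(2)[OF \<delta>(1)]] drho(2)[OF \<delta>(2)]]
    by (simp add: m rho_one)
  from vector_derivative_unique_at[OF this 1] show ?thesis
    by (simp add: br_def clinearD[OF drho(1)] matrix_ring_simps)
qed

abbreviation "E \<equiv> drho sl_e"
abbreviation "F \<equiv> drho sl_f"
abbreviation "H \<equiv> drho sl_h"

lemma br_EF: "br E F = H"
proof -
  have "br E F = drho (br sl_e sl_f)"
    by (rule drho_br[where \<gamma> = "\<lambda>s. lc (of_real s * 1)" and \<delta> = "\<lambda>s. uc (of_real s * 1)" and \<delta>' = "\<lambda>s. uc (of_real s * (-1))"])
       (use curve_lc[of 1] curve_uc[of 1] curve_uc[of "-1"] in \<open>simp_all add: uc_add uc_0 cscale_minus_1\<close>)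
  also have "br sl_e sl_f = sl_h" by (simp add: br_def mat2_mult mat2_diff)
  finally show ?thesis .
qed

text \<open>Only positive real r are tested: the square roots of the norm are such numbers, and r =
  exp(s) suffices to recover the action of \<open>H\<close>.\<close>

definition wt :: "int \<Rightarrow> complex^'m^'m \<Rightarrow> bool" where
  "wt n Y \<longleftrightarrow> (\<forall>r::real. r > 0 \<longrightarrow> \<rho> (dg r) ** Y ** \<rho> (dg (inverse r)) = (of_real r powi n) *\<^sub>c Y)"

lemma rho_dg_inverse:
  "z \<noteq> 0 \<Longrightarrow> \<rho> (dg z) ** \<rho> (dg (inverse z)) = mat 1" "z \<noteq> 0 \<Longrightarrow> \<rho> (dg (inverse z)) ** \<rho> (dg z) = mat 1"
  using rho_inverse[of "dg z" "dg (inverse z)"] rho_inverse[of "dg (inverse z)" "dg z"] dg_SL2[of z]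
    dg_SL2[of "inverse z"] dg_inverse[of z] dg_inverse[of "inverse z"] by simp_all

lemma wt_E: "wt 2 E" and wt_F: "wt (-2) F"
proof -
  have *: "\<rho> (dg r) ** drho Z ** \<rho> (dg (inverse r)) = drho (dg r ** Z ** dg (inverse r))"
    if "r \<noteq> 0" "curve_in SL2 \<gamma> Z" for r \<gamma> Z
    using that by (intro drho_Ad dg_SL2 dg_inverse) auto
  have e: "dg z ** sl_e ** dg (inverse z) = (z powi 2) *\<^sub>c sl_e"
    "dg z ** sl_f ** dg (inverse z) = (z powi (-2)) *\<^sub>c sl_f" if "z \<noteq> 0" for z
    using that by (simp_all add: dg_def mat2_mult mat2_cscale power2_eq_square power_int_minus)
  show "wt 2 E" "wt (-2) F" unfolding wt_def
    using *[OF _ curve_uc[of 1]] *[OF _ curve_lc[of 1]] by (auto simp: e clinearD[OF drho(1)])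
qed

lemma wt_mult: assumes "wt a Y" "wt b Z" shows "wt (a + b) (Y ** Z)"
  unfolding wt_def
proof (intro allI impI)
  fix r :: real assume r: "r > 0"
  let ?d = "\<rho> (dg r)" and ?d' = "\<rho> (dg (inverse r))"
  have "?d ** (Y ** Z) ** ?d' = ?d ** Y ** (?d' ** ?d) ** Z ** ?d'"
    using rho_dg_inverse(2)[of "of_real r"] r by (simp add: matrix_mul_assoc)
  also have "\<dots> = (?d ** Y ** ?d') ** (?d ** Z ** ?d')" by (simp only: matrix_mul_assoc)
  also have "\<dots> = (of_real r powi (a + b)) *\<^sub>c (Y ** Z)"
    using assms r by (simp add: wt_def cscale_mult_left cscale_mult_right power_int_add mult.commute)
  finally show "?d ** (Y ** Z) ** ?d' = (of_real r powi (a + b)) *\<^sub>c (Y ** Z)" .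
qed

lemma wt_br: assumes "wt a Y" "wt b Z" shows "wt (a + b) (br Y Z)"
  using wt_mult[OF assms] wt_mult[OF assms(2,1)] unfolding wt_def br_def
  by (simp add: matrix_diff_ldistrib matrix_diff_rdistrib cscale_diff_right add.commute)

text \<open>The derivative at s = 0 of the weight relation for r = exp(s).\<close>

lemma wt_H: assumes "wt n Y" shows "br H Y = of_int n *\<^sub>c Y"
proof -
  have inv: "curve_in SL2 (\<lambda>s. dg (inverse (exp (of_real s)))) (- sl_h)"
  proof -
    have "((\<lambda>s::real. - s) has_vector_derivative - 1) (at 0)" by (auto intro!: derivative_eq_intros)
    from vector_diff_chain_at[OF this, of "\<lambda>s. dg (exp (of_real s))" sl_h]
    have "((\<lambda>s::real. dg (exp (- of_real s))) has_vector_derivative - sl_h) (at 0)"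
      using curve_dg by (simp add: curve_in_def o_def)
    then show ?thesis using curve_dg by (auto simp: curve_in_def exp_minus[symmetric] dg_SL2 dg_1)
  qed
  have w: "\<rho> (dg (exp (of_real s))) ** Y ** \<rho> (dg (inverse (exp (of_real s)))) = of_real (exp (of_int n * s)) *\<^sub>c Y" for s :: real
  proof -
    have e: "(of_real (exp s) :: complex) powi n = of_real (exp (of_int n * s))"
      by (simp add: exp_power_int flip: of_real_power_int)
    show ?thesis
      using assms[unfolded wt_def, rule_format, OF exp_gt_zero, of s] by (simp only: e exp_of_real of_real_inverse)
  qed
  have 1: "((\<lambda>s. \<rho> (dg (exp (of_real s))) ** Y ** \<rho> (dg (inverse (exp (of_real s))))) has_vector_derivative
      Y ** drho (- sl_h) + H ** Y) (at (0::real))"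
    using has_vector_derivative_matrix_mult[OF bounded_linear.has_vector_derivative[OF bounded_linear_matrix_right drho(2)[OF curve_dg]] drho(2)[OF inv]]
    by (simp add: dg_1 rho_one)
  have "((\<lambda>s. exp (of_int n * s)) has_vector_derivative of_int n) (at (0::real))"
    by (auto intro!: derivative_eq_intros simp: has_real_derivative_iff_has_vector_derivative[symmetric])
  then have "((\<lambda>s. exp (of_int n * s) *\<^sub>R Y) has_vector_derivative of_int n *\<^sub>R Y) (at (0::real))"
    by (rule bounded_linear.has_vector_derivative[OF bounded_linear_scaleR_left])
  then have "((\<lambda>s. \<rho> (dg (exp (of_real s))) ** Y ** \<rho> (dg (inverse (exp (of_real s))))) has_vector_derivative of_int n *\<^sub>R Y) (at (0::real))"
    by (simp add: w cscale_of_real)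
  from vector_derivative_unique_at[OF 1 this] have "H ** Y - Y ** H = of_int n *\<^sub>R Y"
    by (simp add: clinearD[OF drho(1)] matrix_minus_right)
  then show ?thesis by (simp add: br_def cscale_of_real[symmetric])
qed

text \<open>If \<open>br E (br F Y) = 0\<close> for \<open>Y\<close> of weight 2, then \<open>F\<close> takes \<open>E\<^sup>k\<^sup>+\<^sup>1 Y\<close> to a nonzero multiple of
  \<open>E\<^sup>k Y\<close>, so nonzero \<open>Y\<close> would give arbitrarily large eigenvalues of \<open>br H\<close>.\<close>

lemma EF_injective_wt2:
  assumes Y: "br H Y = 2 *\<^sub>c Y" and EF: "br E (br F Y) = 0"
  shows "Y = 0"
proof (rule ccontr)
  assume "Y \<noteq> 0"
  define y where "y k = ((br E) ^^ k) Y" for k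
  have y_Suc: "y (Suc k) = br E (y k)" for k by (simp add: y_def)
  have HE: "br H E = 2 *\<^sub>c E" using wt_H[OF wt_E] by simp
  have yH: "br H (y k) = of_nat (2 + 2 * k) *\<^sub>c y k" for k
  proof (induction k)
    case (Suc k)
    have "br H (y (Suc k)) = br (br H E) (y k) + br E (br H (y k))" by (simp only: y_Suc br_jacobi[of H E])
    also have "\<dots> = 2 *\<^sub>c y (Suc k) + of_nat (2 + 2 * k) *\<^sub>c y (Suc k)"
      by (simp only: HE Suc br_cscale_left br_cscale_right y_Suc)
    finally show ?case by (simp add: cscale_add_left[symmetric] algebra_simps)
  qed (use Y in \<open>simp add: y_def\<close>)
  have FE: "br F (br E Z) = br E (br F Z) - br H Z" for Z
    using br_jacobi[of E F Z] br_EF by simp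
  \<comment> \<open>By \<open>FE\<close> each step adds the weight 2 + 2k, and 2 + 4 + ... + (2 +
    2k) = (k+1)(k+2).\<close>
  have yF: "br F (y (Suc k)) = - (of_nat ((k + 1) * (k + 2)) *\<^sub>c y k)" for k
  proof (induction k)
    case 0
    show ?case using EF Y by (simp add: y_def FE)
  next
    case (Suc k)
    have "br F (y (Suc (Suc k))) = br E (br F (y (Suc k))) - br H (y (Suc k))"
      by (simp only: y_Suc[of "Suc k"] FE)
    also have "\<dots> = (- of_nat ((k + 1) * (k + 2))) *\<^sub>c y (Suc k) - of_nat (2 + 2 * Suc k) *\<^sub>c y (Suc k)"
      by (simp only: Suc yH) (simp add: y_Suc br_cscale_right cscale_minus_1[symmetric] del: of_nat_mult)
    also have "\<dots> = - (of_nat ((Suc k + 1) * (Suc k + 2)) *\<^sub>c y (Suc k))"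
      by (simp add: vec_eq_iff algebra_simps)
    finally show ?case .
  qed
  have nz: "y k \<noteq> 0" for k
  proof (induction k)
    case (Suc k)
    show ?case
    proof
      assume "y (Suc k) = 0"
      then have "of_nat ((k + 1) * (k + 2)) *\<^sub>c y k = 0" using yF[of k] by (simp add: br_def)
      then have "of_nat ((k + 1) * (k + 2)) = (0::complex)" using Suc unfolding cscale_eq_0_iff by blast
      then have "(k + 1) * (k + 2) = 0" by (rule of_nat_eq_0_iff[THEN iffD1])
      then show False by simp
    qed
  qed (use \<open>Y \<noteq> 0\<close> in \<open>simp add: y_def\<close>)
  have "bounded_linear (br H)"
    unfolding br_def by (intro bounded_linear_sub bounded_linear_matrix_left bounded_linear_matrix_right)
  then obtain K where K: "\<And>Z. norm (br H Z) \<le> norm Z * K" using bounded_linear.bounded by blast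
  obtain k where k: "real k > K" using reals_Archimedean2 by blast
  have "real (2 + 2 * k) * norm (y k) = norm (br H (y k))"
    using cscale_of_real[of "real (2 + 2 * k)" "y k"] by (simp add: yH)
  then have "real (2 + 2 * k) * norm (y k) \<le> K * norm (y k)" using K[of "y k"] by (simp add: mult.commute)
  then have "real (2 + 2 * k) \<le> K" using nz[of k] by simp
  then show False using k by simp
qed

end

subsection \<open>Laurent polynomials on the torus\<close>

text \<open>One factor \<open>z ^ J\<close> clears the negative powers, so that facts about
  \<open>poly\<close> apply. Nothing is required at z = 0, where the inverse has a default
  value.\<close>

definition laurent :: "(complex \<Rightarrow> complex) \<Rightarrow> bool" where
  "laurent f \<longleftrightarrow> (\<exists>J P. \<forall>z. z \<noteq> 0 \<longrightarrow> f z * z ^ J = poly P z)"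

lemma laurentI: "(\<And>z. z \<noteq> 0 \<Longrightarrow> f z * z ^ J = poly P z) \<Longrightarrow> laurent f"
  unfolding laurent_def by blast

lemma laurent_cong: "laurent f \<Longrightarrow> (\<And>z. z \<noteq> 0 \<Longrightarrow> g z = f z) \<Longrightarrow> laurent g"
  unfolding laurent_def by simp

lemma laurent_const: "laurent (\<lambda>_. c)"
  by (rule laurentI[of _ 0 "[:c:]"]) simp

lemma laurent_add: assumes "laurent f" "laurent g" shows "laurent (\<lambda>z. f z + g z)"
proof -
  obtain J P where f: "\<And>z. z \<noteq> 0 \<Longrightarrow> f z * z ^ J = poly P z" using assms(1) unfolding laurent_def by blast
  obtain K Q where g: "\<And>z. z \<noteq> 0 \<Longrightarrow> g z * z ^ K = poly Q z" using assms(2) unfolding laurent_def by blast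
  show ?thesis
  proof (rule laurentI)
    fix z :: complex assume z: "z \<noteq> 0"
    have "(f z + g z) * z ^ (J + K) = (f z * z ^ J) * z ^ K + (g z * z ^ K) * z ^ J"
      by (simp add: algebra_simps power_add)
    also have "\<dots> = poly (P * Polynomial.monom 1 K + Q * Polynomial.monom 1 J) z"
      by (simp only: f[OF z] g[OF z]) (simp add: poly_monom)
    finally show "(f z + g z) * z ^ (J + K) = poly (P * Polynomial.monom 1 K + Q * Polynomial.monom 1 J) z" .
  qed
qed

lemma laurent_mult: assumes "laurent f" "laurent g" shows "laurent (\<lambda>z. f z * g z)"
proof -
  obtain J P where f: "\<And>z. z \<noteq> 0 \<Longrightarrow> f z * z ^ J = poly P z" using assms(1) unfolding laurent_def by blast
  obtain K Q where g: "\<And>z. z \<noteq> 0 \<Longrightarrow> g z * z ^ K = poly Q z" using assms(2) unfolding laurent_def by blast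
  show ?thesis
  proof (rule laurentI)
    fix z :: complex assume z: "z \<noteq> 0"
    have "(f z * g z) * z ^ (J + K) = (f z * z ^ J) * (g z * z ^ K)" by (simp add: power_add mult_ac)
    then show "(f z * g z) * z ^ (J + K) = poly (P * Q) z" by (simp only: f[OF z] g[OF z] poly_mult)
  qed
qed

lemma laurent_sum: "(\<And>i. i \<in> A \<Longrightarrow> laurent (f i)) \<Longrightarrow> laurent (\<lambda>z. \<Sum>i\<in>A. f i z)"
  by (induction A rule: infinite_finite_induct) (simp_all add: laurent_const laurent_add)

text \<open>\<open>reflect_poly P\<close> evaluates to z^deg(P) P(1/z), while the old denominator
  \<open>z ^ J\<close> becomes a factor.\<close>

lemma laurent_inverse_arg: assumes "laurent f" shows "laurent (\<lambda>z. f (inverse z))"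
proof -
  obtain J P where f: "\<And>z. z \<noteq> 0 \<Longrightarrow> f z * z ^ J = poly P z" using assms unfolding laurent_def by blast
  show ?thesis
  proof (rule laurentI)
    fix z :: complex assume z: "z \<noteq> 0"
    have "f (inverse z) = poly P (inverse z) * z ^ J"
      using f[of "inverse z"] z by (simp add: field_simps)
    then show "f (inverse z) * z ^ Polynomial.degree P = poly (Polynomial.monom 1 J * reflect_poly P) z"
      using poly_reflect_poly_nz[OF z, of P] by (simp add: poly_monom mult_ac)
  qed
qed

lemma poly_bounded_const:
  fixes Q :: "complex poly" and r :: real
  assumes r: "r > 1" and C: "\<And>k. norm (poly Q (of_real r ^ k)) \<le> C"
  shows "poly Q z = poly Q w"
proof -
  have "Polynomial.degree Q = 0"
  proof (rule ccontr)
    assume "Polynomial.degree Q \<noteq> 0"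
    then have "filterlim (poly Q) at_infinity at_infinity" by (intro filterlim_poly_at_infinity) auto
    moreover have "filterlim (\<lambda>k. (of_real r :: complex) ^ k) at_infinity sequentially"
      using r by (intro filterlim_realpow_sequentially_gt1) simp
    ultimately have "filterlim (\<lambda>k. poly Q (of_real r ^ k)) at_infinity sequentially"
      by (rule filterlim_compose)
    then have "filterlim (\<lambda>k. norm (poly Q (of_real r ^ k))) at_top sequentially"
      by (rule filterlim_at_infinity_imp_norm_at_top)
    then have "\<forall>\<^sub>F k in sequentially. C < norm (poly Q (of_real r ^ k))"
      by (simp add: filterlim_at_top_dense)
    then obtain k where "C < norm (poly Q (of_real r ^ k))" unfolding eventually_sequentially by blast
    then show False using C[of k] by simp
  qed
  then obtain c where "Q = [:c:]" by (rule degree_eq_zeroE)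
  then show ?thesis by simp
qed

text \<open>Boundedness along r^k excludes positive powers, and boundedness along r^(-k) excludes
  negative ones. Two geometric sequences suffice because a nonconstant polynomial tends to infinity
  along them.\<close>

lemma laurent_bounded_const:
  fixes r :: real
  assumes f: "laurent f" and r: "r > 1"
    and C: "\<And>k. norm (f (of_real r ^ k)) \<le> C" "\<And>k. norm (f (inverse (of_real r ^ k))) \<le> C" and z: "z \<noteq> 0"
  shows "f z = f 1"
proof -
  obtain J P where P: "\<And>z. z \<noteq> 0 \<Longrightarrow> f z * z ^ J = poly P z" using f unfolding laurent_def by blast
  define n where "n = J + Polynomial.degree P + 1"
  \<comment> \<open>P is cut at degree J: \<open>A\<close> receives the powers of z with nonnegative
    exponent, \<open>B\<close> the negative ones as a polynomial in 1/z without constant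
    term.\<close>
  define A where "A = (\<Sum>i\<in>{J..<n}. Polynomial.monom (Polynomial.coeff P i) (i - J))"
  define B where "B = (\<Sum>i<J. Polynomial.monom (Polynomial.coeff P i) (J - i))"
  have f_eq: "f z = poly A z + poly B (inverse z)" if z: "z \<noteq> 0" for z
  proof -
    have "poly P z = (\<Sum>i<n. Polynomial.coeff P i * z ^ i)"
      unfolding poly_altdef by (rule sum.mono_neutral_left) (auto simp: n_def coeff_eq_0)
    also have "{..<n} = {..<J} \<union> {J..<n}" by (auto simp: n_def)
    also have "(\<Sum>i\<in>{..<J} \<union> {J..<n}. Polynomial.coeff P i * z ^ i) =
      (\<Sum>i<J. Polynomial.coeff P i * z ^ i) + (\<Sum>i\<in>{J..<n}. Polynomial.coeff P i * z ^ i)"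
      by (rule sum.union_disjoint) auto
    also have "(\<Sum>i\<in>{J..<n}. Polynomial.coeff P i * z ^ i) = poly A z * z ^ J"
      unfolding A_def poly_sum sum_distrib_right
      by (rule sum.cong) (auto simp: poly_monom power_add[symmetric] mult.assoc)
    also have "(\<Sum>i<J. Polynomial.coeff P i * z ^ i) = poly B (inverse z) * z ^ J"
      unfolding B_def poly_sum sum_distrib_right
    proof (rule sum.cong)
      fix i assume "i \<in> {..<J}"
      then have "z ^ J = z ^ (J - i) * z ^ i" by (simp add: power_add[symmetric])
      then show "Polynomial.coeff P i * z ^ i = poly (Polynomial.monom (Polynomial.coeff P i) (J - i)) (inverse z) * z ^ J"
        using z by (simp add: poly_monom power_inverse)
    qed simp
    finally have "f z * z ^ J = (poly A z + poly B (inverse z)) * z ^ J"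
      using P[OF z] by (simp add: algebra_simps)
    then show ?thesis using z by simp
  qed
  have rk: "of_real r ^ k \<noteq> (0::complex)" for k using r by simp
  define D where "D = (\<Sum>i<J. norm (Polynomial.coeff P i))"
  have B_bound: "norm (poly B (inverse (of_real r ^ k))) \<le> D" for k
  proof -
    have "norm (inverse (of_real r ^ k :: complex)) \<le> 1" using r by (simp add: norm_inverse norm_power inverse_le_1_iff)
    then have le: "norm (inverse (of_real r ^ k :: complex)) ^ i \<le> 1" for i by (intro power_le_one) auto
    have "norm (poly B (inverse (of_real r ^ k))) \<le>
        (\<Sum>i<J. norm (Polynomial.coeff P i * inverse (of_real r ^ k) ^ (J - i)))"
      unfolding B_def poly_sum poly_monom by (rule norm_sum)
    also have "\<dots> \<le> D" unfolding D_def
      by (intro sum_mono) (simp only: norm_mult norm_power, intro mult_left_le le norm_ge_zero)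
    finally show ?thesis .
  qed
  have "norm (poly A (of_real r ^ k)) \<le> C + D" for k
  proof -
    have "poly A (of_real r ^ k) = f (of_real r ^ k) - poly B (inverse (of_real r ^ k))"
      using f_eq[OF rk[of k]] by simp
    also have "norm \<dots> \<le> C + D"
      using C(1)[of k] B_bound[of k] norm_triangle_ineq4[of "f (of_real r ^ k)" "poly B (inverse (of_real r ^ k))"] by linarith
    finally show ?thesis .
  qed
  then have A: "poly A z = poly A 1" for z by (rule poly_bounded_const[OF r])
  \<comment> \<open>With \<open>A\<close> constant, f is a polynomial in 1/z, and the second
    sequence applies.\<close>
  define Q where "Q = B + [:poly A 1:]"
  have f_eq': "f z = poly Q (inverse z)" if "z \<noteq> 0" for z
    using f_eq[OF that] A[of z] by (simp add: Q_def)
  have "norm (poly Q (of_real r ^ k)) \<le> C" for k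
    using C(2)[of k] f_eq'[of "inverse (of_real r ^ k)"] rk[of k] by simp
  then have "poly Q (inverse z) = poly Q (inverse 1)" by (rule poly_bounded_const[OF r])
  then show ?thesis using f_eq'[OF z] f_eq'[of 1] by simp
qed

lemma laurent_mat_poly:
  assumes "p \<in> mat_polys UNIV"
  shows "laurent (\<lambda>z. p (dg z))"
  using assms unfolding mat_polys_def
proof induction
  case (const c)
  show ?case by (rule laurent_const)
next
  case (coord f)
  then obtain i j where f: "f = (\<lambda>A. A $ i $ j)" by blast
  have "laurent (\<lambda>z. z)" by (rule laurentI[of _ 0 "[:0, 1:]"]) simp
  moreover have "laurent inverse" by (rule laurentI[of _ 1 1]) simp
  ultimately have "\<forall>i j. laurent (\<lambda>z. dg z $ i $ j)"
    by (simp add: forall_2 dg_def laurent_const)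
  then show ?case by (simp add: f)
qed (rule laurent_add laurent_mult; assumption)+

section \<open>Comparison of matrix coefficients and the trace of a projection\<close>

lemma sum_matrix_mult_left: "(\<Sum>j\<in>A. f j) ** B = (\<Sum>j\<in>A. f j ** (B::complex^'n^'m))"
  by (rule bounded_bilinear.sum_left[OF bounded_bilinear_matrix_mult])

lemma sum_matrix_mult_right: "B ** (\<Sum>j\<in>A. f j) = (\<Sum>j\<in>A. (B::complex^'n^'m) ** f j)"
  by (rule bounded_bilinear.sum_right[OF bounded_bilinear_matrix_mult])

lemma sum_cscale_right: "c *\<^sub>c (\<Sum>j\<in>A. f j) = (\<Sum>j\<in>A. c *\<^sub>c f j)"
  by (induction A rule: infinite_finite_induct) (simp_all add: cscale_add_right)

lemma matrix_poly_coeffs_unique: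
  fixes C D :: "nat \<Rightarrow> complex^'n^'m"
  assumes eq: "\<And>z. z \<noteq> 0 \<Longrightarrow> (\<Sum>j\<le>n. z ^ j *\<^sub>c C j) = (\<Sum>j\<le>n. z ^ j *\<^sub>c D j)" and j: "j \<le> n"
  shows "C j = D j"
proof -
  have "C j $ a $ b = D j $ a $ b" for a b
  proof -
    define p where "p = (\<Sum>j\<le>n. Polynomial.monom (C j $ a $ b - D j $ a $ b) j)"
    have "poly p z = 0" if z: "z \<noteq> 0" for z
    proof -
      have "poly p z = (\<Sum>j\<le>n. z ^ j *\<^sub>c C j) $ a $ b - (\<Sum>j\<le>n. z ^ j *\<^sub>c D j) $ a $ b"
        by (simp add: p_def poly_sum poly_monom sum_subtractf algebra_simps)
      then show ?thesis using eq[OF z] by simp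
    qed
    then have "UNIV - {0} \<subseteq> {z. poly p z = 0}" by auto
    moreover have "infinite (UNIV - {0::complex})" by (simp add: infinite_UNIV_char_0)
    ultimately have "p = 0" using poly_roots_finite finite_subset by blast
    then have "Polynomial.coeff p j = 0" by simp
    then show ?thesis using j by (simp add: p_def coeff_sum)
  qed
  then show ?thesis by (simp add: vec_eq_iff)
qed

lemma trace_cscale: "trace (c *\<^sub>c A) = c * trace A"
  by (simp add: trace_def sum_distrib_left)

lemma trace_sum: "trace (\<Sum>i\<in>A. f i) = (\<Sum>i\<in>A. trace (f i :: complex^'n^'n))"
  unfolding trace_def sum_component by (rule sum.swap)

text \<open>The trace is the rank. Expanding the images of the standard vectors in a basis
  \<open>B\<close> of the range and exchanging sums leaves the b-coordinate of \<open>P *v b\<close>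
  for each b in \<open>B\<close>, which is 1 as P fixes its range.\<close>

lemma trace_idempotent:
  fixes P :: "complex^'n^'n"
  assumes P: "P ** P = P"
  shows "\<exists>n::nat. trace P = of_nat n \<and> (n = 0 \<longrightarrow> P = 0)"
proof -
  obtain B where B: "B \<subseteq> range ((*v) P)" "vec.independent B" "range ((*v) P) \<subseteq> vec.span B"
    by (rule vec.maximal_independent_subset)
  have fin: "finite B" using B(2) by (rule vec.finiteI_independent)
  define c where "c x b = vec.representation B (P *v x) b" for x b
  have mem: "P *v x \<in> vec.span B" for x using B(3) by blast
  have expand: "P *v x = (\<Sum>b\<in>B. c x b *s b)" for x
    unfolding c_def by (rule vec.sum_representation_eq[OF B(2) mem fin order_refl, symmetric])
  have c_sum: "c (\<Sum>i\<in>UNIV. k i *s f i) b = (\<Sum>i\<in>UNIV. k i * c (f i) b)" for k :: "'n \<Rightarrow> complex" and f b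
  proof -
    have "P *v (\<Sum>i\<in>UNIV. k i *s f i) = (\<Sum>i\<in>UNIV. k i *s (P *v f i))"
      by (simp only: vec.sum vec.scale)
    then show ?thesis
      unfolding c_def
      by (simp only: vec.representation_sum[OF B(2) vec.span_scale[OF mem]] vec.representation_scale[OF B(2) mem])
  qed
  have Pa: "(P *v axis j 1) $ i = P $ i $ j" for i j
  proof -
    have "(\<Sum>l\<in>UNIV. P $ i $ l * axis j 1 $ l) = (\<Sum>l\<in>UNIV. if l = j then P $ i $ l else 0)"
      by (rule sum.cong) (auto simp: axis_def)
    then show ?thesis by (simp add: matrix_vector_mult_def)
  qed
  have cb: "c b b = 1" if b: "b \<in> B" for b
  proof -
    obtain y where "b = P *v y" using B(1) b by blast
    then have "P *v b = b" using P by (simp add: matrix_vector_mul_assoc)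
    then show ?thesis using vec.representation_basis[OF B(2) b] by (simp add: c_def)
  qed
  have "trace P = (\<Sum>i\<in>UNIV. (P *v axis i 1) $ i)"
    by (simp only: trace_def Pa)
  also have "\<dots> = (\<Sum>i\<in>UNIV. \<Sum>b\<in>B. b $ i * c (axis i 1) b)"
    by (simp add: expand mult.commute)
  also have "\<dots> = (\<Sum>b\<in>B. \<Sum>i\<in>UNIV. b $ i * c (axis i 1) b)" by (rule sum.swap)
  also have "\<dots> = (\<Sum>b\<in>B. c b b)"
  proof (rule sum.cong)
    fix b :: "complex^'n"
    have "b = (\<Sum>i\<in>UNIV. b $ i *s axis i 1)" by (rule basis_expansion[symmetric])
    then show "(\<Sum>i\<in>UNIV. b $ i * c (axis i 1) b) = c b b" using c_sum[of "\<lambda>i. b $ i" "\<lambda>i. axis i 1" b] by simp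
  qed simp
  also have "\<dots> = of_nat (card B)" using cb by simp
  finally have t: "trace P = of_nat (card B)" .
  have "P = 0" if "card B = 0"
  proof -
    have "B = {}" using that fin by simp
    then have "P *v x = 0" for x using mem[of x] by simp
    then show ?thesis by (simp add: vec_eq_iff Pa[symmetric])
  qed
  then show ?thesis by (intro exI[where x = "card B"] conjI t impI)
qed

context SL2_rep
begin

lemma laurent_rho: "laurent (\<lambda>z. \<rho> (dg z) $ i $ j)"
proof -
  obtain p k where p: "p \<in> mat_polys UNIV" "\<And>g. g \<in> SL2 \<Longrightarrow> \<rho> g $ i $ j = p g / det g ^ k"
  proof -
    have "regular_on SL2 (\<lambda>g. \<rho> g $ i $ j)" using rho_regular by (simp add: regular_map_on_def)
    then have "\<exists>p\<in>mat_polys UNIV. \<exists>k. \<forall>g\<in>SL2. \<rho> g $ i $ j = p g / det g ^ k"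
      by (simp add: regular_on_def)
    then obtain p k where pk: "p \<in> mat_polys UNIV" "\<forall>g\<in>SL2. \<rho> g $ i $ j = p g / det g ^ k"
      by (elim bexE exE)
    show ?thesis by (rule that[OF pk(1) pk(2)[rule_format]])
  qed
  have "\<rho> (dg z) $ i $ j = p (dg z)" if "z \<noteq> 0" for z
    using p(2)[OF dg_SL2[OF that]] dg_SL2[OF that] by (simp add: SL2_def)
  then show ?thesis by (rule laurent_cong[OF laurent_mat_poly[OF p(1)]])
qed

text \<open>The entries of z^(-2) rho(z) Y rho(z)^(-1) are Laurent polynomials in the torus variable
  z. Bounded along r^k and r^(-k), they are constant and equal to their value at z = 1, which is
  \<open>Y\<close>.\<close>

lemma wt2I:
  fixes r C :: real
  assumes r: "r > 1"
    and C: "\<And>k. norm (inverse ((of_real r ^ k)\<^sup>2) *\<^sub>c (\<rho> (dg (of_real r ^ k)) ** Y ** \<rho> (dg (inverse (of_real r ^ k))))) \<le> C"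
      "\<And>k. norm ((of_real r ^ k)\<^sup>2 *\<^sub>c (\<rho> (dg (inverse (of_real r ^ k))) ** Y ** \<rho> (dg (of_real r ^ k)))) \<le> C"
  shows "wt 2 Y"
proof -
  define f where "f z = inverse (z\<^sup>2) *\<^sub>c (\<rho> (dg z) ** Y ** \<rho> (dg (inverse z)))" for z
  have "f z $ i $ j = f 1 $ i $ j" if z: "z \<noteq> 0" for z i j
  proof (rule laurent_bounded_const[OF _ r _ _ z, where f = "\<lambda>z. f z $ i $ j"])
    have "laurent (\<lambda>z. inverse (z\<^sup>2))" by (rule laurentI[of _ 2 1]) simp
    moreover have "laurent (\<lambda>z. (\<rho> (dg z) ** Y ** \<rho> (dg (inverse z))) $ i $ j)"
      unfolding matrix_mult_nth
      by (rule laurent_sum, rule laurent_mult, rule laurent_sum, rule laurent_mult, rule laurent_rho,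
          rule laurent_const, rule laurent_inverse_arg[OF laurent_rho])
    ultimately show "laurent (\<lambda>z. f z $ i $ j)"
      unfolding f_def cscale_nth by (rule laurent_mult)
    show "norm (f (of_real r ^ k) $ i $ j) \<le> C" for k
      using order_trans[OF norm_nth_nth_le C(1)] unfolding f_def .
    have "norm (f (inverse (of_real r ^ k))) \<le> C" for k
      using C(2)[of k] unfolding f_def by (simp add: power_inverse)
    then show "norm (f (inverse (of_real r ^ k)) $ i $ j) \<le> C" for k
      using order_trans[OF norm_nth_nth_le] by blast
  qed
  then have f1: "f z = Y" if "z \<noteq> 0" for z
    using that by (simp add: vec_eq_iff f_def dg_1 rho_one)
  have "\<rho> (dg z) ** Y ** \<rho> (dg (inverse z)) = z\<^sup>2 *\<^sub>c Y" if z: "z \<noteq> 0" for z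
  proof -
    have "z\<^sup>2 *\<^sub>c f z = \<rho> (dg z) ** Y ** \<rho> (dg (inverse z))" using z by (simp add: f_def)
    then show ?thesis using f1[OF z] by simp
  qed
  then show ?thesis unfolding wt_def by simp
qed

text \<open>A common denominator \<open>z ^ K\<close> for all entries. The coefficient
  \<open>B j\<close> will turn out to be the projection to weight j - K.\<close>

lemma rho_dg_coeffs:
  "\<exists>K n B. \<forall>z. z \<noteq> 0 \<longrightarrow> z ^ K *\<^sub>c \<rho> (dg z) = (\<Sum>j\<le>n. z ^ j *\<^sub>c B j)"
proof -
  have "\<forall>i j. \<exists>J P. \<forall>z. z \<noteq> 0 \<longrightarrow> \<rho> (dg z) $ i $ j * z ^ J = poly P z"
    using laurent_rho[unfolded laurent_def] by (intro allI)
  then obtain J P where "\<forall>i j z. z \<noteq> 0 \<longrightarrow> \<rho> (dg z) $ i $ j * z ^ J i j = poly (P i j) z"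
    unfolding choice_iff by (elim exE)
  then have P: "\<And>i j z. z \<noteq> 0 \<Longrightarrow> \<rho> (dg z) $ i $ j * z ^ J i j = poly (P i j) z" by simp
  define K where "K = (\<Sum>i\<in>UNIV. \<Sum>j\<in>UNIV. J i j)"
  have K: "J i j \<le> K" for i j
  proof -
    have "J i j \<le> (\<Sum>j\<in>UNIV. J i j)" by (rule member_le_sum) auto
    also have "\<dots> \<le> K" unfolding K_def by (rule member_le_sum) auto
    finally show ?thesis .
  qed
  define Q where "Q i j = P i j * Polynomial.monom 1 (K - J i j)" for i j
  have Q: "z ^ K * \<rho> (dg z) $ i $ j = poly (Q i j) z" if z: "z \<noteq> 0" for z i j
  proof -
    have "z ^ K = z ^ J i j * z ^ (K - J i j)" using K[of i j] by (simp add: power_add[symmetric])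
    then show ?thesis using P[OF z, of i j] by (simp add: Q_def poly_monom mult_ac)
  qed
  define n where "n = (\<Sum>i\<in>UNIV. \<Sum>j\<in>UNIV. Polynomial.degree (Q i j))"
  have n: "Polynomial.degree (Q i j) \<le> n" for i j
  proof -
    have "Polynomial.degree (Q i j) \<le> (\<Sum>j\<in>UNIV. Polynomial.degree (Q i j))" by (rule member_le_sum) auto
    also have "\<dots> \<le> n" unfolding n_def by (rule member_le_sum) auto
    finally show ?thesis .
  qed
  have "z ^ K *\<^sub>c \<rho> (dg z) = (\<Sum>k\<le>n. z ^ k *\<^sub>c (\<chi> i j. Polynomial.coeff (Q i j) k))" if z: "z \<noteq> 0" for z
  proof -
    have "poly (Q i j) z = (\<Sum>k\<le>n. Polynomial.coeff (Q i j) k * z ^ k)" for i j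
      unfolding poly_altdef using n[of i j] by (intro sum.mono_neutral_left) (auto simp: coeff_eq_0)
    then show ?thesis using Q[OF z] by (simp add: vec_eq_iff mult.commute)
  qed
  then show ?thesis
    by (intro exI[where x = K] exI[where x = n] exI[where x = "\<lambda>k. \<chi> i j. Polynomial.coeff (Q i j) k"]) simp
qed

text \<open>The weight projections \<open>B j\<close> of the torus are idempotents and \<open>H\<close> is their combination with
  integer coefficients, so the trace of \<open>H\<^sup>2\<close> is a sum of squares.\<close>

lemma torus_trivial:
  assumes tr: "trace (H ** H) = 0" and z: "z \<noteq> 0"
  shows "\<rho> (dg z) = mat 1"
proof -
  obtain K n B where B': "\<forall>z. z \<noteq> 0 \<longrightarrow> z ^ K *\<^sub>c \<rho> (dg z) = (\<Sum>j\<le>n. z ^ j *\<^sub>c B j)"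
    using rho_dg_coeffs by (elim exE)
  then have B: "\<And>z. z \<noteq> 0 \<Longrightarrow> z ^ K *\<^sub>c \<rho> (dg z) = (\<Sum>j\<le>n. z ^ j *\<^sub>c B j)" by simp
  \<comment> \<open>Compare the coefficients of z in rho(z) rho(w) = rho(zw), with w fixed.\<close>
  have B_rho: "B j ** (w ^ K *\<^sub>c \<rho> (dg w)) = w ^ j *\<^sub>c B j" if w: "w \<noteq> 0" and j: "j \<le> n" for w j
  proof (rule matrix_poly_coeffs_unique[OF _ j, where C = "\<lambda>j. B j ** (w ^ K *\<^sub>c \<rho> (dg w))"])
    fix z :: complex assume z: "z \<noteq> 0"
    have "(\<Sum>j\<le>n. z ^ j *\<^sub>c (B j ** (w ^ K *\<^sub>c \<rho> (dg w)))) = (z ^ K *\<^sub>c \<rho> (dg z)) ** (w ^ K *\<^sub>c \<rho> (dg w))"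
      by (simp only: B[OF z] sum_matrix_mult_left cscale_mult_left)
    also have "\<dots> = (z * w) ^ K *\<^sub>c \<rho> (dg (z * w))"
      using rho_mult[OF dg_SL2[OF z] dg_SL2[OF w]]
      by (simp add: dg_mult cscale_mult_left cscale_mult_right power_mult_distrib mult.commute)
    also have "\<dots> = (\<Sum>j\<le>n. z ^ j *\<^sub>c (w ^ j *\<^sub>c B j))"
      using B[of "z * w"] z w by (simp add: power_mult_distrib)
    finally show "(\<Sum>j\<le>n. z ^ j *\<^sub>c (B j ** (w ^ K *\<^sub>c \<rho> (dg w)))) = (\<Sum>j\<le>n. z ^ j *\<^sub>c (w ^ j *\<^sub>c B j))" .
  qed
  \<comment> \<open>Expanding the relation \<open>B_rho\<close> in its own variable and comparing
    coefficients again makes the \<open>B j\<close> orthogonal idempotents; the diagonal case is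
    kept.\<close>
  have idem: "B j ** B j = B j" if j: "j \<le> n" for j
  proof -
    have "B j ** B j = (if j = j then B j else 0)"
    proof (rule matrix_poly_coeffs_unique[OF _ j, where C = "\<lambda>k. B j ** B k" and D = "\<lambda>k. if k = j then B j else 0"])
      fix z :: complex assume z: "z \<noteq> 0"
      have "(\<Sum>k\<le>n. z ^ k *\<^sub>c (B j ** B k)) = B j ** (z ^ K *\<^sub>c \<rho> (dg z))"
        by (simp only: B[OF z] sum_matrix_mult_right cscale_mult_right)
      also have "\<dots> = z ^ j *\<^sub>c B j" by (rule B_rho[OF z j])
      also have "\<dots> = (\<Sum>k\<le>n. if k = j then z ^ j *\<^sub>c B j else 0)" using j by simp
      also have "\<dots> = (\<Sum>k\<le>n. z ^ k *\<^sub>c (if k = j then B j else 0))" by (rule sum.cong) auto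
      finally show "(\<Sum>k\<le>n. z ^ k *\<^sub>c (B j ** B k)) = (\<Sum>k\<le>n. z ^ k *\<^sub>c (if k = j then B j else 0))" .
    qed
    then show ?thesis by simp
  qed
  have one: "(\<Sum>j\<le>n. B j) = mat 1" using B[of 1] by (simp add: dg_1 rho_one)
  \<comment> \<open>On the range cut out by \<open>B j\<close> the torus element exp(s) acts by
    exp((j - K)s); differentiate at s = 0.\<close>
  have BH: "B j ** H = of_real (real j - real K) *\<^sub>c B j" if j: "j \<le> n" for j
  proof -
    have e: "B j ** \<rho> (dg (exp (of_real s))) = exp ((real j - real K) * s) *\<^sub>R B j" for s :: real
    proof -
      let ?w = "exp (of_real s) :: complex"
      have "?w ^ K *\<^sub>c (B j ** \<rho> (dg ?w)) = ?w ^ j *\<^sub>c B j" using B_rho[OF _ j, of ?w] by (simp add: cscale_mult_right)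
      then have "inverse (?w ^ K) *\<^sub>c ?w ^ K *\<^sub>c (B j ** \<rho> (dg ?w)) = inverse (?w ^ K) *\<^sub>c ?w ^ j *\<^sub>c B j" by simp
      then have "B j ** \<rho> (dg ?w) = (inverse (?w ^ K) * ?w ^ j) *\<^sub>c B j" by simp
      also have "inverse (?w ^ K) * ?w ^ j = of_real (exp ((real j - real K) * s))"
        by (simp add: exp_of_nat_mult[symmetric] exp_minus[symmetric] exp_add[symmetric] exp_of_real[symmetric] algebra_simps)
      finally show ?thesis by (simp only: cscale_of_real)
    qed
    have "((\<lambda>s. B j ** \<rho> (dg (exp (of_real s)))) has_vector_derivative B j ** H) (at (0::real))"
      by (rule bounded_linear.has_vector_derivative[OF bounded_linear_matrix_left drho(2)[OF curve_dg]])
    moreover have "((\<lambda>s. exp ((real j - real K) * s)) has_vector_derivative (real j - real K)) (at (0::real))"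
      by (auto intro!: derivative_eq_intros simp: has_real_derivative_iff_has_vector_derivative[symmetric])
    then have "((\<lambda>s. exp ((real j - real K) * s) *\<^sub>R B j) has_vector_derivative (real j - real K) *\<^sub>R B j) (at (0::real))"
      by (rule bounded_linear.has_vector_derivative[OF bounded_linear_scaleR_left])
    ultimately show ?thesis unfolding e cscale_of_real by (rule vector_derivative_unique_at)
  qed
  have "H = (\<Sum>j\<le>n. B j ** H)" using one by (simp only: sum_matrix_mult_left[symmetric] matrix_mul_lid)
  then have H: "H = (\<Sum>j\<le>n. of_real (real j - real K) *\<^sub>c B j)" using BH by simp
  have "H ** H = (\<Sum>j\<le>n. of_real ((real j - real K)\<^sup>2) *\<^sub>c B j)"
  proof -
    have "H ** H = (\<Sum>j\<le>n. of_real (real j - real K) *\<^sub>c (B j ** H))"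
      using arg_cong[OF H, of "\<lambda>A. A ** H"] by (simp only: sum_matrix_mult_left cscale_mult_left)
    then show ?thesis using BH by (simp add: power2_eq_square)
  qed
  then have tr': "(\<Sum>j\<le>n. of_real ((real j - real K)\<^sup>2) * trace (B j)) = 0"
    using tr by (simp add: trace_sum trace_cscale)
  have "\<forall>j\<in>{..n}. \<exists>d::nat. trace (B j) = of_nat d \<and> (d = 0 \<longrightarrow> B j = 0)"
    using trace_idempotent[OF idem] by simp
  then obtain d where d: "\<And>j. j \<le> n \<Longrightarrow> trace (B j) = of_nat (d j)" "\<And>j. j \<le> n \<Longrightarrow> d j = 0 \<Longrightarrow> B j = 0"
    by (metis atMost_iff)
  have "of_real (\<Sum>j\<le>n. (real j - real K)\<^sup>2 * real (d j)) = (0::complex)"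
    using tr' d(1) by simp
  \<comment> \<open>All summands are nonnegative, as traces of idempotents are natural numbers. So
    every \<open>B j\<close> with j different from K has trace 0 and vanishes.\<close>
  then have "(\<Sum>j\<le>n. (real j - real K)\<^sup>2 * real (d j)) = 0" by (simp only: of_real_eq_0_iff)
  then have "\<forall>j\<in>{..n}. (real j - real K)\<^sup>2 * real (d j) = 0"
    by (subst (asm) sum_nonneg_eq_0_iff) auto
  then have jK: "j = K \<or> B j = 0" if "j \<le> n" for j
    using d(2)[OF that] that by auto
  have "(\<Sum>j\<le>n. z ^ j *\<^sub>c B j) = (\<Sum>j\<le>n. z ^ K *\<^sub>c B j)"
  proof (intro sum.cong refl)
    fix j assume "j \<in> {..n}"
    then show "z ^ j *\<^sub>c B j = z ^ K *\<^sub>c B j" using jK[of j] by auto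
  qed
  also have "\<dots> = z ^ K *\<^sub>c mat 1" by (simp only: sum_cscale_right[symmetric] one)
  finally have "inverse (z ^ K) *\<^sub>c z ^ K *\<^sub>c \<rho> (dg z) = inverse (z ^ K) *\<^sub>c z ^ K *\<^sub>c mat 1"
    using B[OF z] by simp
  then show ?thesis using z by simp
qed

end

section \<open>Langlands parameters\<close>

text \<open>Pairing with the orthogonal complement gives functions that are identically zero, so the
  derivative is orthogonal to the complement too.\<close>

lemma subspace_vector_derivative:
  fixes g :: "real \<Rightarrow> 'a::euclidean_space"
  assumes S: "subspace S" and g: "\<And>t. g t \<in> S" and D: "(g has_vector_derivative D) (at t0)"
  shows "D \<in> S"
proof -
  have "D \<bullet> y = 0" if y: "y \<in> S\<^sup>\<bottom>" for y
  proof -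
    have "((\<lambda>t. g t \<bullet> y) has_vector_derivative D \<bullet> y) (at t0)"
      by (rule bounded_linear.has_vector_derivative[OF bounded_linear_inner_left D])
    moreover have "g t \<bullet> y = 0" for t
      using y g[of t] by (simp add: orthogonal_comp_def orthogonal_def)
    ultimately have "((\<lambda>t. 0) has_vector_derivative D \<bullet> y) (at t0)" by simp
    from vector_derivative_unique_at[OF this has_vector_derivative_const] show ?thesis .
  qed
  then have "D \<in> S\<^sup>\<bottom>\<^sup>\<bottom>" by (simp add: orthogonal_comp_def orthogonal_def inner_commute)
  then show ?thesis using orthogonal_comp_self[OF S] by simp
qed

lemma weil_mult: "a \<otimes>\<^bsub>weil v\<^esub> b = a \<circ> b"
  by (simp add: weil_def)

locale langlands_datum = L_datum Gd v act + padic v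
  for Gd :: "(complex^'m^'m) set" and v :: "'f::field_char_0 \<Rightarrow> real"
    and act :: "('f alg_closure \<Rightarrow> 'f alg_closure) \<Rightarrow> complex^'m^'m \<Rightarrow> complex^'m^'m" +
  fixes Fr :: "'f alg_closure \<Rightarrow> 'f alg_closure" and phi :: "('f, 'm) L_param"
  assumes act_finite: "\<exists>A. finite A \<and> (\<forall>w\<in>carrier (weil v). (\<forall>x\<in>A. w x = x) \<longrightarrow> (\<forall>g\<in>Gd. act w g = g))"
    and frob: "frobenius_element v Fr"
    and par: "langlands_parameter v Gd act Fr phi"
begin

abbreviation "Ad \<equiv> L_Ad Gd act"

lemma phi_mem: "w \<in> W \<Longrightarrow> x \<in> SL2 \<Longrightarrow> phi (w, x) \<in> carrier LG"
proof -
  assume "w \<in> W" "x \<in> SL2"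
  moreover have "phi \<in> carrier (weil v \<times>\<times> matgroup SL2) \<rightarrow> carrier LG"
    using par by (simp add: langlands_parameter_def hom_def)
  ultimately show ?thesis by (auto simp: DirProd_def)
qed

lemma phi_snd: "w \<in> W \<Longrightarrow> x \<in> SL2 \<Longrightarrow> snd (phi (w, x)) = w"
  using par by (simp add: langlands_parameter_def)

lemma phi_fst_mem: "w \<in> W \<Longrightarrow> x \<in> SL2 \<Longrightarrow> fst (phi (w, x)) \<in> Gd"
  using phi_mem by (simp add: L_carrier)

lemma phi_mult:
  assumes "w \<in> W" "u \<in> W" "x \<in> SL2" "y \<in> SL2"
  shows "phi (w \<circ> u, x ** y) = phi (w, x) \<otimes>\<^bsub>LG\<^esub> phi (u, y)"
proof -
  have "phi ((w, x) \<otimes>\<^bsub>weil v \<times>\<times> matgroup SL2\<^esub> (u, y)) = phi (w, x) \<otimes>\<^bsub>LG\<^esub> phi (u, y)"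
    by (rule hom_mult) (use par assms in \<open>simp_all add: langlands_parameter_def DirProd_def\<close>)
  then show ?thesis by (simp add: weil_mult GL_def)
qed

lemma phi_fst_mult:
  assumes "w \<in> W" "u \<in> W" "x \<in> SL2" "y \<in> SL2"
  shows "fst (phi (w \<circ> u, x ** y)) = fst (phi (w, x)) ** act w (fst (phi (u, y)))"
  using phi_mult[OF assms] phi_snd[OF assms(1,3)] by (simp add: L_mult)

definition rho :: "complex^2^2 \<Rightarrow> complex^'m^'m" where "rho x = fst (phi (id, x))"

text \<open>The cocycle of the Weil group with values in \<open>Gd\<close> that underlies phi;
  temperedness says that its image is bounded in \<open>Gd\<close>.\<close>

definition cc :: "('f alg_closure \<Rightarrow> 'f alg_closure) \<Rightarrow> complex^'m^'m" where "cc w = fst (phi (w, mat 1))"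

lemma rho_mem: "x \<in> SL2 \<Longrightarrow> rho x \<in> Gd" and cc_mem: "w \<in> W \<Longrightarrow> cc w \<in> Gd"
  using phi_fst_mem weil_id SL2_one by (simp_all add: rho_def cc_def)

lemma rho_mult': "x \<in> SL2 \<Longrightarrow> y \<in> SL2 \<Longrightarrow> rho (x ** y) = rho x ** rho y"
  using phi_fst_mult[OF weil_id weil_id, of x y] rho_mem[of y] by (simp add: rho_def act_id)

lemma rho_one': "rho (mat 1) = mat 1"
proof -
  let ?a = "rho (mat 1)"
  have "?a ** ?a = ?a" using rho_mult'[OF SL2_one SL2_one] by simp
  then have "matrix_inv ?a ** (?a ** ?a) = matrix_inv ?a ** ?a" by simp
  then show ?thesis
    by (simp add: matrix_mul_assoc matrix_inv_mult(1)[OF invertible_mem[OF rho_mem[OF SL2_one]]])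
qed

sublocale R: SL2_rep rho
proof
  show "regular_map_on SL2 rho"
    using par unfolding langlands_parameter_def rho_def by (elim conjE)
qed (use rho_one' rho_mult' in auto)

lemma matrix_inv_rho: "x \<in> SL2 \<Longrightarrow> y \<in> SL2 \<Longrightarrow> x ** y = mat 1 \<Longrightarrow> matrix_inv (rho x) = rho y"
  by (rule matrix_inv_eqI) (rule R.rho_inverse)

lemma matrix_inv_rho_dg: "z \<noteq> 0 \<Longrightarrow> matrix_inv (rho (dg z)) = rho (dg (inverse z))"
  by (rule matrix_inv_eqI) (rule R.rho_dg_inverse)

text \<open>Both factorisations (w, 1)(id, x) and (id, x)(w, 1) of the element (w, x) are mapped by
  phi and compared.\<close>

lemma cc_rho:
  assumes "w \<in> W" "x \<in> SL2"
  shows "cc w ** act w (rho x) = rho x ** cc w" "fst (phi (w, x)) = rho x ** cc w"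
proof -
  have "fst (phi (w \<circ> id, mat 1 ** x)) = cc w ** act w (rho x)"
    unfolding cc_def rho_def by (rule phi_fst_mult) (use assms weil_id SL2_one in auto)
  moreover have "fst (phi (id \<circ> w, x ** mat 1)) = rho x ** act id (cc w)"
    unfolding cc_def rho_def by (rule phi_fst_mult) (use assms weil_id SL2_one in auto)
  ultimately show "cc w ** act w (rho x) = rho x ** cc w" "fst (phi (w, x)) = rho x ** cc w"
    using act_id[OF cc_mem[OF assms(1)]] by simp_all
qed

lemma Ad_phi_mult:
  assumes "w \<in> W" "u \<in> W" "w \<circ> u \<in> W" "x \<in> SL2" "y \<in> SL2" "Z \<in> \<gg>"
  shows "Ad (phi (w \<circ> u, x ** y)) Z = Ad (phi (w, x)) (Ad (phi (u, y)) Z)"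
proof -
  have "phi (w \<circ> u, x ** y) \<in> carrier LG" by (rule phi_mem) (use assms SL2_mult in auto)
  then show ?thesis
    unfolding phi_mult[OF assms(1,2,4,5)] by (intro L_Ad_mult phi_mem assms)
qed

lemma Ad_rho:
  assumes "x \<in> SL2" "Z \<in> \<gg>"
  shows "Ad (phi (id, x)) Z = rho x ** Z ** matrix_inv (rho x)"
  using L_Ad_inner[OF phi_mem[OF weil_id assms(1)] _ assms(2)] phi_snd[OF weil_id assms(1)]
  by (simp add: act_id rho_def)

lemma Ad_phi:
  assumes w: "w \<in> W" and z: "z \<noteq> 0" and Z: "Z \<in> \<gg>"
  shows "Ad (phi (w, dg z)) Z = rho (dg z) ** Ad (phi (w, mat 1)) Z ** rho (dg (inverse z))"
proof -
  have "Ad (phi (id \<circ> w, dg z ** mat 1)) Z = Ad (phi (id, dg z)) (Ad (phi (w, mat 1)) Z)"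
    by (rule Ad_phi_mult) (use w weil_id dg_SL2[OF z] SL2_one Z in auto)
  then show ?thesis
    using Ad_rho[OF dg_SL2[OF z] L_Ad_mem[OF phi_mem[OF w SL2_one] Z]] matrix_inv_rho_dg[OF z] by simp
qed

lemma Ad_commute:
  assumes w: "w \<in> W" and x: "x \<in> SL2" and Z: "Z \<in> \<gg>"
  shows "Ad (phi (w, mat 1)) (Ad (phi (id, x)) Z) = Ad (phi (id, x)) (Ad (phi (w, mat 1)) Z)"
  using Ad_phi_mult[OF w weil_id _ SL2_one x Z] Ad_phi_mult[OF weil_id w _ x SL2_one Z] w by simp

lemma Ad_add: "a \<in> carrier LG \<Longrightarrow> Z \<in> \<gg> \<Longrightarrow> Y \<in> \<gg> \<Longrightarrow> Ad a (Z + Y) = Ad a Z + Ad a Y"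
  and Ad_cscale: "a \<in> carrier LG \<Longrightarrow> Z \<in> \<gg> \<Longrightarrow> Ad a (c *\<^sub>c Z) = c *\<^sub>c Ad a Z"
proof -
  assume a: "a \<in> carrier LG" and Z: "Z \<in> \<gg>"
  obtain L where L: "clinear L" "\<And>Z. Z \<in> \<gg> \<Longrightarrow> Ad a Z = L Z" using L_Ad_clinear[OF a] by blast
  show "Ad a (c *\<^sub>c Z) = c *\<^sub>c Ad a Z"
    using Z by (simp add: L(2) lie_algebra_cscale clinearD[OF L(1)])
  show "Ad a (Z + Y) = Ad a Z + Ad a Y" if "Y \<in> \<gg>"
    using Z that by (simp add: L(2) lie_algebra_add clinearD[OF L(1)])
qed

subsection \<open>The centralizer of the image of the Weil group\<close>

definition mm :: "(complex^'m^'m) set" where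
  "mm = {Z \<in> \<gg>. \<forall>w\<in>W. Ad (phi (w, mat 1)) Z = Z}"

lemma mm_add: "Z \<in> mm \<Longrightarrow> Y \<in> mm \<Longrightarrow> Z + Y \<in> mm"
  and mm_cscale: "Z \<in> mm \<Longrightarrow> c *\<^sub>c Z \<in> mm"
  by (simp_all add: mm_def lie_algebra_add lie_algebra_cscale Ad_add Ad_cscale phi_mem SL2_one)

lemma mm_0: "0 \<in> mm" if "Z \<in> mm" for Z
  using mm_cscale[OF that, of 0] by simp

lemma mm_rho:
  assumes "x \<in> SL2" "y \<in> SL2" "x ** y = mat 1" "Z \<in> mm"
  shows "rho x ** Z ** rho y \<in> mm"
proof -
  have Z: "Z \<in> \<gg>" using assms(4) by (simp add: mm_def)
  have "Ad (phi (id, x)) Z = rho x ** Z ** rho y"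
    using Ad_rho[OF assms(1) Z] matrix_inv_rho[OF assms(1-3)] by simp
  moreover have "Ad (phi (id, x)) Z \<in> mm"
    using Ad_commute[OF _ assms(1) Z] assms(4) L_Ad_mem[OF phi_mem[OF weil_id assms(1)] Z]
    by (simp add: mm_def)
  ultimately show ?thesis by simp
qed

text \<open>Conjugation by phi(w, 1) fixes every point of the curve \<open>rho (\<gamma> t)\<close>,
  hence its velocity.\<close>

lemma drho_mm:
  assumes \<gamma>: "curve_in SL2 \<gamma> Z"
  shows "R.drho Z \<in> mm"
proof -
  have m: "\<gamma> t \<in> SL2" "\<gamma> 0 = mat 1" for t using \<gamma> by (simp_all add: curve_in_def)
  have c: "curve_in Gd (\<lambda>t. rho (\<gamma> t)) (R.drho Z)"
    unfolding curve_in_def using R.drho(2)[OF \<gamma>] m rho_mem by (simp add: rho_one')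
  have "Ad (phi (w, mat 1)) (R.drho Z) = R.drho Z" if w: "w \<in> W" for w
  proof (rule L_Ad_eqI[OF phi_mem[OF w SL2_one] c])
    have "conjL (phi (w, mat 1)) (rho (\<gamma> t)) = rho (\<gamma> t)" for t
    proof -
      have "conjL (phi (w, mat 1)) (rho (\<gamma> t)) = rho (\<gamma> t) ** (cc w ** matrix_inv (cc w))"
        using cc_rho(1)[OF w m(1)[of t]] phi_snd[OF w SL2_one] by (simp add: conjL_def cc_def matrix_mul_assoc)
      then show ?thesis using matrix_inv_mult(2)[OF invertible_mem[OF cc_mem[OF w]]] by simp
    qed
    then show "((\<lambda>t. conjL (phi (w, mat 1)) (rho (\<gamma> t))) has_vector_derivative R.drho Z) (at 0)"
      using R.drho(2)[OF \<gamma>] by simp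
  qed
  then show ?thesis using lie_algebra_curve[OF c] by (simp add: mm_def)
qed

lemma E_mm: "R.E \<in> mm" and F_mm: "R.F \<in> mm"
  using drho_mm[OF curve_uc[of 1]] drho_mm[OF curve_lc[of 1]] by simp_all

lemma subspace_mm: "subspace mm"
  unfolding subspace_def using mm_0[OF E_mm] mm_add mm_cscale[of _ "of_real c" for c]
  by (auto simp: cscale_of_real)

text \<open>The bracket is the derivative at 0 of conjugation by \<open>rho (\<gamma> t)\<close>, a
  motion inside the subspace \<open>mm\<close>.\<close>

lemma br_drho_mm:
  assumes Y: "Y \<in> mm" and \<gamma>: "curve_in SL2 \<gamma> A" "curve_in SL2 \<gamma>' (- A)" "\<And>s. \<gamma> s ** \<gamma>' s = mat 1"
  shows "br (R.drho A) Y \<in> mm"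
proof (rule subspace_vector_derivative[OF subspace_mm])
  have m: "\<gamma> t \<in> SL2" "\<gamma>' t \<in> SL2" "\<gamma> 0 = mat 1" "\<gamma>' 0 = mat 1" for t using \<gamma> by (simp_all add: curve_in_def)
  show "rho (\<gamma> t) ** Y ** rho (\<gamma>' t) \<in> mm" for t by (rule mm_rho[OF m(1,2) \<gamma>(3) Y])
  have "((\<lambda>s. rho (\<gamma> s) ** Y ** rho (\<gamma>' s)) has_vector_derivative Y ** R.drho (- A) + R.drho A ** Y) (at 0)"
    using has_vector_derivative_matrix_mult[OF bounded_linear.has_vector_derivative[OF bounded_linear_matrix_right R.drho(2)[OF \<gamma>(1)]] R.drho(2)[OF \<gamma>(2)]]
    by (simp add: m rho_one')
  then show "((\<lambda>s. rho (\<gamma> s) ** Y ** rho (\<gamma>' s)) has_vector_derivative br (R.drho A) Y) (at 0)"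
    by (simp add: br_def clinearD[OF R.drho(1)] matrix_minus_right)
qed

lemma br_E_mm: assumes "Y \<in> mm" shows "br R.E Y \<in> mm"
  by (rule br_drho_mm[OF assms, where \<gamma> = "\<lambda>s. uc (of_real s * 1)" and \<gamma>' = "\<lambda>s. uc (of_real s * (-1))"])
     (use curve_uc[of 1] curve_uc[of "-1"] in \<open>simp_all add: uc_add uc_0 cscale_minus_1\<close>)

lemma br_F_mm: assumes "Y \<in> mm" shows "br R.F Y \<in> mm"
  by (rule br_drho_mm[OF assms, where \<gamma> = "\<lambda>s. lc (of_real s * 1)" and \<gamma>' = "\<lambda>s. lc (of_real s * (-1))"])
     (use curve_lc[of 1] curve_lc[of "-1"] in \<open>simp_all add: lc_add lc_0 cscale_minus_1\<close>)

subsection \<open>The infinitesimal parameter\<close>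

abbreviation "lam \<equiv> infinitesimal_parameter v Fr phi"
abbreviation "VV \<equiv> V_space v Gd act Fr lam"
abbreviation "HH \<equiv> H_group v Gd act lam"

definition nd :: "('f alg_closure \<Rightarrow> 'f alg_closure) \<Rightarrow> real" where
  "nd w = weil_norm v Fr w powr (1/2)"

lemma nd_pos: "0 < nd w" and nd_square: "(nd w)\<^sup>2 = weil_norm v Fr w"
proof -
  have p: "0 < weil_norm v Fr w" by (rule weil_norm_pos)
  then show "0 < nd w" by (simp add: nd_def)
  show "(nd w)\<^sup>2 = weil_norm v Fr w" using p by (simp add: nd_def powr_half_sqrt)
qed

lemma norm_diag_dg: "norm_diag v Fr w = dg (of_real (nd w))"
  by (simp add: norm_diag_def dg_def nd_def powr_minus)

lemma lam_eq: "lam w = phi (w, dg (of_real (nd w)))"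
  by (simp add: infinitesimal_parameter_def norm_diag_dg)

lemma nd_SL2: "dg (of_real (nd w)) \<in> SL2"
  using nd_pos[of w] by (intro dg_SL2) simp

lemma lam_mem: "w \<in> W \<Longrightarrow> lam w \<in> carrier LG"
  unfolding lam_eq using nd_SL2 phi_mem by blast

lemma Ad_lam:
  assumes "w \<in> W" "Z \<in> \<gg>"
  shows "Ad (lam w) Z = rho (dg (of_real (nd w))) ** Ad (phi (w, mat 1)) Z ** rho (dg (inverse (of_real (nd w))))"
  unfolding lam_eq by (rule Ad_phi) (use assms nd_pos[of w] in auto)

lemma V_subset: "Z \<in> VV \<Longrightarrow> Z \<in> \<gg>" and V_Ad: "Z \<in> VV \<Longrightarrow> w \<in> W \<Longrightarrow> Ad (lam w) Z = weil_norm v Fr w *\<^sub>R Z"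
  by (simp_all add: V_space_def)

text \<open>On \<open>mm\<close> only the torus part of \<open>lam w\<close> acts, and weight 2
  turns \<open>nd w\<close> into the norm. This inclusion holds for every parameter; the converse
  will use boundedness.\<close>

lemma mm_wt2_V: assumes "Z \<in> mm" "R.wt 2 Z" shows "Z \<in> VV"
proof -
  have "Ad (lam w) Z = weil_norm v Fr w *\<^sub>R Z" if w: "w \<in> W" for w
  proof -
    have "Ad (lam w) Z = (of_real (nd w) powi 2) *\<^sub>c Z"
      using Ad_lam[OF w, of Z] assms w nd_pos[of w] by (simp add: mm_def R.wt_def)
    also have "\<dots> = of_real (weil_norm v Fr w) *\<^sub>c Z" by (simp add: nd_square[symmetric])
    finally show ?thesis by (simp only: cscale_of_real)
  qed
  then show ?thesis using assms(1) by (simp add: V_space_def mm_def)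
qed

text \<open>The action depends only on the effect on a finite set, on which some power of
  \<open>Fr\<close> is trivial. All multiples of N are recorded, for a limit along k.\<close>

lemma frobenius_powers_act_trivially:
  "\<exists>N\<ge>1. \<forall>k. \<forall>g\<in>Gd. act (Fr ^^ (N * k)) g = g"
proof -
  obtain A where A: "finite A" "\<And>w g. w \<in> W \<Longrightarrow> (\<forall>x\<in>A. w x = x) \<Longrightarrow> g \<in> Gd \<Longrightarrow> act w g = g"
    using act_finite by blast
  obtain N where N: "N \<ge> 1" "\<forall>x\<in>A. (Fr ^^ N) x = x"
    using galois_finite_order_on[OF frobenius_galois[OF frob] A(1)] by blast
  have "\<forall>x\<in>A. (Fr ^^ (N * k)) x = x" for k
    using N(2) funpow_fixed[of "Fr ^^ N"] by (simp add: funpow_mult)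
  then have "act (Fr ^^ (N * k)) g = g" if "g \<in> Gd" for k g
    using A(2) frobenius_funpow_weil(1)[OF frob] that by blast
  then show ?thesis using N(1) by blast
qed

text \<open>\<open>Ad (lam (Fr ^ n))\<close> for \<open>n\<close> divisible by \<open>N\<close> is conjugation by \<open>rho (dg s)\<close> times a bounded element,
  so \<open>Z\<close> in \<open>VV\<close> can only have the weight matching the norm.\<close>

lemma V_wt2:
  assumes temp: "tempered v Gd phi" and Z: "Z \<in> VV"
  shows "R.wt 2 Z"
proof -
  have Zg: "Z \<in> \<gg>" using Z by (rule V_subset)
  obtain N where N: "N \<ge> 1" "\<And>k g. g \<in> Gd \<Longrightarrow> act (Fr ^^ (N * k)) g = g"
    using frobenius_powers_act_trivially by blast
  have FrW: "Fr ^^ n \<in> W" "inv_into UNIV (Fr ^^ n) \<in> W" for n using frobenius_funpow_weil[OF frob] by blast+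
  have Fr1: "Fr \<in> W" using FrW(1)[of 1] by simp
  define s where "s = nd Fr"
  have s: "0 < s" "s\<^sup>2 = inverse (real q)" using nd_pos nd_square weil_norm_frobenius[OF frob] by (simp_all add: s_def)
  have s1: "s < 1"
  proof -
    have "s\<^sup>2 < 1\<^sup>2" using s(2) q_ge_2 by (simp add: inverse_less_1_iff)
    then show ?thesis by (rule power2_less_imp_less) simp
  qed
  have sn: "(of_real s ^ n :: complex) \<noteq> 0" for n using s by simp
  \<comment> \<open>Only the defining relation of \<open>VV\<close> at \<open>Fr\<close> is
    iterated, so multiplicativity of the norm is never invoked.\<close>
  have iter: "Ad (phi (Fr ^^ n, dg (of_real s ^ n))) Z = (of_real s ^ n)\<^sup>2 *\<^sub>c Z" for n
  proof (induction n)
    case 0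
    have "Ad (phi (id, mat 1)) Z = Z" using Ad_rho[OF SL2_one Zg] matrix_inv_rho[OF SL2_one SL2_one]
      by (simp add: rho_one')
    then show ?case by (simp add: dg_1 id_def)
  next
    case (Suc n)
    have "Ad (phi (Fr \<circ> Fr ^^ n, dg (of_real s) ** dg (of_real s ^ n))) Z =
        Ad (phi (Fr, dg (of_real s))) (Ad (phi (Fr ^^ n, dg (of_real s ^ n))) Z)"
      by (rule Ad_phi_mult) (use FrW(1)[of n] FrW(1)[of "Suc n"] Fr1 dg_SL2 sn[of n] s(1) Zg in auto)
    also have "\<dots> = (of_real s ^ n)\<^sup>2 *\<^sub>c Ad (lam Fr) Z"
      unfolding Suc lam_eq s_def[symmetric]
      by (rule Ad_cscale[OF _ Zg]) (rule phi_mem, use Fr1 dg_SL2 s(1) in auto)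
    also have "Ad (lam Fr) Z = of_real (s\<^sup>2) *\<^sub>c Z"
      using V_Ad[OF Z Fr1] by (simp only: nd_square s_def cscale_of_real)
    finally show ?case by (simp add: dg_mult power_mult_distrib mult.commute)
  qed
  define c where "c k = cc (Fr ^^ (N * k))" for k
  \<comment> \<open>As s < 1 and N is positive, r exceeds 1; the powers s^(Nk) are the reciprocals
    of r^k, as \<open>wt2I\<close> expects.\<close>
  define r where "r = inverse (s ^ N)"
  have r1: "r > 1" using s(1) s1 N(1) by (simp add: r_def one_less_inverse_iff power_less_one_iff)
  have rs: "of_real r ^ k = inverse (of_real s ^ (N * k) :: complex)" for k
    by (simp add: r_def power_mult power_inverse)
  have ck: "c k \<in> Gd" for k unfolding c_def by (rule cc_mem[OF FrW(1)])
  \<comment> \<open>The inverse is again a value of the cocycle, because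
    \<open>Fr ^^ (N * k)\<close> acts trivially. Thus one bound serves \<open>c k\<close> and its
    inverse.\<close>
  have c_inv: "matrix_inv (c k) = cc (inv_into UNIV (Fr ^^ (N * k)))" for k
  proof (rule matrix_inv_eqI)
    let ?w = "Fr ^^ (N * k)"
    have "?w \<circ> inv_into UNIV ?w = id"
      using galois_inv_apply[OF galois_funpow[OF frobenius_galois[OF frob]]] by (simp add: fun_eq_iff)
    moreover have "fst (phi (?w \<circ> inv_into UNIV ?w, mat 1 ** mat 1)) = c k ** act ?w (cc (inv_into UNIV ?w))"
      unfolding c_def cc_def by (rule phi_fst_mult) (use FrW SL2_one in auto)
    ultimately show "c k ** cc (inv_into UNIV ?w) = mat 1"
      using N(2)[OF cc_mem[OF FrW(2)]] rho_one' by (simp add: rho_def)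
  qed
  have comm: "c k ** rho x = rho x ** c k" if "x \<in> SL2" for k x
    using cc_rho(1)[OF FrW(1) that, of "N * k"] N(2)[OF rho_mem[OF that]] by (simp add: c_def)
  have key: "rho (dg (of_real s ^ (N * k))) ** (c k ** Z ** matrix_inv (c k)) ** rho (dg (inverse (of_real s ^ (N * k))))
      = (of_real s ^ (N * k))\<^sup>2 *\<^sub>c Z" for k
  proof -
    have "Ad (phi (Fr ^^ (N * k), mat 1)) Z = c k ** Z ** matrix_inv (c k)"
      using L_Ad_inner[OF phi_mem[OF FrW(1)[of "N * k"] SL2_one] _ Zg] phi_snd[OF FrW(1)[of "N * k"] SL2_one] N(2)
      by (simp add: c_def cc_def)
    then show ?thesis using iter[of "N * k"] Ad_phi[OF FrW(1)[of "N * k"] sn[of "N * k"] Zg] by simp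
  qed
  obtain K where K: "compact K" "cc ` W \<subseteq> K"
    using temp unfolding tempered_def bounded_in_def cc_def by auto
  obtain b where b: "\<And>w. w \<in> W \<Longrightarrow> norm (cc w) \<le> b"
    using compact_imp_bounded[OF K(1)] K(2) unfolding bounded_iff by blast
  obtain D where D: "0 < D" "\<And>(A :: complex^'m^'m) (B :: complex^'m^'m). norm (A ** B) \<le> norm A * norm B * D"
    using bounded_bilinear.pos_bounded[OF bounded_bilinear_matrix_mult] by blast
  have b0: "0 \<le> b" using b[OF Fr1] norm_ge_zero order_trans by blast
  have bound: "norm (A ** Z ** B) \<le> b * norm Z * D * b * D" if A: "norm A \<le> b" "norm B \<le> b" for A B :: "complex^'m^'m"
  proof -
    have "norm (A ** Z ** B) \<le> norm (A ** Z) * norm B * D" by (rule D(2))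
    also have "\<dots> \<le> (norm A * norm Z * D) * norm B * D"
      using D by (intro mult_right_mono D(2)) auto
    also have "\<dots> \<le> (b * norm Z * D) * b * D"
      using D(1) A b0 by (intro mult_right_mono mult_mono) auto
    finally show ?thesis .
  qed
  have nc: "norm (c k) \<le> b" "norm (matrix_inv (c k)) \<le> b" for k
    unfolding c_inv unfolding c_def by (rule b[OF FrW(1)], rule b[OF FrW(2)])
  show ?thesis
  proof (rule R.wt2I[OF r1])
    fix k
    let ?s = "of_real s ^ (N * k) :: complex"
    let ?d = "rho (dg ?s)" and ?e = "rho (dg (inverse ?s))"
    note inv = R.rho_dg_inverse[OF sn[of "N * k"]]
    have ic: "matrix_inv (c k) ** c k = mat 1" "c k ** matrix_inv (c k) = mat 1"
      using matrix_inv_mult[OF invertible_mem[OF ck[of k]]] by auto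
    have "?e ** (?d ** (c k ** Z ** matrix_inv (c k)) ** ?e) ** ?d = ?s\<^sup>2 *\<^sub>c (?e ** Z ** ?d)"
      by (simp only: key cscale_mult_left cscale_mult_right)
    moreover have "?e ** (?d ** (c k ** Z ** matrix_inv (c k)) ** ?e) ** ?d =
        (?e ** ?d) ** (c k ** Z ** matrix_inv (c k)) ** (?e ** ?d)"
      by (simp only: matrix_mul_assoc)
    \<comment> \<open>Solving \<open>key\<close> for conjugation by the inverse torus element leaves
      a conjugate of Z by a bounded matrix: the estimate along r^k.\<close>
    ultimately have 1: "?s\<^sup>2 *\<^sub>c (?e ** Z ** ?d) = c k ** Z ** matrix_inv (c k)"
      by (simp only: inv matrix_mul_lid matrix_mul_rid)
    have "norm (inverse ((inverse ?s)\<^sup>2) *\<^sub>c (?e ** Z ** rho (dg (inverse (inverse ?s))))) \<le> b * norm Z * D * b * D"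
      using bound[OF nc] 1 by (simp add: power_inverse)
    then show "norm (inverse ((of_real r ^ k)\<^sup>2) *\<^sub>c (rho (dg (of_real r ^ k)) ** Z ** rho (dg (inverse (of_real r ^ k))))) \<le> b * norm Z * D * b * D"
      by (simp only: rs)
    have cd: "c k ** ?d = ?d ** c k" by (rule comm[OF dg_SL2[OF sn]])
    have ce: "c k ** ?e = ?e ** c k" by (rule comm, rule dg_SL2) (use sn[of "N * k"] in simp)
    have ce': "matrix_inv (c k) ** ?e = ?e ** matrix_inv (c k)"
    proof -
      have "matrix_inv (c k) ** (c k ** ?e) ** matrix_inv (c k) = matrix_inv (c k) ** (?e ** c k) ** matrix_inv (c k)"
        by (simp only: ce)
      then have "(matrix_inv (c k) ** c k) ** (?e ** matrix_inv (c k)) = (matrix_inv (c k) ** ?e) ** (c k ** matrix_inv (c k))"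
        by (simp only: matrix_mul_assoc)
      then show ?thesis by (simp only: ic matrix_mul_lid matrix_mul_rid)
    qed
    have "c k ** (?d ** Z ** ?e) ** matrix_inv (c k) = (c k ** ?d) ** Z ** (?e ** matrix_inv (c k))"
      by (simp only: matrix_mul_assoc)
    also have "\<dots> = ?d ** (c k ** Z ** matrix_inv (c k)) ** ?e"
      by (simp only: cd ce'[symmetric] matrix_mul_assoc)
    also have "\<dots> = ?s\<^sup>2 *\<^sub>c Z" by (rule key)
    finally have "matrix_inv (c k) ** (c k ** (?d ** Z ** ?e) ** matrix_inv (c k)) ** c k = ?s\<^sup>2 *\<^sub>c (matrix_inv (c k) ** Z ** c k)"
      by (simp only: cscale_mult_left cscale_mult_right)
    moreover have "matrix_inv (c k) ** (c k ** (?d ** Z ** ?e) ** matrix_inv (c k)) ** c k =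
        (matrix_inv (c k) ** c k) ** (?d ** Z ** ?e) ** (matrix_inv (c k) ** c k)"
      by (simp only: matrix_mul_assoc)
    \<comment> \<open>The opposite direction: since \<open>c k\<close> commutes with the torus, it
      can be moved to the other side of \<open>key\<close>. This gives the estimate along
      r^(-k).\<close>
    ultimately have 2: "?d ** Z ** ?e = ?s\<^sup>2 *\<^sub>c (matrix_inv (c k) ** Z ** c k)"
      by (simp only: ic matrix_mul_lid matrix_mul_rid)
    have "(inverse ?s)\<^sup>2 *\<^sub>c (?d ** Z ** ?e) = matrix_inv (c k) ** Z ** c k"
      unfolding 2 using sn[of "N * k"] by (simp add: power_inverse)
    then have "norm ((inverse ?s)\<^sup>2 *\<^sub>c (rho (dg (inverse (inverse ?s))) ** Z ** ?e)) \<le> b * norm Z * D * b * D"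
      using bound[OF nc(2) nc(1), of k k] by simp
    then show "norm ((of_real r ^ k)\<^sup>2 *\<^sub>c (rho (dg (inverse (of_real r ^ k))) ** Z ** rho (dg (of_real r ^ k)))) \<le> b * norm Z * D * b * D"
      by (simp only: rs)
  qed
qed

text \<open>Once Z has weight 2, the torus part of \<open>lam w\<close> accounts for the whole norm;
  cancelling it shows that phi(w, 1) fixes Z.\<close>

lemma V_iff:
  assumes temp: "tempered v Gd phi"
  shows "Z \<in> VV \<longleftrightarrow> Z \<in> mm \<and> R.wt 2 Z"
proof
  assume Z: "Z \<in> VV"
  have Zg: "Z \<in> \<gg>" using Z by (rule V_subset)
  have wt: "R.wt 2 Z" by (rule V_wt2[OF temp Z])
  have "Ad (phi (w, mat 1)) Z = Z" if w: "w \<in> W" for w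
  proof -
    let ?n = "of_real (nd w) :: complex"
    have n0: "?n \<noteq> 0" using nd_pos[of w] by simp
    note inv = R.rho_dg_inverse[OF n0]
    let ?A = "Ad (phi (w, mat 1)) Z" and ?d = "rho (dg ?n)" and ?e = "rho (dg (inverse ?n))"
    have "?d ** ?A ** ?e = ?n\<^sup>2 *\<^sub>c Z"
      using Ad_lam[OF w Zg] V_Ad[OF Z w] nd_square[of w]
      by (simp add: cscale_of_real flip: of_real_power)
    also have "\<dots> = ?d ** Z ** ?e"
      using wt[unfolded R.wt_def, rule_format, OF nd_pos[of w]] by simp
    finally have "?e ** (?d ** ?A ** ?e) ** ?d = ?e ** (?d ** Z ** ?e) ** ?d" by simp
    then have "(?e ** ?d) ** ?A ** (?e ** ?d) = (?e ** ?d) ** Z ** (?e ** ?d)" by (simp only: matrix_mul_assoc)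
    then show ?thesis by (simp only: inv matrix_mul_lid matrix_mul_rid)
  qed
  then show "Z \<in> mm \<and> R.wt 2 Z" using wt Zg by (simp add: mm_def)
qed (use mm_wt2_V in blast)

end

section \<open>The open orbit\<close>

lemma clinear_projection:
  fixes V :: "(complex^'m^'m) set"
  assumes "0 \<in> V" "\<And>Y Z. Y \<in> V \<Longrightarrow> Z \<in> V \<Longrightarrow> Y + Z \<in> V" "\<And>c Z. Z \<in> V \<Longrightarrow> c *\<^sub>c Z \<in> V"
  shows "\<exists>f. clinear f \<and> (\<forall>W. f W \<in> V) \<and> (\<forall>Z\<in>V. f Z = Z)"
proof -
  interpret P: vector_space_pair "cscale :: complex \<Rightarrow> complex^'m^'m \<Rightarrow> _" "cscale :: complex \<Rightarrow> complex^'m^'m \<Rightarrow> _"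
    by unfold_locales (simp_all add: cscale_add_right cscale_add_left)
  have "Vector_Spaces.linear cscale cscale (\<lambda>Z::complex^'m^'m. Z)"
    by unfold_locales simp_all
  moreover have "P.vs1.subspace V" using assms by (simp add: P.vs1.subspace_def)
  ultimately obtain g where g: "g ` UNIV \<subseteq> V" "Vector_Spaces.linear cscale cscale g" "\<forall>Z\<in>V. g Z = Z"
    using P.linear_exists_left_inverse_on[of "\<lambda>Z. Z" V] by (auto simp: inj_on_def)
  interpret g: Vector_Spaces.linear cscale cscale g by (rule g(2))
  have "clinear g" by (rule clinearI) (simp_all add: g.add g.scale)
  then show ?thesis using g(1,3) by blast
qed

lemma clinear_inj_inverse:
  fixes f :: "complex^'m^'m \<Rightarrow> complex^'m^'m"
  assumes f: "clinear f" and inj: "\<And>W. f W = 0 \<Longrightarrow> W = 0"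
  shows "\<exists>g. clinear g \<and> (\<forall>Z. f (g Z) = Z)"
proof -
  have i: "inj f" using linear_injective_0[OF clinearD(6)[OF f]] inj by blast
  then have "surj f" using linear_injective_imp_surjective[OF clinearD(6)[OF f]] by blast
  then have fg: "f (inv_into UNIV f Z) = Z" for Z by (rule surj_f_inv_f)
  have "clinear (inv_into UNIV f)"
  proof (rule clinearI)
    show "inv_into UNIV f (A + B) = inv_into UNIV f A + inv_into UNIV f B" for A B
      by (rule injD[OF i]) (simp add: clinearD[OF f] fg)
    show "inv_into UNIV f (c *\<^sub>c A) = c *\<^sub>c inv_into UNIV f A" for c A
      by (rule injD[OF i]) (simp add: clinearD[OF f] fg)
  qed
  then show ?thesis using fg by blast
qed

definition munit :: "'n \<times> 'n \<Rightarrow> complex^'n^'n" where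
  "munit b = (\<chi> i j. if i = fst b \<and> j = snd b then 1 else 0)"

text \<open>The determinant of an operator in the basis of matrix units, indexed by pairs. It makes
  nondegeneracy of an operator depending on y a polynomial condition on y.\<close>

definition clinear_det :: "(complex^'n^'n \<Rightarrow> complex^'n^'n) \<Rightarrow> complex" where
  "clinear_det f = det (\<chi> a b. f (munit b) $ fst a $ snd a :: complex^('n \<times> 'n)^('n \<times> 'n))"

lemma clinear_sum: "clinear f \<Longrightarrow> f (\<Sum>b\<in>A. c b *\<^sub>c Z b) = (\<Sum>b\<in>A. c b *\<^sub>c f (Z b))"
  by (induction A rule: infinite_finite_induct) (simp_all add: clinearD)

lemma munit_expand: "(W :: complex^'n^'n) = (\<Sum>b\<in>UNIV. (W $ fst b $ snd b) *\<^sub>c munit b)"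
proof -
  have "(\<Sum>b\<in>UNIV. W $ fst b $ snd b * munit b $ i $ j) = (\<Sum>b\<in>UNIV. if b = (i, j) then W $ i $ j else 0)" for i j
    by (rule sum.cong) (auto simp: munit_def prod_eq_iff)
  then show ?thesis by (simp add: vec_eq_iff)
qed

lemma clinear_det_kernel:
  fixes f :: "complex^'n^'n \<Rightarrow> complex^'n^'n"
  assumes f: "clinear f" and d: "clinear_det f \<noteq> 0" and W: "f W = 0"
  shows "W = 0"
proof -
  define A where "A = (\<chi> a b. f (munit b) $ fst a $ snd a :: complex^('n \<times> 'n)^('n \<times> 'n))"
  define x where "x = (\<chi> b. W $ fst b $ snd b :: complex^('n \<times> 'n))"
  have "f W = (\<Sum>b\<in>UNIV. (W $ fst b $ snd b) *\<^sub>c f (munit b))"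
    using arg_cong[OF munit_expand[of W], of f] by (simp only: clinear_sum[OF f])
  then have "(\<Sum>b\<in>UNIV. W $ fst b $ snd b * f (munit b) $ i $ j) = 0" for i j
    using W by (simp add: vec_eq_iff)
  then have "A *v x = 0"
    by (simp add: vec_eq_iff matrix_vector_mult_def A_def x_def mult.commute)
  moreover have "invertible A" using d by (simp add: clinear_det_def A_def invertible_det_nz)
  ultimately have "x = 0"
    using matrix_vector_mul_assoc[of "matrix_inv A" A x] matrix_inv_mult(1)[of A] by simp
  then have "x $ (i, j) = 0" for i j by simp
  then have "W $ i $ j = 0" for i j by (simp add: x_def)
  then show ?thesis by (simp add: vec_eq_iff)
qed

lemma clinear_det_id: "clinear_det (\<lambda>W. W) = 1"
proof -
  have "(\<chi> a b. munit b $ fst a $ snd a) = (mat 1 :: complex^('a \<times> 'a)^('a \<times> 'a))"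
    by (auto simp: vec_eq_iff munit_def mat_nth prod_eq_iff)
  then show ?thesis by (simp add: clinear_det_def)
qed

lemma connected_polynomial_nonzero:
  assumes "P \<noteq> (0 :: complex poly)"
  shows "open {t. poly P t \<noteq> 0}" "connected {t. poly P t \<noteq> 0}"
proof -
  have fin: "finite {t. poly P t = 0}" using assms by (rule poly_roots_finite)
  have eq: "{t. poly P t \<noteq> 0} = UNIV - {t. poly P t = 0}" by blast
  show "open {t. poly P t \<noteq> 0}" unfolding eq using fin by (simp add: open_Diff finite_imp_closed)
  show "connected {t. poly P t \<noteq> 0}" unfolding eq by (rule connected_open_delete_finite) (use fin in auto)
qed

section \<open>The group H, its action on V, and the orbit of the nilpotent element\<close>

context langlands_datum
begin

lemma V_0: "0 \<in> VV" and V_add: "Y \<in> VV \<Longrightarrow> Z \<in> VV \<Longrightarrow> Y + Z \<in> VV"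
  and V_cscale: "Z \<in> VV \<Longrightarrow> c *\<^sub>c Z \<in> VV"
proof -
  show c: "c *\<^sub>c Z \<in> VV" if "Z \<in> VV" for c Z
    using that by (simp add: V_space_def lie_algebra_cscale Ad_cscale lam_mem cscale_of_real[symmetric] mult.commute)
  show "Y + Z \<in> VV" if "Y \<in> VV" "Z \<in> VV" for Y Z
    using that by (simp add: V_space_def lie_algebra_add Ad_add lam_mem scaleR_add_right)
  show "0 \<in> VV" using c[OF mm_wt2_V[OF E_mm R.wt_E], of 0] by simp
qed

lemma V_diff: "Y \<in> VV \<Longrightarrow> Z \<in> VV \<Longrightarrow> Y - Z \<in> VV"
  using V_add[of Y "(-1) *\<^sub>c Z"] V_cscale[of Z "-1"] by (simp add: cscale_minus_1)

lemma HH_iff: "h \<in> HH \<longleftrightarrow> h \<in> Gd \<and> (\<forall>w\<in>W. h ** fst (lam w) = fst (lam w) ** act w h)"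
proof -
  have "snd (lam w) = w" if "w \<in> W" for w
    unfolding lam_eq using that nd_SL2 by (rule phi_snd)
  moreover have "fst (lam w) \<in> Gd" if "w \<in> W" for w using lam_mem[OF that] by (simp add: L_carrier)
  ultimately show ?thesis by (auto simp: H_group_def L_mult act_id)
qed

lemma HH_mult: assumes "h \<in> HH" "k \<in> HH" shows "h ** k \<in> HH"
proof -
  have m: "h \<in> Gd" "k \<in> Gd" using assms by (simp_all add: HH_iff)
  have "h ** k ** fst (lam w) = fst (lam w) ** act w (h ** k)" if w: "w \<in> W" for w
  proof -
    have "h ** k ** fst (lam w) = h ** (fst (lam w) ** act w k)"
      using assms(2) w by (simp add: HH_iff flip: matrix_mul_assoc)
    also have "\<dots> = (h ** fst (lam w)) ** act w k" by (simp only: matrix_mul_assoc)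
    also have "\<dots> = fst (lam w) ** (act w h ** act w k)"
      using assms(1) w by (simp add: HH_iff matrix_mul_assoc)
    finally show ?thesis using act_mult[OF w m] by simp
  qed
  then show ?thesis using m by (simp add: HH_iff mult_mem)
qed

lemma HH_inv: assumes "h \<in> HH" shows "matrix_inv h \<in> HH"
proof -
  have m: "h \<in> Gd" using assms by (simp add: HH_iff)
  note i = matrix_inv_mult[OF invertible_mem[OF m]]
  have "matrix_inv h ** fst (lam w) = fst (lam w) ** act w (matrix_inv h)" if w: "w \<in> W" for w
  proof -
    let ?g = "fst (lam w)" and ?a = "act w h"
    have ia: "?a ** matrix_inv ?a = mat 1" by (rule matrix_inv_mult(2)[OF invertible_mem[OF act_mem[OF w m]]])
    have "matrix_inv h ** ?g = matrix_inv h ** ?g ** (?a ** matrix_inv ?a)" by (simp add: ia)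
    also have "\<dots> = matrix_inv h ** (?g ** ?a) ** matrix_inv ?a" by (simp only: matrix_mul_assoc)
    also have "?g ** ?a = h ** ?g" using assms w by (simp add: HH_iff)
    also have "matrix_inv h ** (h ** ?g) ** matrix_inv ?a = (matrix_inv h ** h) ** ?g ** matrix_inv ?a"
      by (simp only: matrix_mul_assoc)
    finally show ?thesis using act_inv[OF w m] by (simp add: i)
  qed
  then show ?thesis using m by (simp add: HH_iff inv_mem)
qed

text \<open>An element of \<open>HH\<close> commutes with \<open>lam w\<close> in the L-group, so
  its adjoint action preserves the common eigenspace \<open>VV\<close>.\<close>

lemma HH_V: assumes h: "h \<in> HH" and y: "y \<in> VV" shows "h ** y ** matrix_inv h \<in> VV"
proof -
  have hG: "h \<in> Gd" using h by (simp add: HH_iff)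
  let ?h = "(h, id) :: (complex^'m^'m) \<times> ('f alg_closure \<Rightarrow> 'f alg_closure)"
  have hL: "?h \<in> carrier LG" using hG weil_id by (simp add: L_carrier)
  have inner: "Ad ?h Z = h ** Z ** matrix_inv h" if "Z \<in> \<gg>" for Z
    using L_Ad_inner[OF hL _ that] act_id by simp
  have yg: "y \<in> \<gg>" by (rule V_subset[OF y])
  have "Ad (lam w) (Ad ?h y) = weil_norm v Fr w *\<^sub>R Ad ?h y" if w: "w \<in> W" for w
  proof -
    have sw: "snd (lam w) = w" unfolding lam_eq using w nd_SL2 by (rule phi_snd)
    have eq: "?h \<otimes>\<^bsub>LG\<^esub> lam w = lam w \<otimes>\<^bsub>LG\<^esub> ?h" using h w by (simp add: H_group_def)
    have mem: "?h \<otimes>\<^bsub>LG\<^esub> lam w \<in> carrier LG"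
      using hG lam_mem[OF w] by (simp add: L_carrier L_mult mult_mem act_id)
    have "Ad (lam w) (Ad ?h y) = Ad (lam w \<otimes>\<^bsub>LG\<^esub> ?h) y"
      using L_Ad_mult[OF lam_mem[OF w] hL _ yg] mem unfolding eq by simp
    also have "\<dots> = Ad ?h (Ad (lam w) y)"
      using L_Ad_mult[OF hL lam_mem[OF w] mem yg] unfolding eq by simp
    also have "Ad (lam w) y = of_real (weil_norm v Fr w) *\<^sub>c y" using V_Ad[OF y w] by (simp add: cscale_of_real)
    also have "Ad ?h (of_real (weil_norm v Fr w) *\<^sub>c y) = of_real (weil_norm v Fr w) *\<^sub>c Ad ?h y"
      by (rule Ad_cscale[OF hL yg])
    finally show ?thesis by (simp only: cscale_of_real)
  qed
  then have "Ad ?h y \<in> VV" using L_Ad_mem[OF hL yg] by (simp add: V_space_def)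
  then show ?thesis by (simp add: inner[OF yg])
qed

text \<open>For \<open>Y\<close> in \<open>mm\<close> of weight 0, neither phi(w, 1) nor the torus
  part of \<open>lam w\<close> moves \<open>Y\<close>; so conjugation by \<open>lam w\<close> fixes
  its exponential.\<close>

lemma mexp_HH: assumes Y: "Y \<in> mm" "R.wt 0 Y" shows "mexp Y \<in> HH"
proof -
  have Yg: "Y \<in> \<gg>" using Y(1) by (simp add: mm_def)
  have "mexp Y ** fst (lam w) = fst (lam w) ** act w (mexp Y)" if w: "w \<in> W" for w
  proof -
    have sw: "snd (lam w) = w" unfolding lam_eq using w nd_SL2 by (rule phi_snd)
    have "Ad (lam w) Y = Y"
      using Ad_lam[OF w Yg] Y w nd_pos[of w] by (simp add: mm_def R.wt_def)
    then have "fst (lam w) ** act w (mexp Y) ** matrix_inv (fst (lam w)) = mexp Y"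
      using conjL_mexp[OF lam_mem[OF w] Yg, of 1] sw by (simp add: conjL_def)
    then have "mexp Y ** fst (lam w) = fst (lam w) ** act w (mexp Y) ** (matrix_inv (fst (lam w)) ** fst (lam w))"
      by (simp add: matrix_mul_assoc)
    then show ?thesis using matrix_inv_mult(1)[OF invertible_mem] lam_mem[OF w] by (simp add: L_carrier)
  qed
  then show ?thesis using mexp_mem[OF Yg] by (simp add: HH_iff)
qed

text \<open>On \<open>VV\<close> the map ad(E) ad(F) is injective by
  \<open>EF_injective_wt2\<close>, hence bijective in finite dimension. Its inverse followed by
  ad(F) solves [s, E] = Z linearly in Z, up to sign, with s of weight 0.\<close>

lemma ex_section:
  assumes V_iff: "\<And>Z. Z \<in> VV \<longleftrightarrow> Z \<in> mm \<and> R.wt 2 Z"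
  shows "\<exists>pr s. clinear pr \<and> clinear s \<and> (\<forall>U. pr U \<in> VV) \<and> (\<forall>Z\<in>VV. pr Z = Z) \<and>
    (\<forall>U. s U \<in> mm \<and> R.wt 0 (s U)) \<and> (\<forall>U. br (s U) R.E = pr U)"
proof -
  obtain pr where pr: "clinear pr" "\<And>U. pr U \<in> VV" "\<And>Z. Z \<in> VV \<Longrightarrow> pr Z = Z"
    using clinear_projection[of VV] V_0 V_add V_cscale by blast
  note prs = clinearD[OF pr(1)]
  have FV: "br R.F Z \<in> mm" "R.wt 0 (br R.F Z)" if "Z \<in> VV" for Z
    using that br_F_mm R.wt_br[OF R.wt_F, of 2 Z] by (simp_all add: V_iff)
  have EFV: "br R.E (br R.F Z) \<in> VV" if "Z \<in> VV" for Z
    using FV[OF that] br_E_mm R.wt_br[OF R.wt_E, of 0 "br R.F Z"] by (simp add: V_iff)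
  \<comment> \<open>Extended by the identity on the kernel of the projection \<open>pr\<close>,
    ad(E) ad(F) becomes an operator on all matrices, where injective implies surjective.\<close>
  define \<Theta> where "\<Theta> U = br R.E (br R.F (pr U)) + (U - pr U)" for U
  have "clinear \<Theta>"
    by (rule clinearI)
       (simp_all add: \<Theta>_def prs br_add_right br_cscale_right cscale_add_right cscale_diff_right)
  moreover have "U = 0" if "\<Theta> U = 0" for U
  proof -
    have "U = pr U - br R.E (br R.F (pr U))" using that by (simp add: \<Theta>_def algebra_simps eq_diff_eq)
    then have UV: "U \<in> VV" using V_diff[OF pr(2) EFV[OF pr(2)]] by metis
    then have "br R.E (br R.F U) = 0" using that pr(3) by (simp add: \<Theta>_def)
    moreover have "br R.H U = 2 *\<^sub>c U" using UV R.wt_H[of 2 U] by (simp add: V_iff)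
    ultimately show ?thesis by (rule R.EF_injective_wt2[rotated])
  qed
  ultimately obtain \<theta> where \<theta>: "clinear \<theta>" "\<And>Z. \<Theta> (\<theta> Z) = Z" using clinear_inj_inverse by blast
  have \<theta>V: "\<theta> Z \<in> VV" "br R.E (br R.F (\<theta> Z)) = Z" if Z: "Z \<in> VV" for Z
  proof -
    have "\<theta> Z = pr (\<theta> Z) + (Z - br R.E (br R.F (pr (\<theta> Z))))"
      using \<theta>(2)[of Z] by (simp add: \<Theta>_def algebra_simps)
    then show m: "\<theta> Z \<in> VV" using V_add[OF pr(2) V_diff[OF Z EFV[OF pr(2)]]] by metis
    show "br R.E (br R.F (\<theta> Z)) = Z" using \<theta>(2)[of Z] pr(3)[OF m] by (simp add: \<Theta>_def)
  qed
  \<comment> \<open>The sign compensates for E standing on the right in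
    \<open>br (s U) R.E\<close>.\<close>
  define s where "s U = (-1) *\<^sub>c br R.F (\<theta> (pr U))" for U
  have "clinear s"
    by (rule clinearI) (simp_all add: s_def prs clinearD[OF \<theta>(1)] br_add_right br_cscale_right cscale_add_right)
  moreover have "s U \<in> mm" "R.wt 0 (s U)" for U
    using FV[OF \<theta>V(1)[OF pr(2)]] mm_cscale
    by (simp_all add: s_def R.wt_def cscale_mult_left cscale_mult_right)
  moreover have "br (s U) R.E = pr U" for U
    using \<theta>V(2)[OF pr(2), of U] br_anti[of R.E "br R.F (\<theta> (pr U))"]
    unfolding s_def br_cscale_left by (simp add: cscale_minus_1)
  ultimately show ?thesis using pr by blast
qed

text \<open>\<open>T\<close> will be the union of the translates by \<open>HH\<close> of the set
  where \<open>p\<close> does not vanish. Points of \<open>VV\<close> in that set belong to the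
  orbit, so the orbit is \<open>T \<inter> VV\<close>.\<close>

lemma open_orbit:
  assumes V_iff: "\<And>Z. Z \<in> VV \<longleftrightarrow> Z \<in> mm \<and> R.wt 2 Z"
  shows "openin (subtopology zariski VV) {h ** R.E ** matrix_inv h | h. h \<in> HH}"
proof -
  have EV: "R.E \<in> VV" using E_mm R.wt_E by (simp add: V_iff)
  obtain pr s where pr: "clinear pr" "\<And>U. pr U \<in> VV" "\<And>Z. Z \<in> VV \<Longrightarrow> pr Z = Z"
    and s: "clinear s" "\<And>U. s U \<in> mm \<and> R.wt 0 (s U)" "\<And>U. br (s U) R.E = pr U"
    using ex_section[OF V_iff] by (elim exE conjE) simp
  \<comment> \<open>The derivative at U = 0 of exp(sU) y exp(-sU) + (U - pr U). The second summand
    fills the directions outside \<open>VV\<close>, and at y = \<open>R.E\<close> the whole operator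
    is the identity.\<close>
  define \<Phi> where "\<Phi> y U = br (s U) y + (U - pr U)" for y U
  have lin: "clinear (\<Phi> y)" for y
    by (rule clinearI)
       (simp_all add: \<Phi>_def clinearD[OF pr(1)] clinearD[OF s(1)] br_def matrix_ring_simps
         cscale_mult_left cscale_mult_right cscale_add_right cscale_diff_right)
  define p where "p y = clinear_det (\<Phi> y)" for y
  have pE: "p R.E \<noteq> 0"
  proof -
    have "\<Phi> R.E = (\<lambda>U. U)" by (simp add: \<Phi>_def s(3) fun_eq_iff)
    then show ?thesis by (simp add: p_def clinear_det_id)
  qed
  let ?Z = "{f. \<exists>i j. f = (\<lambda>A::complex^'m^'m. A $ i $ j)}"
  have mult_poly: "(\<lambda>y. (A ** y ** B) $ i $ j) \<in> polyfuns UNIV ?Z" for A B i j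
  proof -
    have *: "(\<lambda>y. A $ i $ l * y $ l $ k * B $ k $ j) \<in> polyfuns UNIV ?Z" for k l
      by (rule polyfuns.mult, rule polyfuns.mult, rule polyfuns.const, simp, rule polyfuns.coord, blast,
          rule polyfuns.const, simp)
    show ?thesis
      unfolding matrix_mult_nth sum_distrib_right by (intro polyfuns_sum *)
  qed
  have p_poly: "p \<in> mat_polys UNIV"
    unfolding mat_polys_def p_def clinear_det_def
  proof (rule polyfuns_det)
    fix a b :: "'m \<times> 'm"
    have "(\<lambda>y. ((s (munit b) ** y ** mat 1) $ fst a $ snd a - (mat 1 ** y ** s (munit b)) $ fst a $ snd a)
        + (munit b - pr (munit b)) $ fst a $ snd a) \<in> polyfuns UNIV ?Z"
      by (rule polyfuns.add, rule polyfuns_diff, rule mult_poly, rule mult_poly, rule polyfuns.const, simp)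
    then show "(\<lambda>y. (\<chi> a b. \<Phi> y (munit b) $ fst a $ snd a :: complex^('m \<times> 'm)^('m \<times> 'm)) $ a $ b) \<in> polyfuns UNIV ?Z"
      by (simp add: \<Phi>_def br_def)
  qed
  text \<open>Inverse function theorem: near a point where \<open>p\<close> does not vanish, \<open>VV\<close> is swept out by \<open>HH\<close>.\<close>
  have local: "\<exists>e>0. \<forall>z\<in>VV. dist y z < e \<longrightarrow> (\<exists>h\<in>HH. z = h ** y ** matrix_inv h)"
    if y: "y \<in> VV" "p y \<noteq> 0" for y
  proof -
    define f where "f U = mexp (s U) ** y ** mexp (- s U) + (U - pr U)" for U
    have f0: "f 0 = y" by (simp add: f_def clinearD[OF s(1)] clinearD[OF pr(1)])
    have ds: "((\<lambda>U. mexp (s U)) has_derivative s) (at 0)"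
      using has_derivative_compose[OF bounded_linear_imp_has_derivative[OF clinearD(7)[OF s(1)]], of mexp "\<lambda>U. U" 0 UNIV]
        mexp_has_derivative_0 by (simp add: clinearD[OF s(1)])
    have ds': "((\<lambda>U. mexp (- s U)) has_derivative (\<lambda>U. - s U)) (at 0)"
      using has_derivative_compose[OF has_derivative_minus[OF bounded_linear_imp_has_derivative[OF clinearD(7)[OF s(1)]]], of mexp "\<lambda>U. U" 0 UNIV]
        mexp_has_derivative_0 by (simp add: clinearD[OF s(1)])
    have dd: "((\<lambda>U. U - pr U) has_derivative (\<lambda>U. U - pr U)) (at 0)"
      by (intro has_derivative_diff has_derivative_ident bounded_linear_imp_has_derivative clinearD(7)[OF pr(1)])
    have der: "(f has_derivative \<Phi> y) (at 0)"
      unfolding f_def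
      by (rule has_derivative_eq_rhs[OF has_derivative_add[OF bounded_bilinear.FDERIV[OF bounded_bilinear_matrix_mult
            has_derivative_compose[OF ds bounded_linear_imp_has_derivative[OF bounded_linear_matrix_right[of y]]] ds'] dd]])
         (simp add: fun_eq_iff \<Phi>_def br_def clinearD[OF s(1)] matrix_ring_simps)
    have cont: "continuous_on UNIV f"
    proof -
      have cs: "continuous_on UNIV s" "continuous_on UNIV pr"
        using clinearD(7)[OF s(1)] clinearD(7)[OF pr(1)] by (simp_all add: linear_continuous_on)
      have "continuous_on UNIV (\<lambda>U. mexp (s U))" "continuous_on UNIV (\<lambda>U. mexp (- s U))"
        by (rule continuous_on_compose2[OF continuous_on_mexp]; use cs in \<open>auto intro: continuous_on_minus\<close>)+
      then show ?thesis unfolding f_def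
        by (intro continuous_on_add continuous_on_diff continuous_on_id cs continuous_on_const
            bounded_bilinear.continuous_on[OF bounded_bilinear_matrix_mult])
    qed
    have "\<And>U. \<Phi> y U = 0 \<Longrightarrow> U = 0" using clinear_det_kernel[OF lin] y(2) unfolding p_def by blast
    then obtain g where g: "clinear g" "\<And>Z. \<Phi> y (g Z) = Z" using clinear_inj_inverse[OF lin] by blast
    have "f 0 \<in> interior (f ` UNIV)"
      by (rule sussmann_open_mapping[OF open_UNIV cont _ der clinearD(7)[OF g(1)]]) (auto simp: g(2))
    then obtain e where e: "e > 0" "ball y e \<subseteq> range f" unfolding f0 mem_interior by blast
    have "\<exists>h\<in>HH. z = h ** y ** matrix_inv h" if z: "z \<in> VV" "dist y z < e" for z
    proof -
      obtain U where U: "z = f U" using e(2) z(2) by (auto simp: subset_iff)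
      have h: "mexp (s U) \<in> HH" using mexp_HH s(2) by blast
      have "mexp (s U) ** y ** mexp (- s U) \<in> VV" using HH_V[OF h y(1)] by (simp add: matrix_inv_mexp)
      then have "z - mexp (s U) ** y ** mexp (- s U) \<in> VV" by (rule V_diff[OF z(1)])
      \<comment> \<open>A vector in \<open>VV\<close> is fixed by \<open>pr\<close>, while
        \<open>pr\<close> annihilates U - pr U; hence this difference is 0 and z is a pure conjugate
        of y.\<close>
      then have "U - pr U \<in> VV" using U by (simp add: f_def)
      then have "pr (U - pr U) = U - pr U" by (rule pr(3))
      then have "U - pr U = 0" using pr(3)[OF pr(2)] by (simp add: clinearD[OF pr(1)])
      then show ?thesis using h U by (intro bexI[of _ "mexp (s U)"]) (simp_all add: f_def matrix_inv_mexp)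
    qed
    then show ?thesis using e(1) by blast
  qed
  define Q where "Q = {h ** R.E ** matrix_inv h | h. h \<in> HH}"
  have Q_trans: "h ** y ** matrix_inv h \<in> Q" if h: "h \<in> HH" and y: "y \<in> Q" for h y
  proof -
    obtain k where k: "k \<in> HH" "y = k ** R.E ** matrix_inv k" using y unfolding Q_def by blast
    have "matrix_inv (h ** k) = matrix_inv k ** matrix_inv h"
      by (rule matrix_inv_mult_distrib; rule invertible_mem) (use h k(1) in \<open>simp_all add: HH_iff\<close>)
    then have "h ** y ** matrix_inv h = (h ** k) ** R.E ** matrix_inv (h ** k)"
      by (simp add: k(2) matrix_mul_assoc)
    then show ?thesis unfolding Q_def using HH_mult[OF h k(1)] by blast
  qed
  have conj_back: "matrix_inv h ** (h ** y ** matrix_inv h) ** matrix_inv (matrix_inv h) = y" if h: "h \<in> HH" for h y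
  proof -
    have hG: "h \<in> Gd" using h by (simp add: HH_iff)
    note i = matrix_inv_mult[OF invertible_mem[OF hG]]
    have "matrix_inv (matrix_inv h) = h" by (rule matrix_inv_eqI) (rule i)
    then have "matrix_inv h ** (h ** y ** matrix_inv h) ** matrix_inv (matrix_inv h) = (matrix_inv h ** h) ** y ** (matrix_inv h ** h)"
      by (simp add: matrix_mul_assoc)
    then show ?thesis by (simp add: i)
  qed
  have Q_V: "Q \<subseteq> VV" unfolding Q_def using HH_V EV by blast
  have EQ: "R.E \<in> Q"
  proof -
    have "mat 1 \<in> HH" using one_mem act_one by (simp add: HH_iff)
    moreover have "R.E = mat 1 ** R.E ** matrix_inv (mat 1)" by (simp add: matrix_inv_eqI[of "mat 1" "mat 1"])
    ultimately show ?thesis unfolding Q_def by blast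
  qed
  text \<open>A complex line meets \<open>{p = 0}\<close> in a finite set, whose complement is connected.\<close>
  have main: "y \<in> Q" if y: "y \<in> VV" "p y \<noteq> 0" for y
  proof -
    define l where "l t = R.E + t *\<^sub>c (y - R.E)" for t
    obtain P where "\<forall>t. p (R.E + t *\<^sub>c (y - R.E)) = poly P t" using mat_poly_affine_line[OF p_poly] ..
    then have P: "p (l t) = poly P t" for t by (simp add: l_def)
    have P0: "poly P 0 \<noteq> 0" using P[of 0] pE by (simp add: l_def)
    have lV: "l t \<in> VV" for t unfolding l_def by (intro V_add V_cscale V_diff EV y)
    define S where "S = {t. poly P t \<noteq> 0}"
    have Pn: "P \<noteq> 0" using P0 by auto
    have S: "open S" "connected S" unfolding S_def by (rule connected_polynomial_nonzero[OF Pn])+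
    have "bounded_linear (\<lambda>t. t *\<^sub>c (y - R.E))"
      unfolding cscale_def
      by (intro linear_conv_bounded_linear[THEN iffD1] linearI) (simp_all add: vec_eq_iff algebra_simps)
    then have cont: "continuous_on UNIV l"
      unfolding l_def by (intro continuous_on_add continuous_on_const linear_continuous_on)
    have nbhd: "\<exists>d>0. \<forall>u. dist u t < d \<longrightarrow> (l u \<in> Q \<longleftrightarrow> l t \<in> Q)" if t: "t \<in> S" for t
    proof -
      have "p (l t) \<noteq> 0" using t by (simp add: S_def P)
      from local[OF lV this] obtain e where e: "e > 0"
        "\<forall>z\<in>VV. dist (l t) z < e \<longrightarrow> (\<exists>h\<in>HH. z = h ** l t ** matrix_inv h)"
        by (elim exE conjE)
      have "\<exists>d>0. \<forall>u. dist u t < d \<longrightarrow> dist (l u) (l t) < e"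
        using cont e(1) by (simp add: continuous_on_iff)
      then obtain d where d: "d > 0" "\<forall>u. dist u t < d \<longrightarrow> dist (l u) (l t) < e" by (elim exE conjE)
      have "l u \<in> Q \<longleftrightarrow> l t \<in> Q" if u: "dist u t < d" for u
      proof -
        have "dist (l t) (l u) < e" using mp[OF spec[OF d(2)] u] by (subst dist_commute)
        then obtain h where h: "h \<in> HH" "l u = h ** l t ** matrix_inv h"
          using bspec[OF e(2) lV[of u]] by blast
        show ?thesis
        proof
          assume "l u \<in> Q"
          then have "matrix_inv h ** l u ** matrix_inv (matrix_inv h) \<in> Q" by (rule Q_trans[OF HH_inv[OF h(1)]])
          then show "l t \<in> Q" unfolding h(2) conj_back[OF h(1)] .
        next
          assume "l t \<in> Q"
          then show "l u \<in> Q" unfolding h(2) by (rule Q_trans[OF h(1)])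
        qed
      qed
      then show ?thesis using d(1) by blast
    qed
    \<comment> \<open>Orbit membership is locally constant on the parameters with
      \<open>p (l t) \<noteq> 0\<close>; both values 0 and 1 of t are such parameters.\<close>
    define A where "A = {t \<in> S. l t \<in> Q}"
    define B where "B = {t \<in> S. l t \<notin> Q}"
    have nb: "\<exists>d>0. \<forall>u. dist u t < d \<longrightarrow> u \<in> S \<and> (l u \<in> Q \<longleftrightarrow> l t \<in> Q)" if t: "t \<in> S" for t
    proof -
      have "\<exists>d>0. \<forall>u. dist u t < d \<longrightarrow> u \<in> S" using S(1) t by (simp add: open_dist)
      then obtain d1 where d1: "d1 > 0" "\<forall>u. dist u t < d1 \<longrightarrow> u \<in> S" by (elim exE conjE)
      obtain d2 where d2: "d2 > 0" "\<forall>u. dist u t < d2 \<longrightarrow> (l u \<in> Q \<longleftrightarrow> l t \<in> Q)"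
        using nbhd[OF t] by (elim exE conjE)
      show ?thesis
      proof (rule exI[where x = "min d1 d2"], intro conjI allI impI)
        show "0 < min d1 d2" using d1(1) d2(1) by simp
        fix u assume "dist u t < min d1 d2"
        then have u: "dist u t < d1" "dist u t < d2" by simp_all
        show "u \<in> S" by (rule mp[OF spec[OF d1(2)] u(1)])
        show "l u \<in> Q \<longleftrightarrow> l t \<in> Q" by (rule mp[OF spec[OF d2(2)] u(2)])
      qed
    qed
    have oA: "open A" unfolding open_dist
    proof
      fix t assume "t \<in> A"
      then have t: "t \<in> S" "l t \<in> Q" by (simp_all add: A_def)
      obtain d where "d > 0" "\<forall>u. dist u t < d \<longrightarrow> u \<in> S \<and> (l u \<in> Q \<longleftrightarrow> l t \<in> Q)"
        using nb[OF t(1)] by (elim exE conjE)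
      then show "\<exists>d>0. \<forall>u. dist u t < d \<longrightarrow> u \<in> A" using t(2) unfolding A_def by blast
    qed
    have oB: "open B" unfolding open_dist
    proof
      fix t assume "t \<in> B"
      then have t: "t \<in> S" "l t \<notin> Q" by (simp_all add: B_def)
      obtain d where "d > 0" "\<forall>u. dist u t < d \<longrightarrow> u \<in> S \<and> (l u \<in> Q \<longleftrightarrow> l t \<in> Q)"
        using nb[OF t(1)] by (elim exE conjE)
      then show "\<exists>d>0. \<forall>u. dist u t < d \<longrightarrow> u \<in> B" using t(2) unfolding B_def by blast
    qed
    have "A \<inter> B \<inter> S = {}" "S \<subseteq> A \<union> B" unfolding A_def B_def by blast+
    then have "A \<inter> S = {} \<or> B \<inter> S = {}" by (rule connectedD[OF S(2) oA oB])
    moreover have "0 \<in> A \<inter> S" using P0 EQ by (simp add: A_def S_def l_def)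
    ultimately have "B \<inter> S = {}" by blast
    moreover have "1 \<in> S" using P[of 1] y(2) by (simp add: S_def l_def)
    ultimately have "l 1 \<in> Q" unfolding B_def by blast
    then show ?thesis by (simp add: l_def)
  qed
  define T where "T = {z. \<exists>h\<in>HH. p (matrix_inv h ** z ** h) \<noteq> 0}"
  have "zariski_open T"
    unfolding zariski_open_def
  proof
    fix z assume "z \<in> T"
    then obtain h where h: "h \<in> HH" "p (matrix_inv h ** z ** h) \<noteq> 0" unfolding T_def by blast
    have "(\<lambda>z. p (matrix_inv h ** z ** h)) \<in> mat_polys UNIV"
      unfolding mat_polys_def by (rule polyfuns_compose[OF p_poly mult_poly])
    moreover have "{z. p (matrix_inv h ** z ** h) \<noteq> 0} \<subseteq> T" unfolding T_def using h(1) by blast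
    ultimately show "\<exists>r\<in>mat_polys UNIV. r z \<noteq> 0 \<and> {z. r z \<noteq> 0} \<subseteq> T" using h(2)
      by (intro bexI[where x = "\<lambda>z. p (matrix_inv h ** z ** h)"] conjI) auto
  qed
  moreover have "Q = T \<inter> VV"
  proof (intro equalityI subsetI)
    fix z assume z: "z \<in> Q"
    then obtain h where h: "h \<in> HH" "z = h ** R.E ** matrix_inv h" unfolding Q_def by blast
    have "matrix_inv (matrix_inv h) = h"
      using h(1) by (intro matrix_inv_eqI matrix_inv_mult invertible_mem) (simp add: HH_iff)
    then have "matrix_inv h ** z ** h = R.E" using conj_back[OF h(1), of R.E] h(2) by simp
    then have "p (matrix_inv h ** z ** h) \<noteq> 0" using pE by simp
    then show "z \<in> T \<inter> VV" using h(1) z Q_V unfolding T_def by blast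
  next
    fix z assume z: "z \<in> T \<inter> VV"
    then obtain h where h: "h \<in> HH" "p (matrix_inv h ** z ** h) \<noteq> 0" unfolding T_def by blast
    note i = matrix_inv_mult[OF invertible_mem, of h]
    have hG: "h \<in> Gd" using h(1) by (simp add: HH_iff)
    have hh: "matrix_inv (matrix_inv h) = h" by (rule matrix_inv_eqI) (rule i[OF hG])
    have "matrix_inv h ** z ** h \<in> VV" using HH_V[OF HH_inv[OF h(1)], of z] z by (simp add: hh)
    then have "matrix_inv h ** z ** h \<in> Q" using main h(2) by blast
    then have "h ** (matrix_inv h ** z ** h) ** matrix_inv h \<in> Q" by (rule Q_trans[OF h(1)])
    moreover have "h ** (matrix_inv h ** z ** h) ** matrix_inv h = (h ** matrix_inv h) ** z ** (h ** matrix_inv h)"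
      by (simp only: matrix_mul_assoc)
    ultimately show "z \<in> Q" by (simp add: i[OF hG])
  qed
  ultimately show ?thesis unfolding openin_subtopology openin_zariski Q_def by blast
qed

lemma x_elem_eq: "x_elem phi = R.E"
  using R.drho(3)[OF curve_uc[of 1]] by (simp add: x_elem_def rho_def[abs_def])

lemma tempered_imp_open:
  assumes "tempered v Gd phi"
  shows "open_parameter v Gd act Fr phi"
proof -
  note V = V_iff[OF assms]
  have EV: "R.E \<in> VV" using E_mm R.wt_E by (simp add: V)
  have "mat 1 \<in> HH" using one_mem act_one by (simp add: HH_iff)
  moreover have "R.E = mat 1 ** R.E ** matrix_inv (mat 1)" by (simp add: matrix_inv_eqI[of "mat 1" "mat 1"])
  ultimately have "R.E \<in> {h ** R.E ** matrix_inv h | h. h \<in> HH}" by blast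
  then show ?thesis
    unfolding open_parameter_def Let_def x_elem_eq using open_orbit[OF V] EV by blast
qed

end

section \<open>Arthur type\<close>

lemma trace_br: "trace (br A B ** C) = trace (A ** br B C)"
proof -
  have "trace (B ** A ** C) = trace (A ** C ** B)"
    using trace_mul_sym[of B "A ** C"] by (simp add: matrix_mul_assoc)
  then show ?thesis by (simp add: br_def matrix_ring_simps trace_sub)
qed

lemma trace_minus: "trace (- A) = - trace (A :: complex^'n^'n)"
  by (simp add: trace_def sum_negf)

text \<open>Invariance of the trace form. The right side does not involve \<open>h\<close>, so all
  \<open>h\<close> with [h, e] = 2e pair equally with g, even when h and f belong to different
  triples.\<close>

lemma trace_sl2_triple:
  assumes "br h e = 2 *\<^sub>c e" "br e f = g"
  shows "trace (g ** h) = 2 * trace (f ** e)"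
proof -
  have "br f e = - g" using assms(2) br_anti[of f e] by simp
  then have "trace (g ** h) = - trace (br f e ** h)"
    by (simp add: matrix_minus_left trace_minus)
  also have "\<dots> = - trace (f ** br e h)" by (simp add: trace_br)
  also have "br e h = - (2 *\<^sub>c e)" using assms(1) br_anti[of e h] by simp
  finally show ?thesis by (simp add: matrix_minus_right cscale_mult_right trace_cscale trace_minus)
qed

text \<open>If \<open>e\<close> and \<open>e + t e'\<close> are conjugate for commuting sl2-triples \<open>(e, h, f)\<close> and \<open>(e', h', f')\<close>,
  then \<open>h\<close> and \<open>h + h'\<close> have the same square trace, since this depends only on the conjugacy class of the
  nilpotent element.\<close>

lemma conjugate_triple_trace:
  fixes k k' :: "complex^'n^'n"
  assumes h1: "br h1 e1 = 2 *\<^sub>c e1" and ef1: "br e1 f1 = h1"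
    and h2: "br h2 e2 = 2 *\<^sub>c e2" and ef2: "br e2 f2 = h2"
    and c: "br h1 e2 = 0" "br h2 e1 = 0" "br e1 f2 = 0" "br e2 f1 = 0" "br h1 f2 = 0"
    and k: "k' ** k = mat 1" and conj: "k ** e1 ** k' = e1 + t *\<^sub>c e2" and t: "t \<noteq> 0"
  shows "trace (h2 ** h2) = 0"
proof -
  have cmul: "(k ** A ** k') ** (k ** B ** k') = k ** (A ** B) ** k'" for A B
  proof -
    have "(k ** A ** k') ** (k ** B ** k') = k ** A ** (k' ** k) ** B ** k'" by (simp only: matrix_mul_assoc)
    then show ?thesis by (simp add: k matrix_mul_assoc)
  qed
  have cbr: "br (k ** A ** k') (k ** B ** k') = k ** br A B ** k'" for A B
    by (simp only: br_def cmul matrix_diff_ldistrib matrix_diff_rdistrib)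
  have ctr: "trace (k ** A ** k') = trace A" for A
    using trace_mul_sym[of k "A ** k'"] by (simp add: matrix_mul_assoc[symmetric] k)
  let ?e = "e1 + t *\<^sub>c e2" and ?f = "k ** f1 ** k'" and ?h = "k ** h1 ** k'"
  \<comment> \<open>The factor 1/t cancels t in the bracket [t e2, f2 / t] = h2, so that
    [e1 + t e2, ?fD] is h1 + h2.\<close>
  let ?fD = "f1 + inverse t *\<^sub>c f2" and ?hD = "h1 + h2"
  have left: "br (A + B) C = br A C + br B C" for A B C :: "complex^'n^'n"
    by (simp add: br_def matrix_ring_simps)
  have 1: "br ?h ?e = 2 *\<^sub>c ?e"
    using cbr[of h1 e1] by (simp only: conj h1 cscale_mult_left cscale_mult_right)
  have 2: "br ?e ?f = ?h" using cbr[of e1 f1] by (simp only: conj ef1)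
  have 3: "br ?hD ?e = 2 *\<^sub>c ?e"
    by (simp add: left br_add_right br_cscale_right h1 h2 c cscale_add_right mult.commute)
  have 4: "br ?e ?fD = ?hD"
    using t by (simp add: left br_add_right br_cscale_right br_cscale_left ef1 ef2 c)
  \<comment> \<open>\<open>?hD\<close> and \<open>?h\<close> are neutral elements for the same
    nilpotent \<open>?e\<close>, so one factor at a time can be exchanged.\<close>
  have "trace (?hD ** ?hD) = trace (?hD ** ?h)"
    using trace_sl2_triple[OF 3 4] trace_sl2_triple[OF 1 4] by simp
  also have "\<dots> = trace (?h ** ?hD)" by (rule trace_mul_sym)
  also have "\<dots> = trace (?h ** ?h)"
    using trace_sl2_triple[OF 3 2] trace_sl2_triple[OF 1 2] by simp
  also have "\<dots> = trace (h1 ** h1)" by (simp only: cmul ctr)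
  finally have "trace (h1 ** h2) + trace (h2 ** h1) + trace (h2 ** h2) = 0"
    by (simp add: matrix_add_ldistrib matrix_add_rdistrib trace_add algebra_simps)
  \<comment> \<open>As h2 = [e2, f2], invariance moves the bracket onto [f2, h1], which
    vanishes.\<close>
  moreover have "trace (h2 ** h1) = 0"
    using trace_br[of e2 f2 h1] br_anti[of f2 h1] by (simp add: ef2 c trace_def)
  moreover have "trace (h1 ** h2) = trace (h2 ** h1)" by (rule trace_mul_sym)
  ultimately show ?thesis by simp
qed

text \<open>With the first argument frozen its coordinates become constants; this makes the
  restriction of an Arthur parameter to the second SL2 regular.\<close>

lemma polyfuns_fix_first:
  fixes p :: "(complex^2^2) \<times> (complex^2^2) \<Rightarrow> complex"
  assumes "p \<in> polyfuns UNIV ({f. \<exists>k l. f = (\<lambda>(x, y). x $ k $ l)} \<union> {f. \<exists>k l. f = (\<lambda>(x, y). y $ k $ l)})"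
  shows "(\<lambda>y. p (a, y)) \<in> mat_polys UNIV"
  using assms
proof induction
  case (const c)
  show ?case unfolding mat_polys_def by (rule polyfuns.const) simp
next
  case (coord f)
  then consider k l where "f = (\<lambda>(x, y). x $ k $ l)" | k l where "f = (\<lambda>(x, y). y $ k $ l)" by blast
  then show ?case
  proof cases
    case 1
    show ?thesis unfolding 1 mat_polys_def prod.case by (rule polyfuns.const) simp
  next
    case 2
    show ?thesis unfolding 2 prod.case by (rule coord_mat_polys)
  qed
next
  case (add f g)
  then show ?case unfolding mat_polys_def by (intro polyfuns.add)
next
  case (mult f g)
  then show ?case unfolding mat_polys_def by (intro polyfuns.mult)
qed

context langlands_datum
begin

lemma tempered_imp_arthur_type:
  assumes temp: "tempered v Gd phi"
  shows "arthur_type v Gd act Fr phi"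
proof -
  define psi where "psi = (\<lambda>(w, x, y::complex^2^2). phi (w, x))"
  have psi: "psi (w, x, y) = phi (w, x)" for w x y by (simp add: psi_def)
  note p = par[unfolded langlands_parameter_def]
  have hom: "psi \<in> hom (weil v \<times>\<times> (matgroup SL2 \<times>\<times> matgroup SL2)) LG"
  proof (rule homI)
    fix a :: "('f alg_closure \<Rightarrow> 'f alg_closure) \<times> (complex^2^2) \<times> (complex^2^2)"
    assume "a \<in> carrier (weil v \<times>\<times> (matgroup SL2 \<times>\<times> matgroup SL2))"
    then obtain w x y where a: "a = (w, x, y)" "w \<in> W" "x \<in> SL2" "y \<in> SL2"
      by (auto simp: DirProd_def)
    then show "psi a \<in> carrier LG" using phi_mem by (simp add: psi)
    fix b :: "('f alg_closure \<Rightarrow> 'f alg_closure) \<times> (complex^2^2) \<times> (complex^2^2)"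
    assume "b \<in> carrier (weil v \<times>\<times> (matgroup SL2 \<times>\<times> matgroup SL2))"
    then obtain w' x' y' where b: "b = (w', x', y')" "w' \<in> W" "x' \<in> SL2" "y' \<in> SL2"
      by (auto simp: DirProd_def)
    have "a \<otimes>\<^bsub>weil v \<times>\<times> (matgroup SL2 \<times>\<times> matgroup SL2)\<^esub> b = (w \<circ> w', x ** x', y ** y')"
      by (simp add: a(1) b(1) DirProd_def weil_mult GL_def)
    then show "psi (a \<otimes>\<^bsub>weil v \<times>\<times> (matgroup SL2 \<times>\<times> matgroup SL2)\<^esub> b) = psi a \<otimes>\<^bsub>LG\<^esub> psi b"
      using phi_mult[OF a(2) b(2) a(3) b(3)] by (simp add: psi a(1) b(1))
  qed
  have cont: "continuous_map (prod_topology (weil_topology v) (prod_topology (top_of_set SL2) (top_of_set SL2)))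
      (L_topology v Gd) psi"
  proof -
    have "continuous_map (prod_topology (weil_topology v) (prod_topology (top_of_set SL2) (top_of_set (SL2 :: (complex^2^2) set))))
      (prod_topology (weil_topology v) (top_of_set SL2)) (\<lambda>a. (fst a, fst (snd a)))"
      by (intro continuous_map_pairedI continuous_map_fst
          continuous_map_compose[OF continuous_map_snd continuous_map_fst, unfolded o_def])
    moreover have "continuous_map (prod_topology (weil_topology v) (top_of_set SL2)) (L_topology v Gd) phi"
      using p by (elim conjE)
    ultimately have "continuous_map (prod_topology (weil_topology v) (prod_topology (top_of_set SL2) (top_of_set (SL2 :: (complex^2^2) set))))
      (L_topology v Gd) (phi \<circ> (\<lambda>a. (fst a, fst (snd a))))"
      by (rule continuous_map_compose)
    moreover have "phi \<circ> (\<lambda>a. (fst a, fst (snd a))) = psi" by (simp add: fun_eq_iff psi_def case_prod_beta)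
    ultimately show ?thesis by simp
  qed
  have poly: "\<exists>p \<in> polyfuns UNIV ({f. \<exists>k l. f = (\<lambda>(x, y). x $ k $ l)} \<union> {f. \<exists>k l. f = (\<lambda>(x, y). y $ k $ l)}).
      \<forall>x\<in>SL2. \<forall>y\<in>SL2. fst (psi (id, x, y)) $ i $ j = p (x, y)" for i j
  proof -
    have "regular_on SL2 (\<lambda>x. rho x $ i $ j)" using R.rho_regular by (simp add: regular_map_on_def)
    then obtain p k where p: "p \<in> mat_polys UNIV" "\<forall>g\<in>SL2. rho g $ i $ j = p g / det g ^ k"
      unfolding regular_on_def by (elim bexE exE)
    have "(\<lambda>z::(complex^2^2) \<times> (complex^2^2). p (fst z)) \<in> polyfuns UNIV ({f. \<exists>k l. f = (\<lambda>(x, y). x $ k $ l)} \<union> {f. \<exists>k l. f = (\<lambda>(x, y). y $ k $ l)})"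
    proof (rule polyfuns_compose[OF p(1)])
      fix i j :: 2
      have "(\<lambda>z::(complex^2^2) \<times> (complex^2^2). fst z $ i $ j) = (\<lambda>(x, y). x $ i $ j)"
        by (simp add: fun_eq_iff)
      then show "(\<lambda>z::(complex^2^2) \<times> (complex^2^2). fst z $ i $ j) \<in>
          polyfuns UNIV ({f. \<exists>k l. f = (\<lambda>(x, y). x $ k $ l)} \<union> {f. \<exists>k l. f = (\<lambda>(x, y). y $ k $ l)})"
        by (intro polyfuns.coord) blast
    qed
    moreover have "fst (psi (id, x, y)) $ i $ j = p (fst (x, y))" if "x \<in> SL2" for x y :: "complex^2^2"
      using p(2) that by (simp add: psi rho_def SL2_def)
    ultimately show ?thesis by (intro bexI[where x = "\<lambda>z. p (fst z)"]) auto
  qed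
  have "arthur_parameter v Gd act Fr psi"
    unfolding arthur_parameter_def
  proof (intro conjI hom cont ballI allI poly)
    show "snd (psi (w, x, y)) = w" if "w \<in> W" "x \<in> SL2" for w x y using phi_snd[OF that] by (simp add: psi)
    show "L_semisimple v Gd act (psi (Fr, mat 1, mat 1))" using p by (simp add: psi)
    show "bounded_in Gd ((\<lambda>w. fst (psi (w, mat 1, mat 1))) ` W)"
      using temp by (simp add: psi tempered_def)
  qed
  then show ?thesis unfolding arthur_type_def by (intro exI[of _ psi]) (simp add: psi)
qed

lemma open_arthur_imp_tempered:
  assumes op: "open_parameter v Gd act Fr phi" and ar: "arthur_type v Gd act Fr phi"
  shows "tempered v Gd phi"
proof -
  obtain psi where psi: "arthur_parameter v Gd act Fr psi"
    and phi_psi: "\<And>w x. w \<in> W \<Longrightarrow> x \<in> SL2 \<Longrightarrow> phi (w, x) = psi (w, x, dg (of_real (nd w)))"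
    using ar unfolding arthur_type_def norm_diag_dg by blast
  note p = psi[unfolded arthur_parameter_def]
  have psi_hom: "psi \<in> hom (weil v \<times>\<times> (matgroup SL2 \<times>\<times> matgroup SL2)) LG" using p by (elim conjE)
  have psi_snd: "snd (psi (w, x, y)) = w" if "w \<in> W" "x \<in> SL2" "y \<in> SL2" for w x y using p that by simp
  have psi_mem: "fst (psi (w, x, y)) \<in> Gd" if "w \<in> W" "x \<in> SL2" "y \<in> SL2" for w x y
  proof -
    have "psi (w, x, y) \<in> carrier LG"
      using psi_hom that by (auto simp: hom_def DirProd_def)
    then show ?thesis by (simp add: L_carrier)
  qed
  have psi_mult: "fst (psi (w \<circ> u, x ** x', y ** y')) = fst (psi (w, x, y)) ** act w (fst (psi (u, x', y')))"
    if "w \<in> W" "u \<in> W" "x \<in> SL2" "x' \<in> SL2" "y \<in> SL2" "y' \<in> SL2" for w u x x' y y'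
  proof -
    have "psi ((w, x, y) \<otimes>\<^bsub>weil v \<times>\<times> (matgroup SL2 \<times>\<times> matgroup SL2)\<^esub> (u, x', y')) = psi (w, x, y) \<otimes>\<^bsub>LG\<^esub> psi (u, x', y')"
      by (rule hom_mult[OF psi_hom]) (use that in \<open>simp_all add: DirProd_def\<close>)
    then have "psi (w \<circ> u, x ** x', y ** y') = psi (w, x, y) \<otimes>\<^bsub>LG\<^esub> psi (u, x', y')"
      by (simp add: DirProd_def weil_mult GL_def)
    then show ?thesis using psi_snd that by (simp add: L_mult)
  qed
  define sg where "sg y = fst (psi (id, mat 1, y))" for y
  define r where "r x y = fst (psi (id, x, y))" for x y
  have r_mem: "r x y \<in> Gd" if "x \<in> SL2" "y \<in> SL2" for x y
    unfolding r_def by (rule psi_mem) (use that weil_id in auto)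
  have r_mult: "r (x ** x') (y ** y') = r x y ** r x' y'"
    if "x \<in> SL2" "x' \<in> SL2" "y \<in> SL2" "y' \<in> SL2" for x x' y y'
    using psi_mult[OF weil_id weil_id that] r_mem[OF that(2,4)] act_id by (simp add: r_def)
  have sg_r: "sg y = r (mat 1) y" for y by (simp add: sg_def r_def)
  have r_one: "r (mat 1) (mat 1) = mat 1"
  proof -
    let ?a = "r (mat 1) (mat 1)"
    have "?a ** ?a = ?a" using r_mult[OF SL2_one SL2_one SL2_one SL2_one] by simp
    then have "matrix_inv ?a ** (?a ** ?a) = matrix_inv ?a ** ?a" by simp
    then show ?thesis
      by (simp add: matrix_mul_assoc matrix_inv_mult(1)[OF invertible_mem[OF r_mem[OF SL2_one SL2_one]]])
  qed
  \<comment> \<open>The norm of \<open>id\<close> is not evaluated. Instead x = 1 shows that the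
    second SL2 sends \<open>dg\<close> of its square root to the identity, and this factor then
    drops out for every x.\<close>
  have rho_r: "rho x = r x (mat 1)" if x: "x \<in> SL2" for x
  proof -
    let ?d = "dg (of_real (nd id))"
    have 1: "rho x = r x ?d" if "x \<in> SL2" for x unfolding rho_def r_def using phi_psi[OF weil_id that] by simp
    have "r (x ** mat 1) (mat 1 ** ?d) = r x (mat 1) ** r (mat 1) ?d"
      by (rule r_mult) (use x SL2_one nd_SL2 in auto)
    moreover have "r (mat 1) ?d = mat 1" using 1[OF SL2_one] rho_one' by (rule subst)
    ultimately show ?thesis using 1[OF x] by simp
  qed
  interpret S: SL2_rep sg
  proof
    show "sg (mat 1) = mat 1" by (simp add: sg_r r_one)
    show "sg (A ** B) = sg A ** sg B" if "A \<in> SL2" "B \<in> SL2" for A B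
      using r_mult[OF SL2_one SL2_one that] by (simp add: sg_r)
    show "regular_map_on SL2 sg"
      unfolding regular_map_on_def
    proof (intro allI)
      fix i j
      have "\<exists>p \<in> polyfuns UNIV ({f. \<exists>k l. f = (\<lambda>(x, y). x $ k $ l)} \<union> {f. \<exists>k l. f = (\<lambda>(x, y). y $ k $ l)}).
        \<forall>x\<in>SL2. \<forall>y\<in>SL2. fst (psi (id, x, y)) $ i $ j = p (x, y)" using p by simp
      then obtain P where P: "P \<in> polyfuns UNIV ({f. \<exists>k l. f = (\<lambda>(x, y). x $ k $ l)} \<union> {f. \<exists>k l. f = (\<lambda>(x, y). y $ k $ l)})"
        "\<forall>x\<in>SL2. \<forall>y\<in>SL2. fst (psi (id, x, y)) $ i $ j = P (x, y)" by (elim bexE)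
      have *: "\<forall>g\<in>SL2. sg g $ i $ j = P (mat 1, g) / det g ^ 0" using P(2) SL2_one[where 'a = complex] by (simp add: sg_def)
      show "regular_on SL2 (\<lambda>g. sg g $ i $ j)"
        unfolding regular_on_def
        by (rule bexI[OF _ polyfuns_fix_first[OF P(1), of "mat 1"]], rule exI[where x = 0], rule *)
    qed
  qed
  have r_split: "r x y = rho x ** sg y" "rho x ** sg y = sg y ** rho x" if "x \<in> SL2" "y \<in> SL2" for x y
    using r_mult[OF that(1) SL2_one SL2_one that(2)] r_mult[OF SL2_one that(1,2) SL2_one] rho_r[OF that(1)]
    by (simp_all add: sg_r)
  have comm: "br (R.drho A) (S.drho B) = 0" if \<gamma>: "curve_in SL2 \<gamma> A" and \<delta>: "curve_in SL2 \<delta> B" for \<gamma> \<delta> A B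
  proof -
    have m: "\<gamma> t \<in> SL2" "\<delta> t \<in> SL2" for t using \<gamma> \<delta> by (simp_all add: curve_in_def)
    have 1: "R.drho A ** sg y = sg y ** R.drho A" if y: "y \<in> SL2" for y
    proof -
      have "((\<lambda>t. rho (\<gamma> t) ** sg y) has_vector_derivative R.drho A ** sg y) (at 0)"
        by (rule bounded_linear.has_vector_derivative[OF bounded_linear_matrix_right R.drho(2)[OF \<gamma>]])
      moreover have "((\<lambda>t. sg y ** rho (\<gamma> t)) has_vector_derivative sg y ** R.drho A) (at 0)"
        by (rule bounded_linear.has_vector_derivative[OF bounded_linear_matrix_left R.drho(2)[OF \<gamma>]])
      ultimately show ?thesis unfolding r_split(2)[OF m(1) y] by (rule vector_derivative_unique_at)
    qed
    have "((\<lambda>t. R.drho A ** sg (\<delta> t)) has_vector_derivative R.drho A ** S.drho B) (at 0)"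
      by (rule bounded_linear.has_vector_derivative[OF bounded_linear_matrix_left S.drho(2)[OF \<delta>]])
    moreover have "((\<lambda>t. sg (\<delta> t) ** R.drho A) has_vector_derivative S.drho B ** R.drho A) (at 0)"
      by (rule bounded_linear.has_vector_derivative[OF bounded_linear_matrix_right S.drho(2)[OF \<delta>]])
    ultimately have "R.drho A ** S.drho B = S.drho B ** R.drho A"
      unfolding 1[OF m(2)] by (rule vector_derivative_unique_at)
    then show ?thesis by (simp add: br_def)
  qed
  have cu: "curve_in SL2 (\<lambda>s. uc (of_real s * 1)) sl_e" and cl: "curve_in SL2 (\<lambda>s. lc (of_real s * 1)) sl_f"
    using curve_uc[of 1] curve_lc[of 1] by simp_all
  have curve: "curve_in Gd (\<lambda>s. rho (uc (of_real s * a)) ** sg (uc (of_real s * b))) (a *\<^sub>c R.E + b *\<^sub>c S.E)" for a b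
  proof -
    have "((\<lambda>s. rho (uc (of_real s * a)) ** sg (uc (of_real s * b))) has_vector_derivative
        rho (uc (of_real 0 * a)) ** S.drho (b *\<^sub>c sl_e) + R.drho (a *\<^sub>c sl_e) ** sg (uc (of_real 0 * b))) (at (0::real))"
      by (rule has_vector_derivative_matrix_mult[OF R.drho(2)[OF curve_uc] S.drho(2)[OF curve_uc]])
    then show ?thesis
      unfolding curve_in_def using r_split(1)[OF uc_SL2 uc_SL2] r_mem[OF uc_SL2 uc_SL2]
      by (simp add: uc_0 rho_one' S.rho_one clinearD[OF R.drho(1)] clinearD[OF S.drho(1)] add.commute)
  qed
  \<comment> \<open>Since \<open>lam w\<close> is psi(w, d, d) with the same torus element d in both
    copies of SL2, both nilpotents are scaled by the same norm.\<close>
  have inV: "R.E + t *\<^sub>c S.E \<in> VV" for t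
  proof -
    let ?Z = "R.E + t *\<^sub>c S.E"
    have c0: "curve_in Gd (\<lambda>s. rho (uc (of_real s * 1)) ** sg (uc (of_real s * t))) ?Z" using curve[of 1 t] by simp
    have "Ad (lam w) ?Z = weil_norm v Fr w *\<^sub>R ?Z" if w: "w \<in> W" for w
    proof -
      let ?n = "of_real (nd w) :: complex"
      let ?m = "?n\<^sup>2" and ?g = "fst (lam w)"
      have n0: "?n \<noteq> 0" using nd_pos[of w] by simp
      have sw: "snd (lam w) = w" unfolding lam_eq using w nd_SL2 by (rule phi_snd)
      have lam_psi: "lam w = psi (w, dg ?n, dg ?n)" unfolding lam_eq by (rule phi_psi[OF w nd_SL2])
      have gi: "?g ** matrix_inv ?g = mat 1"
        using matrix_inv_mult(2)[OF invertible_mem] lam_mem[OF w] by (simp add: L_carrier)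
      \<comment> \<open>Conjugation by diag(n, 1/n) scales the upper entry by n^2; this is where the
        norm arises from its square root.\<close>
      have swap: "dg ?n ** uc c = uc (?m * c) ** dg ?n" for c
        using n0 by (simp add: dg_def uc_def mat2_mult power2_eq_square field_simps)
      have cj: "conjL (lam w) (r (uc a) (uc b)) = r (uc (?m * a)) (uc (?m * b))" for a b
      proof -
        have "?g ** act w (r (uc a) (uc b)) = fst (psi (w \<circ> id, dg ?n ** uc a, dg ?n ** uc b))"
          unfolding r_def lam_psi by (rule psi_mult[symmetric]) (use w weil_id nd_SL2 uc_SL2 in auto)
        also have "\<dots> = fst (psi (id \<circ> w, uc (?m * a) ** dg ?n, uc (?m * b) ** dg ?n))" by (simp add: swap)
        also have "\<dots> = r (uc (?m * a)) (uc (?m * b)) ** act id ?g"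
          unfolding r_def lam_psi by (rule psi_mult) (use w weil_id nd_SL2 uc_SL2 in auto)
        also have "act id ?g = ?g" using lam_mem[OF w] by (simp add: act_id L_carrier)
        finally have "?g ** act w (r (uc a) (uc b)) ** matrix_inv ?g = r (uc (?m * a)) (uc (?m * b)) ** (?g ** matrix_inv ?g)"
          by (simp add: matrix_mul_assoc)
        then show ?thesis by (simp add: conjL_def sw gi)
      qed
      have "((\<lambda>s. conjL (lam w) (rho (uc (of_real s * 1)) ** sg (uc (of_real s * t)))) has_vector_derivative
          ?m *\<^sub>c R.E + (?m * t) *\<^sub>c S.E) (at (0::real))"
        using curve[of ?m "?m * t"] cj[of "of_real s * 1" "of_real s * t" for s]
        by (simp add: curve_in_def r_split(1)[OF uc_SL2 uc_SL2] mult_ac)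
      then have "Ad (lam w) ?Z = ?m *\<^sub>c R.E + (?m * t) *\<^sub>c S.E"
        by (rule L_Ad_eqI[OF lam_mem[OF w] c0])
      also have "\<dots> = of_real (weil_norm v Fr w) *\<^sub>c ?Z"
        by (simp add: cscale_add_right nd_square[symmetric])
      finally show ?thesis by (simp only: cscale_of_real)
    qed
    then show ?thesis using lie_algebra_curve[OF c0] by (simp add: V_space_def)
  qed
  obtain y where y: "openin (subtopology zariski VV) {h ** y ** matrix_inv h | h. h \<in> HH}"
    "R.E \<in> {h ** y ** matrix_inv h | h. h \<in> HH}"
    using op unfolding open_parameter_def Let_def x_elem_eq by blast
  obtain T where T: "zariski_open T" "{h ** y ** matrix_inv h | h. h \<in> HH} = T \<inter> VV"
    using y(1) unfolding openin_subtopology openin_zariski by blast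
  have "R.E \<in> T" using y(2) T(2) by blast
  then obtain g where g: "g \<in> mat_polys UNIV" "g R.E \<noteq> 0" "{B. g B \<noteq> 0} \<subseteq> T"
    using T(1) unfolding zariski_open_def by blast
  obtain P where P: "\<forall>t. g (R.E + t *\<^sub>c S.E) = poly P t" using mat_poly_affine_line[OF g(1)] ..
  \<comment> \<open>The value at t = 0 is \<open>g R.E\<close>, which is nonzero. So only finitely
    many t are excluded, and a nonzero t with R.E + t S.E in the orbit remains.\<close>
  have "P \<noteq> 0" using g(2) spec[OF P, of 0] by auto
  then have "finite (insert 0 {t. poly P t = 0})" using poly_roots_finite by simp
  then obtain t where t: "t \<notin> insert 0 {t. poly P t = 0}" using ex_new_if_finite infinite_UNIV_char_0 by blast
  then have t0: "t \<noteq> 0" and "g (R.E + t *\<^sub>c S.E) \<noteq> 0" using P by auto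
  then have "R.E + t *\<^sub>c S.E \<in> T \<inter> VV" using g(3) inV by blast
  then obtain h1 where h1: "h1 \<in> HH" "R.E + t *\<^sub>c S.E = h1 ** y ** matrix_inv h1" unfolding T(2)[symmetric] by blast
  obtain h0 where h0: "h0 \<in> HH" "R.E = h0 ** y ** matrix_inv h0" using y(2) by blast
  have i: "matrix_inv h0 ** h0 = mat 1" "matrix_inv h1 ** h1 = mat 1" "h0 ** matrix_inv h0 = mat 1"
    using matrix_inv_mult[OF invertible_mem, of h0] matrix_inv_mult[OF invertible_mem, of h1] h0(1) h1(1)
    by (simp_all add: HH_iff)
  have tr: "trace (S.H ** S.H) = 0"
  proof (rule conjugate_triple_trace[OF _ R.br_EF _ S.br_EF _ _ _ _ _ _ _ t0])
    show "br R.H R.E = 2 *\<^sub>c R.E" using R.wt_H[OF R.wt_E] by simp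
    show "br S.H S.E = 2 *\<^sub>c S.E" using S.wt_H[OF S.wt_E] by simp
    show "br R.H S.E = 0" by (rule comm[OF curve_dg cu])
    show "br S.H R.E = 0" using comm[OF cu curve_dg] br_anti[of S.H R.E] by simp
    show "br R.E S.F = 0" by (rule comm[OF cu cl])
    show "br S.E R.F = 0" using comm[OF cl cu] br_anti[of S.E R.F] by simp
    show "br R.H S.F = 0" by (rule comm[OF curve_dg cl])
    have "(h0 ** matrix_inv h1) ** (h1 ** matrix_inv h0) = h0 ** (matrix_inv h1 ** h1) ** matrix_inv h0"
      by (simp only: matrix_mul_assoc)
    then show "(h0 ** matrix_inv h1) ** (h1 ** matrix_inv h0) = mat 1" by (simp add: i)
    have "(h1 ** matrix_inv h0) ** (h0 ** y ** matrix_inv h0) ** (h0 ** matrix_inv h1) =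
        h1 ** (matrix_inv h0 ** h0) ** y ** (matrix_inv h0 ** h0) ** matrix_inv h1"
      by (simp only: matrix_mul_assoc)
    then show "(h1 ** matrix_inv h0) ** R.E ** (h0 ** matrix_inv h1) = R.E + t *\<^sub>c S.E"
      by (simp add: i h1(2) h0(2)[symmetric])
  qed
  \<comment> \<open>phi(w, 1) is psi(w, 1, d) with d in the torus of the second SL2. The vanishing
    trace makes this torus act trivially, so the bounded element psi(w, 1, 1) is left.\<close>
  have "fst (phi (w, mat 1)) = fst (psi (w, mat 1, mat 1))" if w: "w \<in> W" for w
  proof -
    let ?d = "dg (of_real (nd w))"
    have "fst (psi (w \<circ> id, mat 1 ** mat 1, mat 1 ** ?d)) = fst (psi (w, mat 1, mat 1)) ** act w (fst (psi (id, mat 1, ?d)))"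
      by (rule psi_mult) (use w weil_id SL2_one nd_SL2 in auto)
    moreover have "fst (psi (id, mat 1, ?d)) = mat 1"
      using S.torus_trivial[OF tr, of "of_real (nd w)"] nd_pos[of w] by (simp add: sg_def)
    ultimately show ?thesis using phi_psi[OF w SL2_one] act_one[OF w] by simp
  qed
  then have "(\<lambda>w. fst (phi (w, mat 1))) ` W = (\<lambda>w. fst (psi (w, mat 1, mat 1))) ` W" by (intro image_cong) auto
  moreover have "bounded_in Gd ((\<lambda>w. fst (psi (w, mat 1, mat 1))) ` W)" using p by (elim conjE)
  ultimately show ?thesis by (simp add: tempered_def)
qed

end

theorem proposition4p1:
  fixes v :: "'f::field_char_0 \<Rightarrow> real"
    and G B T :: "('f alg_closure^'n^'n) set"
    and Gd Bd Td :: "(complex^'m^'m) set"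
    and pin :: "(complex^'m^'m \<Rightarrow> complex) \<Rightarrow> complex \<Rightarrow> complex^'m^'m"
    and act :: "('f alg_closure \<Rightarrow> 'f alg_closure) \<Rightarrow> complex^'m^'m \<Rightarrow> complex^'m^'m"
    and Fr :: "'f alg_closure \<Rightarrow> 'f alg_closure"
    and phi :: "('f, 'm::finite) L_param"
  assumes "padic_field v"
    and "connected_reductive G"
    and "quasi_split (range to_ac) G"
    and "dual_group_datum v G B T Gd Bd Td pin act"
    and "frobenius_element v Fr"
    and "langlands_parameter v Gd act Fr phi"
  shows "tempered v Gd phi \<longleftrightarrow>
         open_parameter v Gd act Fr phi \<and> arthur_type v Gd act Fr phi"
proof -
  note d = assms(4)[unfolded dual_group_datum_def]
  have red: "connected_reductive Gd" using d by (elim conjE)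
  have act: "\<forall>w\<in>carrier (weil v).
        act w \<in> iso (matgroup Gd) (matgroup Gd) \<and> regular_map_on Gd (act w) \<and>
        act w ` Bd = Bd \<and> act w ` Td = Td \<and>
        (\<forall>b\<in>simple_roots Bd Td. \<forall>c. act w (pin b c) = pin (dual_char act Td w b) c)"
    using d by (elim conjE)
  have act_id: "\<forall>g\<in>Gd. act id g = g" using d by (elim conjE)
  have act_comp: "\<forall>w\<in>carrier (weil v). \<forall>u\<in>carrier (weil v). \<forall>g\<in>Gd. act (w \<circ> u) g = act w (act u g)"
    using d by (elim conjE)
  have act_finite: "\<exists>A. finite A \<and> (\<forall>w\<in>carrier (weil v). (\<forall>x\<in>A. w x = x) \<longrightarrow> (\<forall>g\<in>Gd. act w g = g))"
    using d by (elim conjE)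
  have hom: "act w \<in> hom (matgroup Gd) (matgroup Gd)" if "w \<in> carrier (weil v)" for w
    using act that by (simp add: iso_def)
  interpret langlands_datum Gd v act Fr phi
  proof
    show "algebraic_group Gd" using red by (simp add: connected_reductive_def connected_group_def)
    show "act w g \<in> Gd" if "w \<in> carrier (weil v)" "g \<in> Gd" for w g
      using hom[OF that(1)] that(2) by (auto simp: hom_def)
    show "act w (g ** h) = act w g ** act w h" if "w \<in> carrier (weil v)" "g \<in> Gd" "h \<in> Gd" for w g h
      using hom_mult[OF hom[OF that(1)], of g h] that(2,3) by (simp add: GL_def)
    show "regular_map_on Gd (act w)" if "w \<in> carrier (weil v)" for w using act that by simp
    show "act id g = g" if "g \<in> Gd" for g using act_id that by simp
    show "act (w \<circ> u) g = act w (act u g)" if "w \<in> carrier (weil v)" "u \<in> carrier (weil v)" "g \<in> Gd" for w u g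
      using act_comp that by simp
  qed (rule assms act_finite)+
  show ?thesis
    using tempered_imp_open tempered_imp_arthur_type open_arthur_imp_tempered by blast
qed

end
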